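(* Let $x\in D_1$, $\nu,\mu\in\mathbb{C}$, $\nu+\mu\notin-\mathbb{N}$, $\nu+\frac12\notin\mathbb{Z}$. Then, for the upper sign chosen everywhere as well as for the lower sign chosen everywhere, $$\mathsf{Q}_\nu^\mu(x)=\frac{\sqrt{\pi}}{2^{\frac32}(1-x^2)^{\frac14}}\Bigg[e^{\pm\frac{i\pi}{2}(\mu+\frac12)}\frac{\Gamma(\nu+\frac12)}{\Gamma(\nu-\mu+1)}\big(x\pm i\sqrt{1-x^2}\big)^{\nu+\frac12}{}_2F_1\!\left(\tfrac12+\mu,\tfrac12-\mu;\tfrac12-\nu;\frac{\mp x+i\sqrt{1-x^2}}{2i\sqrt{1-x^2}}\right)$$ $$+\,e^{\mp\frac{i\pi}{2}(\mu+\frac12)}\frac{\Gamma(\nu+\mu+1)}{\Gamma(\nu+\frac32)}\left(1+e^{\pm i\pi(\nu+\mu)}\frac{\cos(\pi\mu)}{\cos(\pi\nu)}\right)\big(x\mp i\sqrt{1-x^2}\big)^{\nu+\frac12}{}_2F_1\!\left(\tfrac12+\mu,\tfrac12-\mu;\nu+\tfrac32;\frac{\mp x+i\sqrt{1-x^2}}{2i\sqrt{1-x^2}}\right)\Bigg],$$ or equivalently, for $\operatorname{Re}\theta\in(0,\pi)$, $$\mathsf{Q}_\nu^\mu(\cos\theta)=\frac{\sqrt{\pi}}{2^{\frac32}\sqrt{\sin\theta}}\Bigg[e^{\pm\frac{i\pi}{2}(\mu+\frac12)}\frac{\Gamma(\nu+\frac12)}{\Gamma(\nu-\mu+1)}e^{\pm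 i(\nu+\frac12)\theta}{}_2F_1\!\left(\tfrac12+\mu,\tfrac12-\mu;\tfrac12-\nu;\tfrac12\pm\tfrac{i}{2}\cot\theta\right)$$ $$+\,e^{\mp\frac{i\pi}{2}(\mu+\frac12)}\frac{\Gamma(\nu+\mu+1)}{\Gamma(\nu+\frac32)}\left(1+e^{\pm i\pi(\nu+\mu)}\frac{\cos(\pi\mu)}{\cos(\pi\nu)}\right)e^{\mp i(\nu+\frac12)\theta}{}_2F_1\!\left(\tfrac12+\mu,\tfrac12-\mu;\nu+\tfrac32;\tfrac12\pm\tfrac{i}{2}\cot\theta\right)\Bigg].$$
   Context: $\mathbb{N}=\{1,2,3,\dots\}$, $-\mathbb{N}=\{-1,-2,\dots\}$. $D_1=\mathbb{C}\setminus((-\infty,-1]\cup[1,\infty))$, $D_2=\mathbb{C}\setminus(-\infty,1]$. Complex powers and roots are principal values. ${}_2F_1(a,b;c;w)$ is the Gauss hypergeometric function, principal branch on $\mathbb{C}\setminus[1,\infty)$ (the analytic continuation of $\sum_{n\ge0}\frac{(a)_n(b)_n}{(c)_n}\frac{w^n}{n!}$). $1/\Gamma$ is read as the entire function (zero at the poles of $\Gamma$). Associated Legendre function of the second kind: for $z\in D_2$, $\nu+\mu\in\mathbb{C}\setminus-\mathbb{N}$, $$Q_\nu^\mu(z)=\frac{\sqrt{\pi}\,e^{i\pi\mu}\Gamma(\nu+\mu+1)(z^2-1)^{\frac12\mu}}{2^{\nu+1}\Gamma(\nu+\frac32)z^{\nu+\mu+1}}\,{}_2F_1\!\left(\tfrac{\nu+\mu+2}{2},\tfrac{\nu+\mu+1}{2};\nu+\tfrac32;\tfrac1{z^2}\right),$$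 where $(z^2-1)^\alpha:=(z+1)^\alpha(z-1)^\alpha$. Ferrers function of the second kind: for $x\in(-1,1)$, $$\mathsf{Q}_\nu^\mu(x)=\tfrac12\big[e^{-\frac12 i\pi\mu}\,e^{-i\pi\mu}Q_\nu^\mu(x+i0)+e^{\frac12 i\pi\mu}\,e^{-i\pi\mu}Q_\nu^\mu(x-i0)\big],$$ where $x\pm i0$ denotes the limit from the upper/lower half-plane, and $\mathsf{Q}_\nu^\mu$ is extended analytically to $D_1$. *)

theory Defs
  imports "HOL-Complex_Analysis.Complex_Analysis"
begin

text \<open>
  All complex powers are \<open>powr\<close>, i.e. principal values, and \<open>csqrt\<close> is the principal root.
  Reciprocals \<open>1/\<Gamma>\<close> are written with the entire function \<^const>\<open>rGamma\<close>.
\<close>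

definition D1 :: "complex set" where
  "D1 = - {complex_of_real t | t. t \<le> -1 \<or> 1 \<le> t}"

definition hyp2F1_domain :: "complex set" where
  "hyp2F1_domain = - {complex_of_real t | t. 1 \<le> t}"

text \<open>
  The principal branch of the Gauss hypergeometric function: the analytic continuation of the
  Gauss series from the unit disc to the plane cut along \<open>[1,\<infinity>)\<close>. The continuation is unique
  because the domain is connected; values on the cut are unspecified. As usual, the definition is
  meaningful only if \<open>c\<close> is not a nonpositive integer.
\<close>
definition hyp2F1 :: "complex \<Rightarrow> complex \<Rightarrow> complex \<Rightarrow> complex \<Rightarrow> complex" where
  "hyp2F1 a b c = (SOME f. f holomorphic_on hyp2F1_domain \<and>
     (\<forall>w. norm w < 1 \<longrightarrow>
        (\<lambda>n. pochhammer a n * pochhammer b n / pochhammer c n * w ^ n / fact n) sums f w))"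

text \<open>
  The associated Legendre function of the second kind on the plane cut along \<open>(-\<infinity>,1]\<close>, for
  \<open>\<nu> + \<mu>\<close> not a negative integer. The power of \<open>z\<^sup>2 - 1\<close> is the product of the principal powers of
  \<open>z + 1\<close> and \<open>z - 1\<close>. For \<open>\<nu> + 3/2\<close> a nonpositive integer one would need the regularised
  hypergeometric function; that case is not covered by this definition.
\<close>
definition legendre_Q :: "complex \<Rightarrow> complex \<Rightarrow> complex \<Rightarrow> complex" where
  "legendre_Q \<nu> \<mu> z =
     complex_of_real (sqrt pi) * exp (\<i> * pi * \<mu>) * Gamma (\<nu> + \<mu> + 1)
       * ((z + 1) powr (\<mu> / 2) * (z - 1) powr (\<mu> / 2))
       * rGamma (\<nu> + 3/2) / (2 powr (\<nu> + 1) * z powr (\<nu> + \<mu> + 1))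
       * hyp2F1 ((\<nu> + \<mu> + 2) / 2) ((\<nu> + \<mu> + 1) / 2) (\<nu> + 3/2) (1 / z\<^sup>2)"

definition legendre_Q_upper :: "complex \<Rightarrow> complex \<Rightarrow> real \<Rightarrow> complex" where
  "legendre_Q_upper \<nu> \<mu> x = Lim (at (of_real x) within {z. Im z > 0}) (legendre_Q \<nu> \<mu>)"

definition legendre_Q_lower :: "complex \<Rightarrow> complex \<Rightarrow> real \<Rightarrow> complex" where
  "legendre_Q_lower \<nu> \<mu> x = Lim (at (of_real x) within {z. Im z < 0}) (legendre_Q \<nu> \<mu>)"

text \<open>The Ferrers function of the second kind, first on the interval \<open>(-1,1)\<close> \<dots>\<close>
definition ferrers_Q_real :: "complex \<Rightarrow> complex \<Rightarrow> real \<Rightarrow> complex" where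
  "ferrers_Q_real \<nu> \<mu> x =
     (exp (- (\<i> * pi * \<mu> / 2)) * exp (- (\<i> * pi * \<mu>)) * legendre_Q_upper \<nu> \<mu> x
      + exp (\<i> * pi * \<mu> / 2) * exp (- (\<i> * pi * \<mu>)) * legendre_Q_lower \<nu> \<mu> x) / 2"

text \<open>\<dots> and then its (unique) analytic continuation to \<^const>\<open>D1\<close>.\<close>
definition ferrers_Q :: "complex \<Rightarrow> complex \<Rightarrow> complex \<Rightarrow> complex" where
  "ferrers_Q \<nu> \<mu> = (SOME f. f holomorphic_on D1 \<and>
     (\<forall>x::real. -1 < x \<and> x < 1 \<longrightarrow> f (of_real x) = ferrers_Q_real \<nu> \<mu> x))"

end

(* A second-order equation with a regular singular point has only one holomorphic solution with
   prescribed nonzero value there, so identities between hypergeometric functions reduce to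
   checking the hypergeometric equation. The substitution s = 4 t / (1 + t)^2 maps the unit disc
   onto the plane cut along [1,oo) and turns this equation into one whose power series solution
   converges in the whole disc; this gives the principal branch of 2F1. The same substitution,
   with t = exp (-2 i theta), followed by Pfaff's transformation, turns the definition of the
   Legendre function at cos theta into a formula that extends continuously across (-1,1). The
   boundary values from the two sides involve 2F1 at w and at 1 - w, where
   w = 1/2 + (i/2) cot theta, and the connection formula between 0 and 1 eliminates one of them. *)
theory Submission
  imports Defs
begin

section \<open>The hypergeometric equation at the origin\<close>

text \<open>Both \<open>hyp2F1\<close> and \<open>ferrers_Q\<close> are chosen by
  \<open>SOME\<close>, so nothing can be said about either before a function with the required
  property has been exhibited. The Gauss series reaches only the unit disc, which is why the
  equation and not the series carries the argument. The second obstacle is the value of the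
  connection coefficients. The point 1 lies on the cut, and the coefficient can be read off as a
  limit there only if Re (c - a - b) > 0, which here would restrict \<nu>. Existence of the
  coefficients is therefore separated from their evaluation: constancy of weighted Wronskians gives
  the former, and integer shifts of c into the region where the limit is available give the latter.
  The parameters of the final formula come from \<alpha> = \<nu> + \<mu> + 1 and c = \<nu> + 3/2:
  the substitution produces \<alpha> - c + 1 = 1/2 + \<mu>, and Pfaff's transformation replaces
  \<alpha> by c - \<alpha> = 1/2 - \<mu>. As these two add up to 1, c - a - b is \<nu> + 1/2, and
  the single condition on \<nu> gives both nonintegrality conditions of the connection formula. The
  two signs in the result say which of w and 1 - w is kept.\<close>

lemma has_fps_expansion_0_imp_zero:
  fixes f :: "complex \<Rightarrow> complex"
  assumes "f has_fps_expansion 0" "f holomorphic_on S" "open S" "connected S" "0 \<in> S" "w \<in> S"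
  shows "f w = 0"
proof -
  have "eventually (\<lambda>z. 0 = f z) (nhds 0)"
    using assms(1) by (simp add: has_fps_expansion_def)
  then obtain T where T: "open T" "0 \<in> T" "\<And>z. z \<in> T \<Longrightarrow> f z = 0"
    unfolding eventually_nhds by metis
  show ?thesis
    by (rule analytic_continuation_open[of "S \<inter> T" S f "\<lambda>_. 0"]) (use assms T in auto)
qed

definition hyp2F1_ode :: "complex \<Rightarrow> complex \<Rightarrow> complex \<Rightarrow> complex set \<Rightarrow> (complex \<Rightarrow> complex) \<Rightarrow> bool" where
  "hyp2F1_ode a b c S y \<longleftrightarrow> y holomorphic_on S \<and>
     (\<forall>w\<in>S. w * (1 - w) * deriv (deriv y) w + (c - (a + b + 1) * w) * deriv y w - a * b * y w = 0)"

lemma hyp2F1_odeI: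
  assumes "open S"
    and y: "\<And>w. w \<in> S \<Longrightarrow> (y has_field_derivative y1 w) (at w)"
    and y1: "\<And>w. w \<in> S \<Longrightarrow> (y1 has_field_derivative y2 w) (at w)"
    and eq: "\<And>w. w \<in> S \<Longrightarrow> w * (1 - w) * y2 w + (c - (a + b + 1) * w) * y1 w - a * b * y w = 0"
  shows "hyp2F1_ode a b c S y"
proof -
  have 1: "deriv y w = y1 w" if "w \<in> S" for w
    using y[OF that] by (rule DERIV_imp_deriv)
  have 2: "deriv (deriv y) w = y2 w" if w: "w \<in> S" for w
    by (rule DERIV_imp_deriv, rule has_field_derivative_transform_within_open[OF y1[OF w] assms(1) w]) (simp add: 1)
  have "y holomorphic_on S"
    using assms(1) y by (auto simp: holomorphic_on_open)
  then show ?thesis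
    unfolding hyp2F1_ode_def by (auto simp: 1 2 eq)
qed

definition hyp2F1_fps :: "complex \<Rightarrow> complex \<Rightarrow> complex \<Rightarrow> complex fps" where
  "hyp2F1_fps a b c = Abs_fps (\<lambda>n. pochhammer a n * pochhammer b n / (pochhammer c n * fact n))"

lemma hyp2F1_fps_nth_Suc:
  "fps_nth (hyp2F1_fps a b c) (Suc n) =
     (a + of_nat n) * (b + of_nat n) / ((c + of_nat n) * of_nat (Suc n)) * fps_nth (hyp2F1_fps a b c) n"
  by (simp add: hyp2F1_fps_def pochhammer_Suc field_simps)

lemma nonpos_Ints_add_of_nat_nonzero:
  assumes "(c::complex) \<notin> \<int>\<^sub>\<le>\<^sub>0"
  shows "c + of_nat n \<noteq> 0"
  using assms by (metis add_eq_0_iff2 minus_of_nat_in_nonpos_Ints)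

text \<open>The coefficient of w^n in the equation gives (n + c)(n + 1) Y_(n+1) = (n + a)(n + b)
  Y_n. Since n + c never vanishes, the value 1 at the origin determines the whole series.\<close>

lemma hyp2F1_ode_unique_fps:
  assumes ode: "hyp2F1_ode a b c S y" and S: "open S" "0 \<in> S" and y0: "y 0 = 1" and c: "c \<notin> \<int>\<^sub>\<le>\<^sub>0"
  shows "y has_fps_expansion hyp2F1_fps a b c"
proof -
  define Y where "Y = fps_expansion y 0"
  have holo: "y holomorphic_on S" using ode by (simp add: hyp2F1_ode_def)
  have Y[fps_expansion_intros]: "y has_fps_expansion Y"
    using S holo unfolding Y_def by blast
  define L where "L = fps_X * fps_deriv (fps_deriv Y) - fps_X * (fps_X * fps_deriv (fps_deriv Y))
    + fps_const c * fps_deriv Y - fps_const (a + b + 1) * (fps_X * fps_deriv Y) - fps_const (a * b) * Y"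
  have "(\<lambda>w. w * deriv (deriv y) w - w * (w * deriv (deriv y) w) + c * deriv y w
          - (a + b + 1) * (w * deriv y w) - a * b * y w) has_fps_expansion L"
    unfolding L_def by (intro fps_expansion_intros has_fps_expansion_const)
  then have "(\<lambda>w. 0) has_fps_expansion L"
    by (rule has_fps_expansion_cong[THEN iffD1, rotated -1])
       (use ode S in \<open>auto simp: hyp2F1_ode_def eventually_nhds algebra_simps\<close>)
  then have "L = 0"
    using fps_expansion_unique_complex has_fps_expansion_0 by blast
  have "fps_nth L n = (of_nat n + c) * of_nat (Suc n) * fps_nth Y (Suc n)
          - (of_nat n + a) * (of_nat n + b) * fps_nth Y n" for n
    unfolding L_def by (cases n; cases "n - 1") (auto simp: algebra_simps)
  with \<open>L = 0\<close> have rec: "(of_nat n + c) * of_nat (Suc n) * fps_nth Y (Suc n) = (of_nat n + a) * (of_nat n + b) * fps_nth Y n" for n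
    by (metis fps_zero_nth right_minus_eq)
  have "fps_nth Y n = fps_nth (hyp2F1_fps a b c) n" for n
  proof (induction n)
    case 0
    then show ?case by (simp add: Y_def fps_expansion_def hyp2F1_fps_def y0)
  next
    case (Suc n)
    have "c + of_nat n \<noteq> 0" using c by (rule nonpos_Ints_add_of_nat_nonzero)
    then show ?case
      using rec[of n] unfolding hyp2F1_fps_nth_Suc Suc[symmetric]
      by (simp add: divide_simps del: of_nat_Suc) (simp add: algebra_simps)
  qed
  then have "Y = hyp2F1_fps a b c" by (simp add: fps_eq_iff)
  then show ?thesis using Y by simp
qed

section \<open>The cut plane, and recognising the principal branch by its series\<close>

lemma hyp2F1_domain_iff: "w \<in> hyp2F1_domain \<longleftrightarrow> 1 - w \<notin> \<real>\<^sub>\<le>\<^sub>0"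
  by (auto simp: hyp2F1_domain_def complex_nonpos_Reals_iff complex_eq_iff)

lemma open_hyp2F1_domain: "open hyp2F1_domain"
proof -
  have "hyp2F1_domain = (\<lambda>w. 1 - w) -` (- \<real>\<^sub>\<le>\<^sub>0)"
    by (auto simp: hyp2F1_domain_iff)
  moreover have "open ((\<lambda>w. 1 - w) -` (- \<real>\<^sub>\<le>\<^sub>0 :: complex set))"
    by (intro open_vimage open_Compl closed_nonpos_Reals_complex continuous_intros)
  ultimately show ?thesis by simp
qed

lemma connected_hyp2F1_domain: "connected hyp2F1_domain"
proof (rule starlike_imp_connected)
  have "closed_segment 0 w \<subseteq> hyp2F1_domain" if w: "w \<in> hyp2F1_domain" for w
  proof
    fix x assume "x \<in> closed_segment 0 w"
    then obtain u where u: "0 \<le> u" "u \<le> 1" "x = of_real u * w"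
      by (auto simp: in_segment scaleR_conv_of_real)
    show "x \<in> hyp2F1_domain"
    proof (cases "Im w = 0")
      case True
      then have "Re w < 1" using w by (auto simp: hyp2F1_domain_iff complex_nonpos_Reals_iff)
      then have "u * Re w < 1" using u
        by (smt (verit) mult_left_le_one_le mult_nonneg_nonpos)
      then show ?thesis using u True by (auto simp: hyp2F1_domain_iff complex_nonpos_Reals_iff)
    next
      case False
      then show ?thesis using u by (cases "u = 0") (auto simp: hyp2F1_domain_iff complex_nonpos_Reals_iff)
    qed
  qed
  then show "starlike hyp2F1_domain"
    by (auto simp: starlike_def intro!: bexI[of _ 0]) (auto simp: hyp2F1_domain_iff)
qed

lemma ball_subset_hyp2F1_domain: "ball 0 1 \<subseteq> hyp2F1_domain"
proof
  fix w :: complex assume "w \<in> ball 0 1"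
  then have "Re w < 1" using abs_Re_le_cmod[of w] by auto
  then show "w \<in> hyp2F1_domain" by (auto simp: hyp2F1_domain_iff complex_nonpos_Reals_iff)
qed

lemma hyp2F1_domain_0 [simp]: "0 \<in> hyp2F1_domain"
  using ball_subset_hyp2F1_domain by auto

text \<open>Such an f is a witness for the choice in \<open>hyp2F1\<close>, so the chosen function
  has the same property. Both are sums of one series on the unit disc and agree on the connected cut
  plane by analytic continuation.\<close>

lemma hyp2F1_eqI:
  assumes holo: "f holomorphic_on hyp2F1_domain" and f: "f has_fps_expansion hyp2F1_fps a b c"
    and w: "w \<in> hyp2F1_domain"
  shows "hyp2F1 a b c w = f w"
proof -
  define P where "P = (\<lambda>g. g holomorphic_on hyp2F1_domain \<and> (\<forall>w. norm w < 1 \<longrightarrow>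
     (\<lambda>n. pochhammer a n * pochhammer b n / pochhammer c n * w ^ n / fact n) sums g w))"
  have exp: "fps_expansion f 0 = hyp2F1_fps a b c"
    using f fps_nth_fps_expansion[OF f] by (simp add: fps_expansion_def fps_eq_iff)
  have "(\<lambda>n. pochhammer a n * pochhammer b n / pochhammer c n * w ^ n / fact n) sums f w" if "norm w < 1" for w
  proof -
    have "(\<lambda>n. (deriv ^^ n) f 0 / fact n * (w - 0) ^ n) sums f w"
      by (rule holomorphic_power_series[of f 0 1])
        (use that holo ball_subset_hyp2F1_domain in \<open>auto intro: holomorphic_on_subset\<close>)
    then show ?thesis
      by (simp add: fps_nth_fps_expansion[OF f, symmetric] hyp2F1_fps_def mult_ac)
  qed
  then have "P f" using holo by (simp add: P_def)
  then have Q: "P (hyp2F1 a b c)" unfolding hyp2F1_def P_def[symmetric] by (rule someI[of P])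
  show ?thesis
  proof (rule analytic_continuation_open[of "ball 0 1" hyp2F1_domain "hyp2F1 a b c" f])
    fix z :: complex assume "z \<in> ball 0 1"
    then show "hyp2F1 a b c z = f z" using \<open>P f\<close> Q unfolding P_def
      by (auto intro: sums_unique2)
  qed (use w Q holo ball_subset_hyp2F1_domain open_hyp2F1_domain connected_hyp2F1_domain in \<open>auto simp: P_def\<close>)
qed

lemma hyp2F1_eqI_ode:
  assumes "hyp2F1_ode a b c hyp2F1_domain y" "y 0 = 1" "c \<notin> \<int>\<^sub>\<le>\<^sub>0" "w \<in> hyp2F1_domain"
  shows "hyp2F1 a b c w = y w"
  by (rule hyp2F1_eqI)
     (use assms hyp2F1_ode_unique_fps[OF assms(1) open_hyp2F1_domain] in \<open>auto simp: hyp2F1_ode_def\<close>)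

section \<open>The principal branch\<close>

text \<open>In the limit the recurrence becomes k (n + 2) = k n, with characteristic roots 1 and -1,
  so the terms grow more slowly than any geometric sequence of ratio above 1. Bounding the larger of
  two consecutive terms makes this elementary.\<close>

lemma conv_radius_ge_1_of_recurrence:
  fixes k P Q :: "nat \<Rightarrow> complex"
  assumes rec: "\<And>n. k (Suc (Suc n)) = P n * k (Suc n) + Q n * k n"
    and P: "P \<longlonglongrightarrow> 0" and Q: "Q \<longlonglongrightarrow> 1"
  shows "conv_radius k \<ge> 1"
proof (rule conv_radius_geI_ex')
  fix r :: real assume r: "0 < r" "ereal r < 1"
  then have r1: "r < 1" by simp
  \<comment> \<open>With this choice \<rho> * r = (1 + r) / 2 < 1, while norm (P n) + norm (Q n) <
    \<rho> from N on.\<close>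
  define \<epsilon> where "\<epsilon> = (1 - r) / (4 * r)"
  define \<rho> where "\<rho> = 1 + 2 * \<epsilon>"
  have \<epsilon>: "\<epsilon> > 0" using r r1 by (simp add: \<epsilon>_def)
  have \<rho>: "\<rho> \<ge> 1" "\<rho> * r < 1" using \<epsilon> r r1 by (auto simp: \<rho>_def \<epsilon>_def field_simps)
  define M where "M n = max (norm (k n)) (norm (k (Suc n)))" for n
  have "\<forall>\<^sub>F n in sequentially. norm (P n) < \<epsilon>"
    using tendsto_norm[OF P] \<epsilon> by (auto intro: order_tendstoD)
  moreover have "\<forall>\<^sub>F n in sequentially. norm (Q n) < 1 + \<epsilon>"
    using tendsto_norm[OF Q] \<epsilon> by (auto intro: order_tendstoD)
  ultimately have "\<forall>\<^sub>F n in sequentially. norm (P n) < \<epsilon> \<and> norm (Q n) < 1 + \<epsilon>"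
    by eventually_elim auto
  then obtain N where N: "norm (P n) < \<epsilon>" "norm (Q n) < 1 + \<epsilon>" if "n \<ge> N" for n
    by (auto simp: eventually_sequentially)
  have M0: "M n \<ge> 0" for n by (simp add: M_def le_max_iff_disj)
  have step: "M (Suc n) \<le> \<rho> * M n" if "n \<ge> N" for n
  proof -
    have "norm (k (Suc (Suc n))) \<le> norm (P n) * norm (k (Suc n)) + norm (Q n) * norm (k n)"
      unfolding rec by (metis norm_mult norm_triangle_ineq)
    also have "\<dots> \<le> \<epsilon> * M n + (1 + \<epsilon>) * M n"
      using N[OF that] \<epsilon> by (intro add_mono mult_mono) (auto simp: M_def)
    also have "\<dots> = \<rho> * M n" by (simp add: \<rho>_def algebra_simps)
    finally have *: "norm (k (Suc (Suc n))) \<le> \<rho> * M n" .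
    have "norm (k (Suc n)) \<le> M n" by (simp add: M_def)
    also have "\<dots> \<le> \<rho> * M n" using \<rho> M0[of n] by (simp add: mult_le_cancel_right1)
    finally show ?thesis using * by (simp add: M_def[of "Suc n"])
  qed
  have bound: "M (N + m) \<le> \<rho> ^ m * M N" for m
  proof (induction m)
    case (Suc m)
    have "M (N + Suc m) \<le> \<rho> * M (N + m)" using step[of "N + m"] by simp
    also have "\<dots> \<le> \<rho> * (\<rho> ^ m * M N)" using Suc \<rho> by (intro mult_left_mono) auto
    finally show ?case by (simp add: mult_ac)
  qed simp
  show "summable (\<lambda>n. k n * of_real r ^ n)"
  proof (rule summable_comparison_test'[of "\<lambda>n. M N * (\<rho> * r) ^ n" N])
    show "summable (\<lambda>n. M N * (\<rho> * r) ^ n)"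
      using \<rho> r by (intro summable_mult summable_geometric) auto
    fix n assume "n \<ge> N"
    then obtain m where m: "n = N + m" using le_Suc_ex by blast
    have "norm (k n) \<le> \<rho> ^ m * M N" using bound[of m] by (simp add: m M_def)
    also have "\<dots> \<le> \<rho> ^ n * M N"
      using \<rho> M0 by (intro mult_right_mono power_increasing) (auto simp: m)
    finally have "norm (k n) * r ^ n \<le> \<rho> ^ n * M N * r ^ n"
      using r by (intro mult_right_mono) auto
    then show "norm (k n * of_real r ^ n) \<le> M N * (\<rho> * r) ^ n"
      using r by (simp add: norm_mult norm_power power_mult_distrib mult_ac)
  qed
qed

text \<open>
  The hypergeometric equation for \<open>(1 + t) powr (2 * a) * K t\<close>, rewritten in the variable \<open>t\<close> with
  \<open>s = 4 * t / (1 + t)\<^sup>2\<close>. Splitting off the power keeps the recurrence for the coefficients of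
  \<open>K\<close> at three terms.
\<close>
definition koebe_ode :: "complex \<Rightarrow> complex \<Rightarrow> complex \<Rightarrow> (complex \<Rightarrow> complex) \<Rightarrow> bool" where
  "koebe_ode a b c K \<longleftrightarrow> K holomorphic_on ball 0 1 \<and>
     (\<forall>t\<in>ball 0 1. t * (1 - t\<^sup>2) * deriv (deriv K) t
        + (c + (2 * c - 4 * b) * t + (c - 2 - 4 * a) * t\<^sup>2) * deriv K t
        + 2 * a * ((c - 2 * b) + (c - 1 - 2 * a) * t) * K t = 0)"

lemma tendsto_inverse_of_nat_add:
  "(\<lambda>n. x / (of_nat n + z :: complex)) \<longlonglongrightarrow> 0"
  by (intro tendsto_divide_0[OF tendsto_const] tendsto_add_filterlim_at_infinity'[OF _ tendsto_const] tendsto_of_nat)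

text \<open>Comparison of coefficients in \<open>koebe_ode\<close>: the second clause comes from
  t^0, the third from t^(n+1), divided by the factor (n + 2)(n + 1 + c) of the highest
  coefficient.\<close>

fun koebe_coeff :: "complex \<Rightarrow> complex \<Rightarrow> complex \<Rightarrow> nat \<Rightarrow> complex" where
  "koebe_coeff a b c 0 = 1"
| "koebe_coeff a b c (Suc 0) = - 2 * a * (c - 2 * b) / c"
| "koebe_coeff a b c (Suc (Suc n)) =
     - ((2 * c - 4 * b) * (of_nat n + 1) + 2 * a * (c - 2 * b)) / ((of_nat n + 2) * (of_nat n + (1 + c)))
         * koebe_coeff a b c (Suc n)
     + (of_nat n * (of_nat n - 1) - (c - 2 - 4 * a) * of_nat n - 2 * a * (c - 1 - 2 * a))
         / ((of_nat n + 2) * (of_nat n + (1 + c))) * koebe_coeff a b c n"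

text \<open>The leading factor t (1 - t^2) vanishes only at 0, 1 and -1, so no singular point other
  than the centre lies in the open disc. In coefficients this shows as the limits 0 and 1 required
  by \<open>conv_radius_ge_1_of_recurrence\<close>.\<close>

lemma koebe_ode_solution:
  assumes c: "c \<notin> \<int>\<^sub>\<le>\<^sub>0"
  obtains K where "koebe_ode a b c K" "K 0 = 1"
proof -
  define k where "k = koebe_coeff a b c"
  have nz: "of_nat n + (1 + c) \<noteq> 0" "of_nat n + 2 \<noteq> (0 :: complex)" for n
  proof -
    show "of_nat n + (1 + c) \<noteq> 0"
      using nonpos_Ints_add_of_nat_nonzero[OF c, of "Suc n"] by (simp add: algebra_simps)
    show "of_nat n + 2 \<noteq> (0 :: complex)"
      by (metis add_2_eq_Suc' nat.distinct(1) of_nat_add of_nat_eq_0_iff of_nat_numeral)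
  qed
  have "c \<noteq> 0" using c by auto
  have rad: "conv_radius k \<ge> 1"
  proof (rule conv_radius_ge_1_of_recurrence)
    \<comment> \<open>Both coefficients are divided with remainder by (n + 2)(n + 1 + c) and split
      into fractions with constant numerators, so that their limits can be read off.\<close>
    show "k (Suc (Suc n)) = - (((2 * c - 4 * b) / (of_nat n + 2)
        + (c - 2 * b) * (2 * a - 2 * c) / (of_nat n + 2) * (1 / (of_nat n + (1 + c))))) * k (Suc n)
      + (1 + (4 * a - 2 - 2 * c) / (of_nat n + (1 + c))
        + (2 + 2 * c - 8 * a - 2 * a * (c - 1 - 2 * a)) / (of_nat n + 2) * (1 / (of_nat n + (1 + c)))) * k n"
      (is "_ = ?P n * _ + ?Q n * _") for n
    proof -
      have fracs: "- (u / x + v / x * (1 / y)) = - (u * y + v) / (x * y)"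
        "1 + u / y + v / x * (1 / y) = (x * y + u * x + v) / (x * y)"
        if "x \<noteq> 0" "y \<noteq> 0" for x y u v :: complex
        using that by (simp_all add: field_simps)
      have "?P n = - ((2 * c - 4 * b) * (of_nat n + 1) + 2 * a * (c - 2 * b)) / ((of_nat n + 2) * (of_nat n + (1 + c)))"
        unfolding fracs(1)[OF nz(2,1)] by (simp add: algebra_simps)
      moreover have "?Q n = (of_nat n * (of_nat n - 1) - (c - 2 - 4 * a) * of_nat n - 2 * a * (c - 1 - 2 * a))
         / ((of_nat n + 2) * (of_nat n + (1 + c)))"
        unfolding fracs(2)[OF nz(2,1)] by (simp add: algebra_simps)
      ultimately show ?thesis by (simp add: k_def)
    qed
    show "?P \<longlonglongrightarrow> 0"
      using tendsto_minus[OF tendsto_add[OF tendsto_inverse_of_nat_add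
          tendsto_mult[OF tendsto_inverse_of_nat_add tendsto_inverse_of_nat_add]]] by simp
    show "?Q \<longlonglongrightarrow> 1"
    proof -
      have "?Q \<longlonglongrightarrow> 1 + 0 + 0 * 0"
        by (intro tendsto_add tendsto_mult tendsto_const tendsto_inverse_of_nat_add)
      then show ?thesis by simp
    qed
  qed
  define F where "F = Abs_fps k"
  have radF: "fps_conv_radius F \<ge> 1" using rad by (simp add: fps_conv_radius_def F_def)
  define K where "K = eval_fps F"
  have holo: "K holomorphic_on ball 0 1"
    unfolding K_def
    by (intro holomorphic_on_eval_fps) (auto intro!: order_less_le_trans[OF _ radF] simp flip: one_ereal_def)
  have KF [fps_expansion_intros]: "K has_fps_expansion F"
    unfolding K_def by (rule eval_fps_has_fps_expansion) (use radF in \<open>auto intro: order_less_le_trans[of 0 1]\<close>)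
  define L where "L = fps_X * fps_deriv (fps_deriv F) - fps_X ^ 3 * fps_deriv (fps_deriv F)
     + (fps_const c * fps_deriv F + fps_const (2 * c - 4 * b) * (fps_X * fps_deriv F)
        + fps_const (c - 2 - 4 * a) * (fps_X ^ 2 * fps_deriv F))
     + (fps_const (2 * a * (c - 2 * b)) * F + fps_const (2 * a * (c - 1 - 2 * a)) * (fps_X * F))"
  have "fps_nth L n = 0" for n
  proof (cases n)
    case 0
    then show ?thesis using \<open>c \<noteq> 0\<close> by (simp add: L_def F_def k_def fps_X_power_mult_nth field_simps)
  next
    case (Suc m)
    define D where "D = (of_nat m + 2) * (of_nat m + (1 + c))"
    have "D \<noteq> 0" using nz[of m] by (simp add: D_def)
    define R where "R = - ((2 * c - 4 * b) * (of_nat m + 1) + 2 * a * (c - 2 * b)) * k (Suc m)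
      + (of_nat m * (of_nat m - 1) - (c - 2 - 4 * a) * of_nat m - 2 * a * (c - 1 - 2 * a)) * k m"
    have R: "k (Suc (Suc m)) * D = R"
      unfolding k_def koebe_coeff.simps D_def[symmetric] R_def using \<open>D \<noteq> 0\<close>
      by (simp add: distrib_right)
    have 1: "fps_nth (fps_X * fps_deriv (fps_deriv F)) (Suc m) = (of_nat m + 1) * (of_nat m + 2) * k (Suc (Suc m))"
      by (simp add: F_def algebra_simps)
    \<comment> \<open>For m < 2 both sides vanish: the factor X^3 shifts past the index, and m (m -
      1) = 0.\<close>
    have 2: "fps_nth (fps_X ^ 3 * fps_deriv (fps_deriv F)) (Suc m) = of_nat m * (of_nat m - 1) * k m"
    proof (cases "m < 2")
      case True
      then show ?thesis by (auto simp: fps_X_power_mult_nth less_2_cases_iff)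
    next
      case False
      then obtain j where "m = Suc (Suc j)" by (metis add_2_eq_Suc le_Suc_ex not_less)
      then show ?thesis by (simp add: F_def fps_X_power_mult_nth)
    qed
    have 3: "fps_nth (fps_X * fps_deriv F) (Suc m) = (of_nat m + 1) * k (Suc m)"
      by (simp add: F_def algebra_simps)
    have 4: "fps_nth (fps_X\<^sup>2 * fps_deriv F) (Suc m) = of_nat m * k m"
      by (cases m) (auto simp: F_def fps_X_power_mult_nth)
    have 5: "fps_nth (fps_deriv F) (Suc m) = (of_nat m + 2) * k (Suc (Suc m))"
      "fps_nth F (Suc m) = k (Suc m)" "fps_nth (fps_X * F) (Suc m) = k m"
      by (simp_all add: F_def algebra_simps)
    have "fps_nth L n = k (Suc (Suc m)) * D - R"
      unfolding L_def D_def R_def Suc fps_add_nth fps_sub_nth fps_mult_left_const_nth 1 2 3 4 5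
      by (simp add: algebra_simps)
    with R show ?thesis by simp
  qed
  then have "L = 0" by (simp add: fps_eq_iff)
  define l where "l t = t * deriv (deriv K) t - t ^ 3 * deriv (deriv K) t
     + (c * deriv K t + (2 * c - 4 * b) * (t * deriv K t)
        + (c - 2 - 4 * a) * (t ^ 2 * deriv K t))
     + (2 * a * (c - 2 * b) * K t + 2 * a * (c - 1 - 2 * a) * (t * K t))" for t
  have "l has_fps_expansion L"
    unfolding L_def l_def [abs_def] by (intro fps_expansion_intros has_fps_expansion_const)
  moreover have "l holomorphic_on ball 0 1"
    unfolding l_def [abs_def] by (intro holomorphic_intros holo holomorphic_deriv) auto
  ultimately have "l t = 0" if "t \<in> ball 0 1" for t
    using has_fps_expansion_0_imp_zero[of l "ball 0 1" t] \<open>L = 0\<close> that by auto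
  then have "koebe_ode a b c K"
    unfolding koebe_ode_def l_def using holo by (auto simp: algebra_simps power2_eq_square power3_eq_cube)
  moreover have "K 0 = 1" by (simp add: K_def eval_fps_at_0 F_def k_def)
  ultimately show ?thesis by (rule that)
qed

text \<open>The inverse, with values in the unit disc, of s = 4 t / (1 + t)^2, which is a reflected
  and rescaled Koebe function. Here 1 - s is the square of (1 - t) / (1 + t), and this quotient has
  positive real part, hence is the principal root, when t lies in the disc.\<close>

definition koebe_inv :: "complex \<Rightarrow> complex" where
  "koebe_inv s = (1 - csqrt (1 - s)) / (1 + csqrt (1 - s))"

lemma csqrt_Re_pos: "z \<notin> \<real>\<^sub>\<le>\<^sub>0 \<Longrightarrow> 0 < Re (csqrt z)"
proof (rule ccontr)
  assume z: "z \<notin> \<real>\<^sub>\<le>\<^sub>0" and "\<not> 0 < Re (csqrt z)"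
  then have "Re (csqrt z) = 0" using csqrt_principal[of z] by auto
  then have "Im ((csqrt z)\<^sup>2) = 0" "Re ((csqrt z)\<^sup>2) \<le> 0" by (auto simp: power2_eq_square)
  then show False using z by (simp add: complex_nonpos_Reals_iff)
qed

lemma koebe_inv_in_ball:
  assumes "s \<in> hyp2F1_domain"
  shows "koebe_inv s \<in> ball 0 1"
proof -
  define r where "r = csqrt (1 - s)"
  have r: "Re r > 0" unfolding r_def using assms by (intro csqrt_Re_pos) (simp add: hyp2F1_domain_iff)
  have "norm (1 - r) < norm (1 + r)"
    using r by (simp add: cmod_def power2_eq_square algebra_simps)
  moreover then have "norm (1 + r) > 0" by (smt (verit) norm_ge_zero)
  ultimately show ?thesis by (simp add: koebe_inv_def r_def[symmetric] norm_divide divide_simps)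
qed

lemma has_field_derivative_powr_const:
  fixes g :: "complex \<Rightarrow> complex"
  assumes g: "(g has_field_derivative g') (at x)" and x: "g x \<notin> \<real>\<^sub>\<le>\<^sub>0"
  shows "((\<lambda>x. g x powr s) has_field_derivative (s * (g x powr s) / g x * g')) (at x)"
proof -
  have "((\<lambda>z. z powr s) \<circ> g has_field_derivative (s * g x powr (s - 1) * g')) (at x)"
    using has_field_derivative_powr[OF x] g by (rule DERIV_chain)
  moreover have "g x powr (s - 1) = g x powr s / g x"
    using x by (auto simp: powr_diff)
  ultimately show ?thesis by (simp add: o_def)
qed

text \<open>In r = csqrt (1 - s) everything except the power E and the values of K is rational: p
  and q are the first two derivatives of t, and E * K(t) has derivative E * G * p. The
  hypergeometric expression turns out to be E / (4 r) times the left-hand side of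
  \<open>koebe_ode\<close> at t.\<close>

lemma koebe_pullback_ode:
  assumes K: "koebe_ode a b c K"
  shows "hyp2F1_ode a b c hyp2F1_domain (\<lambda>s. (1 + koebe_inv s) powr (2 * a) * K (koebe_inv s))"
proof -
  define r where "r s = csqrt (1 - s)" for s
  define t where "t = koebe_inv"
  define p where "p s = 1 / (r s * (1 + r s)\<^sup>2)" for s
  define q where "q s = (1 + 3 * r s) / (2 * (r s) ^ 3 * (1 + r s) ^ 3)" for s
  define E where "E s = (1 + t s) powr (2 * a)" for s
  define K1 K2 where "K1 = deriv K" and "K2 = deriv K1"
  define G where "G s = 2 * a / (1 + t s) * K (t s) + K1 (t s)" for s
  define G' where "G' s = - 2 * a / (1 + t s)\<^sup>2 * p s * K (t s) + 2 * a / (1 + t s) * (K1 (t s) * p s) + K2 (t s) * p s" for s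
  have tr: "t s = (1 - r s) / (1 + r s)" for s by (simp add: t_def koebe_inv_def r_def)
  have K': "(K has_field_derivative K1 z) (at z)" "(K1 has_field_derivative K2 z) (at z)" if "z \<in> ball 0 1" for z
    using K that unfolding koebe_ode_def K1_def K2_def
    by (auto intro!: holomorphic_derivI[of _ "ball 0 1"] holomorphic_deriv)
  show ?thesis
  proof (rule hyp2F1_odeI[OF open_hyp2F1_domain])
    fix s assume s: "s \<in> hyp2F1_domain"
    have s': "1 - s \<notin> \<real>\<^sub>\<le>\<^sub>0" using s by (simp add: hyp2F1_domain_iff)
    have Rer: "Re (r s) > 0" unfolding r_def using s' by (intro csqrt_Re_pos)
    have rnz: "r s \<noteq> 0" "1 + r s \<noteq> 0" using Rer by (auto simp: complex_eq_iff)
    have r2: "(r s)\<^sup>2 = 1 - s" by (simp add: r_def)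
    have tb: "t s \<in> ball 0 1" unfolding t_def by (rule koebe_inv_in_ball[OF s])
    have t1: "1 + t s = 2 / (1 + r s)" using rnz by (simp add: tr field_simps)
    have t1nz: "1 + t s \<noteq> 0" using rnz by (simp add: t1)
    have "Re (1 + t s) > 0" using tb abs_Re_le_cmod[of "t s"] by auto
    then have t1p: "1 + t s \<notin> \<real>\<^sub>\<le>\<^sub>0" by (auto simp: complex_nonpos_Reals_iff)
    have dr [derivative_intros]: "(r has_field_derivative (- 1 / (2 * r s))) (at s)"
      unfolding r_def using s' by (auto intro!: derivative_eq_intros)
    have dt [derivative_intros]: "(t has_field_derivative p s) (at s)"
      unfolding tr [abs_def] p_def using rnz
      by (auto intro!: derivative_eq_intros simp: divide_simps power2_eq_square)
    have dp [derivative_intros]: "(p has_field_derivative q s) (at s)"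
    proof -
      have "(p has_field_derivative (- (- 1 / (2 * r s) * (1 + r s)\<^sup>2 + r s * (2 * (1 + r s) * (- 1 / (2 * r s)))) / (r s * (1 + r s)\<^sup>2)\<^sup>2)) (at s)"
        unfolding p_def [abs_def] using rnz
        by (auto intro!: derivative_eq_intros simp: power2_eq_square)
      also have "(- (- 1 / (2 * r s) * (1 + r s)\<^sup>2 + r s * (2 * (1 + r s) * (- 1 / (2 * r s)))) / (r s * (1 + r s)\<^sup>2)\<^sup>2) = q s"
        using rnz unfolding q_def by (simp add: divide_simps) algebra
      finally show ?thesis .
    qed
    have dE [derivative_intros]: "(E has_field_derivative (2 * a / (1 + t s) * E s * p s)) (at s)"
      unfolding E_def [abs_def]
      by (rule DERIV_cong[OF has_field_derivative_powr_const]) (use t1p in \<open>auto intro!: derivative_eq_intros\<close>)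
    have dK [derivative_intros]: "((\<lambda>s. K (t s)) has_field_derivative (K1 (t s) * p s)) (at s)"
      using DERIV_chain2[OF K'(1)[OF tb] dt] .
    have dK1 [derivative_intros]: "((\<lambda>s. K1 (t s)) has_field_derivative (K2 (t s) * p s)) (at s)"
      using DERIV_chain2[OF K'(2)[OF tb] dt] .
    show "((\<lambda>s. (1 + koebe_inv s) powr (2 * a) * K (koebe_inv s)) has_field_derivative E s * G s * p s) (at s)"
      unfolding t_def[symmetric] E_def[symmetric]
      by (auto intro!: derivative_eq_intros simp: G_def algebra_simps)
    have dG [derivative_intros]: "(G has_field_derivative G' s) (at s)"
      unfolding G_def [abs_def]
      by (rule DERIV_cong, (rule derivative_intros t1nz)+)
         (use t1nz in \<open>simp add: G'_def divide_simps power2_eq_square\<close>)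
    show "((\<lambda>s. E s * G s * p s) has_field_derivative
       (2 * a / (1 + t s) * E s * p s) * G s * p s + E s * G' s * p s + E s * G s * q s) (at s)"
      by (auto intro!: derivative_eq_intros simp: algebra_simps)
    have "t s * (1 - (t s)\<^sup>2) * K2 (t s)
        + (c + (2 * c - 4 * b) * t s + (c - 2 - 4 * a) * (t s)\<^sup>2) * K1 (t s)
        + 2 * a * ((c - 2 * b) + (c - 1 - 2 * a) * t s) * K (t s) = 0" (is "?kode = 0")
      using K tb by (auto simp: koebe_ode_def K1_def K2_def)
    moreover have "s * (1 - s) * ((2 * a / (1 + t s) * E s * p s) * G s * p s + E s * G' s * p s + E s * G s * q s)
         + (c - (a + b + 1) * s) * (E s * G s * p s) - a * b * (E s * K (t s)) = E s / (4 * r s) * ?kode"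
    proof -
      have s2: "s = 1 - (r s)\<^sup>2" using r2 by simp
      \<comment> \<open>R and S stand for r s and 1 + r s, and k, k1, k2 for the values of K and its
        derivatives at t s. Keeping S as a variable of its own leaves the denominators monomial
        until only numerators have to be compared.\<close>
      have key: "(1 - R\<^sup>2) * R\<^sup>2 * ((2 * a / (2 / S) * (1 / (R * S\<^sup>2))) * (2 * a / (2 / S) * k + k1) * (1 / (R * S\<^sup>2))
           + (- 2 * a / (2 / S)\<^sup>2 * (1 / (R * S\<^sup>2)) * k + 2 * a / (2 / S) * (k1 * (1 / (R * S\<^sup>2))) + k2 * (1 / (R * S\<^sup>2))) * (1 / (R * S\<^sup>2))
           + (2 * a / (2 / S) * k + k1) * ((1 + 3 * R) / (2 * R ^ 3 * S ^ 3)))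
         + (c - (a + b + 1) * (1 - R\<^sup>2)) * ((2 * a / (2 / S) * k + k1) * (1 / (R * S\<^sup>2))) - a * b * k
         = 1 / (4 * R) * (((1 - R) / S) * (1 - ((1 - R) / S)\<^sup>2) * k2
        + (c + (2 * c - 4 * b) * ((1 - R) / S) + (c - 2 - 4 * a) * ((1 - R) / S)\<^sup>2) * k1
        + 2 * a * ((c - 2 * b) + (c - 1 - 2 * a) * ((1 - R) / S)) * k)" (is "?l = ?r")
        if "R \<noteq> 0" "S \<noteq> 0" and S: "S = 1 + R" for R S k k1 k2 :: complex
      proof -
        define H where "H = a * S * k + k1"
        have "?l = (1 - R) / S ^ 3 * (a * S * H - a * S\<^sup>2 * k / 2 + a * S * k1 + k2)
            + (1 - R) * (1 + 3 * R) / (2 * R * S\<^sup>2) * H + (c - (a + b + 1) * (1 - R\<^sup>2)) * H / (R * S\<^sup>2) - a * b * k"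
        proof -
          have 1: "2 * a / (2 / S) = a * S" "- 2 * a / (2 / S)\<^sup>2 = - a * S\<^sup>2 / 2"
            using that by (simp_all add: field_simps power2_eq_square)
          have "(1 - R\<^sup>2) = (1 - R) * S" by (simp add: S algebra_simps power2_eq_square)
          then have 2: "(1 - R\<^sup>2) * R\<^sup>2 * (A * (1 / (R * S\<^sup>2)) * (1 / (R * S\<^sup>2))) = (1 - R) / S ^ 3 * A"
              "(1 - R\<^sup>2) * R\<^sup>2 * ((1 + 3 * R) / (2 * R ^ 3 * S ^ 3)) = (1 - R) * (1 + 3 * R) / (2 * R * S\<^sup>2)" for A
            using that by (simp_all add: divide_simps power2_eq_square power3_eq_cube)
          have 3: "?l = (1 - R\<^sup>2) * R\<^sup>2 * ((a * S * H - a * S\<^sup>2 * k / 2 + a * S * k1 + k2) * (1 / (R * S\<^sup>2)) * (1 / (R * S\<^sup>2)))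
             + (1 - R\<^sup>2) * R\<^sup>2 * ((1 + 3 * R) / (2 * R ^ 3 * S ^ 3)) * H
             + (c - (a + b + 1) * (1 - R\<^sup>2)) * H * (1 / (R * S\<^sup>2)) - a * b * k"
            unfolding 1 H_def[symmetric] by (simp add: algebra_simps)
          show ?thesis unfolding 3 unfolding 2 by simp
        qed
        also have "\<dots> = (4 * R * (1 - R) * (a * S * H - a * S\<^sup>2 * k / 2 + a * S * k1 + k2)
            + 2 * (1 - R) * (1 + 3 * R) * S * H + 4 * S * (c - (a + b + 1) * (1 - R\<^sup>2)) * H - 4 * R * S ^ 3 * a * b * k) / (4 * R * S ^ 3)"
          (is "_ = ?n / _")
          using that(1,2) by (simp add: divide_simps power2_eq_square power3_eq_cube)
        also have "?n = (1 - R) * (S\<^sup>2 - (1 - R)\<^sup>2) * k2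
            + S * (c * S\<^sup>2 + (2 * c - 4 * b) * (1 - R) * S + (c - 2 - 4 * a) * (1 - R)\<^sup>2) * k1
            + 2 * a * S\<^sup>2 * ((c - 2 * b) * S + (c - 1 - 2 * a) * (1 - R)) * k"
          unfolding S H_def by (simp add: field_simps power2_eq_square power3_eq_cube)
        also have "\<dots> / (4 * R * S ^ 3) = ?r"
          using that(1,2) by (simp add: divide_simps power2_eq_square power3_eq_cube) (simp add: algebra_simps)
        finally show ?thesis .
      qed
      have "s * (1 - s) * ((2 * a / (1 + t s) * E s * p s) * G s * p s + E s * G' s * p s + E s * G s * q s)
         + (c - (a + b + 1) * s) * (E s * G s * p s) - a * b * (E s * K (t s)) =
         E s * ((1 - (r s)\<^sup>2) * (r s)\<^sup>2 * ((2 * a / (1 + t s) * p s) * G s * p s + G' s * p s + G s * q s)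
         + (c - (a + b + 1) * (1 - (r s)\<^sup>2)) * (G s * p s) - a * b * K (t s))"
        unfolding r2 by (simp add: algebra_simps)
      also have "\<dots> = E s / (4 * r s) * ?kode"
        unfolding G_def G'_def t1 p_def q_def
        using key[OF rnz refl, of "K (t s)" "K1 (t s)" "K2 (t s)"] unfolding tr[of s, symmetric] by simp
      finally show ?thesis .
    qed
    ultimately show "s * (1 - s) * ((2 * a / (1 + t s) * E s * p s) * G s * p s + E s * G' s * p s + E s * G s * q s)
         + (c - (a + b + 1) * s) * (E s * G s * p s) - a * b * ((1 + koebe_inv s) powr (2 * a) * K (koebe_inv s)) = 0"
      unfolding t_def[symmetric] E_def[symmetric] by simp
  qed
qed

section \<open>Transformations and contiguous relations\<close>

lemma hyp2F1_ode_cong: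
  assumes S: "open S" and eq: "\<And>w. w \<in> S \<Longrightarrow> y w = z w" and y: "hyp2F1_ode a b c S y"
  shows "hyp2F1_ode a b c S z"
proof -
  have holo: "z holomorphic_on S"
    using y eq holomorphic_cong[of S S y z] by (simp add: hyp2F1_ode_def)
  have d: "deriv z w = deriv y w" if "w \<in> S" for w
    by (rule deriv_cong_ev) (use S eq that in \<open>auto simp: eventually_nhds\<close>)
  have dd: "deriv (deriv z) w = deriv (deriv y) w" if "w \<in> S" for w
    by (rule deriv_cong_ev) (use S d that in \<open>auto simp: eventually_nhds\<close>)
  show ?thesis using y holo by (auto simp: hyp2F1_ode_def d dd eq)
qed

text \<open>This is where the choice in \<open>hyp2F1\<close> is shown to have a witness: the
  pulled-back solution is holomorphic on the whole cut plane and has value 1 at 0.\<close>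

lemma hyp2F1_ode:
  assumes c: "c \<notin> \<int>\<^sub>\<le>\<^sub>0"
  shows "hyp2F1_ode a b c hyp2F1_domain (hyp2F1 a b c)"
proof -
  obtain K where K: "koebe_ode a b c K" "K 0 = 1"
    using koebe_ode_solution[OF c] by blast
  let ?y = "\<lambda>s. (1 + koebe_inv s) powr (2 * a) * K (koebe_inv s)"
  have y: "hyp2F1_ode a b c hyp2F1_domain ?y" by (rule koebe_pullback_ode[OF K(1)])
  have "?y 0 = 1" using K(2) by (simp add: koebe_inv_def)
  from hyp2F1_eqI_ode[OF y this c] show ?thesis
    by (intro hyp2F1_ode_cong[OF open_hyp2F1_domain _ y]) auto
qed

lemma hyp2F1_0 [simp]:
  assumes c: "c \<notin> \<int>\<^sub>\<le>\<^sub>0"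
  shows "hyp2F1 a b c 0 = 1"
proof -
  obtain K where K: "koebe_ode a b c K" "K 0 = 1"
    using koebe_ode_solution[OF c] by blast
  show ?thesis
    using hyp2F1_eqI_ode[OF koebe_pullback_ode[OF K(1)] _ c, of 0] K(2) by (simp add: koebe_inv_def)
qed

lemma hyp2F1_has_fps_expansion:
  "c \<notin> \<int>\<^sub>\<le>\<^sub>0 \<Longrightarrow> hyp2F1 a b c has_fps_expansion hyp2F1_fps a b c"
  by (rule hyp2F1_ode_unique_fps[OF hyp2F1_ode open_hyp2F1_domain]) auto

lemma hyp2F1_holomorphic: "c \<notin> \<int>\<^sub>\<le>\<^sub>0 \<Longrightarrow> hyp2F1 a b c holomorphic_on hyp2F1_domain"
  using hyp2F1_ode by (simp add: hyp2F1_ode_def)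

lemma hyp2F1_has_field_derivative:
  assumes "c \<notin> \<int>\<^sub>\<le>\<^sub>0" "w \<in> hyp2F1_domain"
  shows "(hyp2F1 a b c has_field_derivative deriv (hyp2F1 a b c) w) (at w)"
    and "(deriv (hyp2F1 a b c) has_field_derivative deriv (deriv (hyp2F1 a b c)) w) (at w)"
  using assms hyp2F1_holomorphic[OF assms(1)] open_hyp2F1_domain
  by (auto intro!: holomorphic_derivI holomorphic_deriv)

lemma hyp2F1_ode_eq:
  assumes "c \<notin> \<int>\<^sub>\<le>\<^sub>0" "w \<in> hyp2F1_domain"
  shows "w * (1 - w) * deriv (deriv (hyp2F1 a b c)) w
    + (c - (a + b + 1) * w) * deriv (hyp2F1 a b c) w - a * b * hyp2F1 a b c w = 0"
  using hyp2F1_ode[OF assms(1)] assms(2) by (auto simp: hyp2F1_ode_def)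

lemma hyp2F1_commute: "hyp2F1 a b c = hyp2F1 b a c"
  by (simp only: hyp2F1_def mult.commute[of "pochhammer a n" "pochhammer b n" for n])

text \<open>For the parameters \<alpha> / 2 and (\<alpha> + 1) / 2 the equation
  \<open>koebe_ode\<close> is 1 + t times the hypergeometric equation with parameters \<alpha>,
  \<alpha> - c + 1, c, so K is known. Since norm t < 1, \<open>koebe_inv\<close> undoes the
  substitution.\<close>

lemma hyp2F1_quadratic:
  assumes c: "c \<notin> \<int>\<^sub>\<le>\<^sub>0" and t: "norm t < 1"
  shows "hyp2F1 (\<alpha> / 2) ((\<alpha> + 1) / 2) c (4 * t / (1 + t)\<^sup>2) = (1 + t) powr \<alpha> * hyp2F1 \<alpha> (\<alpha> - c + 1) c t"
proof -
  let ?K = "hyp2F1 \<alpha> (\<alpha> - c + 1) c"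
  have K: "koebe_ode (\<alpha> / 2) ((\<alpha> + 1) / 2) c ?K"
    unfolding koebe_ode_def
  proof safe
    show "?K holomorphic_on ball 0 1"
      using hyp2F1_holomorphic[OF c] ball_subset_hyp2F1_domain by (rule holomorphic_on_subset)
    fix t :: complex assume "t \<in> ball 0 1"
    then have "t \<in> hyp2F1_domain" using ball_subset_hyp2F1_domain by auto
    from hyp2F1_ode_eq[OF c this, of \<alpha> "\<alpha> - c + 1"]
    have "(1 + t) * (t * (1 - t) * deriv (deriv ?K) t
      + (c - (\<alpha> + (\<alpha> - c + 1) + 1) * t) * deriv ?K t - \<alpha> * (\<alpha> - c + 1) * ?K t) = 0" by simp
    moreover have halves: "4 * ((\<alpha> + 1) / 2) = 2 * (\<alpha> + 1)" "4 * (\<alpha> / 2) = 2 * \<alpha>"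
      "2 * (\<alpha> / 2) = \<alpha>" "2 * ((\<alpha> + 1) / 2) = \<alpha> + 1" by simp_all
    ultimately show "t * (1 - t\<^sup>2) * deriv (deriv ?K) t
        + (c + (2 * c - 4 * ((\<alpha> + 1) / 2)) * t + (c - 2 - 4 * (\<alpha> / 2)) * t\<^sup>2) * deriv ?K t
        + 2 * (\<alpha> / 2) * ((c - 2 * ((\<alpha> + 1) / 2)) + (c - 1 - 2 * (\<alpha> / 2)) * t) * ?K t = 0"
      unfolding halves by (simp add: algebra_simps power2_eq_square)
  qed
  define s where "s = 4 * t / (1 + t)\<^sup>2"
  define r where "r = (1 - t) / (1 + t)"
  have tt: "\<bar>Re t\<bar> < 1" using abs_Re_le_cmod[of t] t by simp
  then have nz: "1 + t \<noteq> 0" "1 - t \<noteq> 0" by (auto simp: complex_eq_iff)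
  have "1 - s = r\<^sup>2" using nz by (simp add: s_def r_def divide_simps power2_eq_square) (simp add: algebra_simps)
  have rpos: "Re r > 0"
  proof -
    have "Re r = (1 - (norm t)\<^sup>2) / (norm (1 + t))\<^sup>2"
      by (simp add: r_def Re_divide cmod_power2) (simp add: power2_eq_square algebra_simps)
    also have "\<dots> > 0" using nz t by (simp add: power_less_one_iff)
    finally show ?thesis .
  qed
  have r: "csqrt (1 - s) = r"
    unfolding \<open>1 - s = r\<^sup>2\<close> by (rule csqrt_square) (use rpos in auto)
  have "1 + r \<noteq> 0" using rpos by (auto simp: complex_eq_iff)
  have inv: "koebe_inv s = t"
    unfolding koebe_inv_def r using \<open>1 + r \<noteq> 0\<close> nz by (simp add: r_def divide_simps)
  have "s \<in> hyp2F1_domain"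
  proof (rule ccontr)
    assume "s \<notin> hyp2F1_domain"
    then have "Im (r\<^sup>2) = 0" "Re (r\<^sup>2) \<le> 0" by (auto simp: hyp2F1_domain_iff \<open>1 - s = r\<^sup>2\<close> complex_nonpos_Reals_iff)
    then show False using rpos by (auto simp: power2_eq_square mult_le_0_iff)
  qed
  from hyp2F1_eqI_ode[OF koebe_pullback_ode[OF K] _ c this] show ?thesis
    by (simp add: inv c s_def[symmetric]) (simp add: koebe_inv_def c)
qed

lemma hyp2F1_pfaff_domain:
  assumes "w \<in> hyp2F1_domain"
  shows "w / (w - 1) \<in> hyp2F1_domain"
proof -
  have "w \<noteq> 1" using assms by (auto simp: hyp2F1_domain_iff)
  then have "1 - w / (w - 1) = inverse (1 - w)" by (simp add: divide_simps)
  then show ?thesis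
    using assms by (simp add: hyp2F1_domain_iff)
qed

text \<open>The right-hand side has value 1 at 0 and solves the equation for a, b, c. In v = 1 - w
  the point w / (w - 1) is - (1 - v) / v, and the expression to be shown zero is - E / v times the
  equation for a, c - b, c at that point.\<close>

lemma hyp2F1_pfaff:
  assumes c: "c \<notin> \<int>\<^sub>\<le>\<^sub>0" and w: "w \<in> hyp2F1_domain"
  shows "hyp2F1 a b c w = (1 - w) powr (- a) * hyp2F1 a (c - b) c (w / (w - 1))"
proof -
  define g g1 g2 where "g = hyp2F1 a (c - b) c" and "g1 = deriv g" and "g2 = deriv g1"
  define E where "E w = (1 - w) powr (- a)" for w
  define z where "z w = w / (w - 1)" for w :: complex
  have "hyp2F1_ode a b c hyp2F1_domain (\<lambda>w. E w * g (z w))"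
  proof (rule hyp2F1_odeI[OF open_hyp2F1_domain])
    fix w assume w: "w \<in> hyp2F1_domain"
    define v where "v = 1 - w"
    have v: "v \<notin> \<real>\<^sub>\<le>\<^sub>0" "v \<noteq> 0" "w - 1 \<noteq> 0" using w by (auto simp: hyp2F1_domain_iff v_def)
    have zw: "z w \<in> hyp2F1_domain" unfolding z_def by (rule hyp2F1_pfaff_domain[OF w])
    have dE: "(E has_field_derivative (a * E w / v)) (at w)"
      unfolding E_def [abs_def]
      by (rule DERIV_cong[OF has_field_derivative_powr_const]) (use v in \<open>auto intro!: derivative_eq_intros simp: v_def\<close>)
    have dz: "(z has_field_derivative (- 1 / v\<^sup>2)) (at w)"
      unfolding z_def [abs_def] using v
      by (auto intro!: derivative_eq_intros simp: v_def divide_simps power2_eq_square) (simp add: algebra_simps)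
    have dv: "((\<lambda>w. 1 - w) has_field_derivative (- 1)) (at w)" by (auto intro!: derivative_eq_intros)
    have dg: "((\<lambda>w. g (z w)) has_field_derivative (g1 (z w) * (- 1 / v\<^sup>2))) (at w)"
      "((\<lambda>w. g1 (z w)) has_field_derivative (g2 (z w) * (- 1 / v\<^sup>2))) (at w)"
      unfolding g_def g1_def g2_def by (rule DERIV_chain2[OF hyp2F1_has_field_derivative(1)[OF c zw] dz],
        rule DERIV_chain2[OF hyp2F1_has_field_derivative(2)[OF c zw] dz])
    note [derivative_intros] = dE dg
    have nz: "1 - w \<noteq> 0" "(1 - w)\<^sup>2 \<noteq> 0" using v by (auto simp: v_def)
    show "((\<lambda>w. E w * g (z w)) has_field_derivative E w * (a * g (z w) / (1 - w) - g1 (z w) / (1 - w)\<^sup>2)) (at w)"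
      using v by (auto intro!: derivative_eq_intros simp: v_def algebra_simps)
    show "((\<lambda>w. E w * (a * g (z w) / (1 - w) - g1 (z w) / (1 - w)\<^sup>2)) has_field_derivative
       a * E w / (1 - w) * (a * g (z w) / (1 - w) - g1 (z w) / (1 - w)\<^sup>2)
       + E w * (a * g (z w) / (1 - w)\<^sup>2 - a * g1 (z w) / (1 - w)^3 - 2 * g1 (z w) / (1 - w)^3 + g2 (z w) / (1 - w)^4)) (at w)"
    proof -
      have "((\<lambda>w. a * g (z w) / (1 - w) - g1 (z w) / (1 - w)\<^sup>2) has_field_derivative
        a * g (z w) / (1 - w)\<^sup>2 - a * g1 (z w) / (1 - w)^3 - 2 * g1 (z w) / (1 - w)^3 + g2 (z w) / (1 - w)^4) (at w)"
        by (rule DERIV_cong, (rule derivative_intros dg nz)+)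
           (use v in \<open>simp_all add: field_simps eval_nat_numeral flip: v_def\<close>)
      with dE show ?thesis
        by (rule DERIV_cong[OF DERIV_mult]) (simp add: v_def)
    qed
    have "z w * (1 - z w) * g2 (z w) + (c - (a + (c - b) + 1) * z w) * g1 (z w) - a * (c - b) * g (z w) = 0"
      (is "?ode = 0")
      using hyp2F1_ode_eq[OF c zw] by (simp add: g_def g1_def g2_def)
    moreover have "w * (1 - w) * (a * E w / (1 - w) * (a * g (z w) / (1 - w) - g1 (z w) / (1 - w)\<^sup>2)
       + E w * (a * g (z w) / (1 - w)\<^sup>2 - a * g1 (z w) / (1 - w)^3 - 2 * g1 (z w) / (1 - w)^3 + g2 (z w) / (1 - w)^4))
       + (c - (a + b + 1) * w) * (E w * (a * g (z w) / (1 - w) - g1 (z w) / (1 - w)\<^sup>2)) - a * b * (E w * g (z w))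
       = - (E w / v) * ?ode"
    proof -
      have zv: "z w = - (1 - v) / v" using v by (simp add: z_def v_def divide_simps) (simp add: algebra_simps)
      have wv: "w = 1 - v" by (simp add: v_def)
      have key: "(1 - v) * v * (a * e / v * (a * G / v - G1 / v\<^sup>2)
         + e * (a * G / v\<^sup>2 - a * G1 / v^3 - 2 * G1 / v^3 + G2 / v^4))
         + (c - (a + b + 1) * (1 - v)) * (e * (a * G / v - G1 / v\<^sup>2)) - a * b * (e * G)
        = - (e / v) * ((- (1 - v) / v) * (1 - (- (1 - v) / v)) * G2
            + (c - (a + (c - b) + 1) * (- (1 - v) / v)) * G1 - a * (c - b) * G)" for e G G1 G2
      proof -
        have "a * e / v * (a * G / v - G1 / v\<^sup>2) + e * (a * G / v\<^sup>2 - a * G1 / v^3 - 2 * G1 / v^3 + G2 / v^4)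
            = e * (a * a * G * v\<^sup>2 - a * G1 * v + a * G * v\<^sup>2 - a * G1 * v - 2 * G1 * v + G2) / v ^ 4"
          using v(2) by (simp add: field_simps eval_nat_numeral)
        moreover have "e * (a * G / v - G1 / v\<^sup>2) = e * (a * G * v - G1) * v / v ^ 3"
          using v(2) by (simp add: field_simps eval_nat_numeral)
        moreover have "a * b * (e * G) = a * b * e * G * v ^ 3 / v ^ 3" using v(2) by simp
        moreover have "(1 - v) * v * (X / v ^ 4) = (1 - v) * X / v ^ 3" for X
          using v(2) by (simp add: field_simps eval_nat_numeral)
        ultimately have "(1 - v) * v * (a * e / v * (a * G / v - G1 / v\<^sup>2)
         + e * (a * G / v\<^sup>2 - a * G1 / v^3 - 2 * G1 / v^3 + G2 / v^4))
         + (c - (a + b + 1) * (1 - v)) * (e * (a * G / v - G1 / v\<^sup>2)) - a * b * (e * G) =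
         ((1 - v) * (e * (a * a * G * v\<^sup>2 - a * G1 * v + a * G * v\<^sup>2 - a * G1 * v - 2 * G1 * v + G2))
           + (c - (a + b + 1) * (1 - v)) * (e * (a * G * v - G1) * v) - a * b * e * G * v ^ 3) / v ^ 3"
          by (simp add: add_divide_distrib diff_divide_distrib)
        also have "(1 - v) * (e * (a * a * G * v\<^sup>2 - a * G1 * v + a * G * v\<^sup>2 - a * G1 * v - 2 * G1 * v + G2))
           + (c - (a + b + 1) * (1 - v)) * (e * (a * G * v - G1) * v) - a * b * e * G * v ^ 3
           = e * ((1 - v) * G2 - (c * v\<^sup>2 + (a + c - b + 1) * (1 - v) * v) * G1 + a * (c - b) * G * v\<^sup>2)"
          by (simp add: algebra_simps eval_nat_numeral)
        also have "\<dots> / v ^ 3 = - (e / v) * ((- (1 - v) / v) * (1 - (- (1 - v) / v)) * G2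
            + (c - (a + (c - b) + 1) * (- (1 - v) / v)) * G1 - a * (c - b) * G)"
          using v(2) by (simp add: field_simps eval_nat_numeral)
        finally show ?thesis .
      qed
      show ?thesis
        using key[of "E w" "g (z w)" "g1 (z w)" "g2 (z w)"] unfolding zv[symmetric] unfolding wv by simp
    qed
    ultimately show "w * (1 - w) * (a * E w / (1 - w) * (a * g (z w) / (1 - w) - g1 (z w) / (1 - w)\<^sup>2)
       + E w * (a * g (z w) / (1 - w)\<^sup>2 - a * g1 (z w) / (1 - w)^3 - 2 * g1 (z w) / (1 - w)^3 + g2 (z w) / (1 - w)^4))
       + (c - (a + b + 1) * w) * (E w * (a * g (z w) / (1 - w) - g1 (z w) / (1 - w)\<^sup>2)) - a * b * (E w * g (z w)) = 0"
      by simp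
  qed
  from hyp2F1_eqI_ode[OF this _ c w] show ?thesis
    by (simp add: E_def z_def g_def c)
qed

text \<open>Pfaff's transformation twice: w / (w - 1) is an involution, and the second application
  takes the numerator parameters in the other order. The powers combine because Ln (inverse (1 - w))
  = - Ln (1 - w) off the cut.\<close>

lemma hyp2F1_euler:
  assumes c: "c \<notin> \<int>\<^sub>\<le>\<^sub>0" and w: "w \<in> hyp2F1_domain"
  shows "hyp2F1 a b c w = (1 - w) powr (c - a - b) * hyp2F1 (c - a) (c - b) c w"
proof -
  have v: "1 - w \<notin> \<real>\<^sub>\<le>\<^sub>0" using w by (simp add: hyp2F1_domain_iff)
  define z where "z = w / (w - 1)"
  have w1: "w \<noteq> 1" using v by auto
  have z: "z \<in> hyp2F1_domain" "1 - z = inverse (1 - w)" "z / (z - 1) = w"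
    using hyp2F1_pfaff_domain[OF w] w1 by (auto simp: z_def divide_simps)
  have "hyp2F1 a b c w = (1 - w) powr (- a) * hyp2F1 (c - b) a c z"
    using hyp2F1_pfaff[OF c w, of a b] by (simp add: z_def hyp2F1_commute)
  also have "hyp2F1 (c - b) a c z = (1 - z) powr (- (c - b)) * hyp2F1 (c - b) (c - a) c w"
    using hyp2F1_pfaff[OF c z(1), of "c - b" a] by (simp only: z(3))
  also have "(1 - z) powr (- (c - b)) = (1 - w) powr (c - b)"
    using v by (simp add: z(2) powr_def Ln_inverse algebra_simps)
  also have "(1 - w) powr (- a) * ((1 - w) powr (c - b) * hyp2F1 (c - b) (c - a) c w)
      = (1 - w) powr (c - a - b) * hyp2F1 (c - a) (c - b) c w"
    using w1 by (simp add: powr_def hyp2F1_commute[of "c - b"] algebra_simps flip: exp_add)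
  finally show ?thesis .
qed

text \<open>On coefficients the operator w d/dw + c - 1 is multiplication by n + c - 1, and (n + c -
  1) / (c)_n = (c - 1) / (c - 1)_n. This is the source of the recursion in c for the connection
  coefficients.\<close>

lemma hyp2F1_contiguous_lower:
  assumes c: "c \<notin> \<int>\<^sub>\<le>\<^sub>0" "c - 1 \<notin> \<int>\<^sub>\<le>\<^sub>0" and w: "w \<in> hyp2F1_domain"
  shows "w * deriv (hyp2F1 a b c) w + (c - 1) * hyp2F1 a b c w = (c - 1) * hyp2F1 a b (c - 1) w"
proof -
  note [fps_expansion_intros] = hyp2F1_has_fps_expansion[OF c(1)]
  have c1: "c - 1 \<noteq> 0" using c by auto
  let ?f = "\<lambda>w. 1 / (c - 1) * (w * deriv (hyp2F1 a b c) w) + hyp2F1 a b c w"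
  have "?f has_fps_expansion hyp2F1_fps a b (c - 1)"
  proof (rule has_fps_expansion_schematicI)
    show "?f has_fps_expansion fps_const (1 / (c - 1)) * (fps_X * fps_deriv (hyp2F1_fps a b c)) + hyp2F1_fps a b c"
      by (intro fps_expansion_intros)
    show "fps_const (1 / (c - 1)) * (fps_X * fps_deriv (hyp2F1_fps a b c)) + hyp2F1_fps a b c = hyp2F1_fps a b (c - 1)"
    proof (rule fps_ext)
      fix n
      have 1: "fps_nth (fps_const (1 / (c - 1)) * (fps_X * fps_deriv (hyp2F1_fps a b c)) + hyp2F1_fps a b c) n
        = (of_nat n + c - 1) / (c - 1) * fps_nth (hyp2F1_fps a b c) n"
      proof -
        have X: "fps_nth (fps_X * fps_deriv (hyp2F1_fps a b c)) n = of_nat n * fps_nth (hyp2F1_fps a b c) n"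
          by (cases n) simp_all
        show ?thesis
        proof -
          have "1 / d * (N * f) + f = (N + d) / d * f" if "d \<noteq> 0" for d N f :: complex
            using that by (simp add: field_simps)
          from this[OF c1] show ?thesis
            unfolding fps_add_nth fps_mult_left_const_nth X by (simp add: add_diff_eq)
        qed
      qed
      have "pochhammer (c - 1) n * (of_nat n + c - 1) = (c - 1) * pochhammer c n"
      proof -
        have "pochhammer (c - 1) (Suc n) = (c - 1) * pochhammer (c - 1 + 1) n" by (rule pochhammer_rec)
        moreover have "pochhammer (c - 1) (Suc n) = pochhammer (c - 1) n * (c - 1 + of_nat n)" by (rule pochhammer_Suc)
        moreover have "c - 1 + 1 = c" "c - 1 + of_nat n = of_nat n + c - 1" by simp_all
        ultimately show ?thesis by metis
      qed
      moreover have "pochhammer (c - 1) n \<noteq> 0" "pochhammer c n \<noteq> 0"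
        using c by (auto dest: pochhammer_eq_0_imp_nonpos_Int)
      ultimately have *: "(of_nat n + c - 1) / (c - 1) / pochhammer c n = 1 / pochhammer (c - 1) n"
        using c1 by (simp add: divide_simps mult_ac)
      have "(of_nat n + c - 1) / (c - 1) * fps_nth (hyp2F1_fps a b c) n
          = pochhammer a n * pochhammer b n / fact n * (1 / pochhammer (c - 1) n)"
      proof -
        have "x * (A / (p * q)) = A / q * (x / p)" for x A p q :: complex by (simp add: mult_ac)
        then show ?thesis unfolding hyp2F1_fps_def fps_nth_Abs_fps by (simp only: *)
      qed
      then show "fps_nth (fps_const (1 / (c - 1)) * (fps_X * fps_deriv (hyp2F1_fps a b c)) + hyp2F1_fps a b c) n
          = fps_nth (hyp2F1_fps a b (c - 1)) n"
        unfolding 1 by (simp add: hyp2F1_fps_def mult_ac)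
    qed
  qed
  moreover have "?f holomorphic_on hyp2F1_domain"
    by (intro holomorphic_intros hyp2F1_holomorphic[OF c(1)] holomorphic_deriv open_hyp2F1_domain)
  ultimately have "hyp2F1 a b (c - 1) w = ?f w" using w by (intro hyp2F1_eqI)
  moreover have "x + d * y = d * (1 / d * x + y)" if "d \<noteq> 0" for d x y :: complex
    using that by (simp add: field_simps)
  ultimately show ?thesis using c1 by metis
qed

text \<open>Up to sign, the lowering operator for c in the variable 1 - w is this operator for a + b
  - c + 1 in the variable w. Lowering c on one side of the connection formula thus raises a + b - c
  + 1 on the other.\<close>

lemma hyp2F1_contiguous_raise:
  assumes c: "c \<notin> \<int>\<^sub>\<le>\<^sub>0" "c + 1 \<notin> \<int>\<^sub>\<le>\<^sub>0" and w: "w \<in> hyp2F1_domain"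
  shows "(1 - w) * deriv (hyp2F1 a b c) w + (c - a - b) * hyp2F1 a b c w
     = (c - a) * (c - b) / c * hyp2F1 a b (c + 1) w"
proof -
  note [fps_expansion_intros] = hyp2F1_has_fps_expansion[OF c(1)] hyp2F1_has_fps_expansion[OF c(2)]
  let ?f = "\<lambda>w. deriv (hyp2F1 a b c) w - w * deriv (hyp2F1 a b c) w + (c - a - b) * hyp2F1 a b c w
     - (c - a) * (c - b) / c * hyp2F1 a b (c + 1) w"
  have "?f has_fps_expansion 0"
  proof (rule has_fps_expansion_schematicI)
    let ?F = "fps_deriv (hyp2F1_fps a b c) - fps_X * fps_deriv (hyp2F1_fps a b c)
        + fps_const (c - a - b) * hyp2F1_fps a b c - fps_const ((c - a) * (c - b) / c) * hyp2F1_fps a b (c + 1)"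
    show "?f has_fps_expansion ?F"
      by (intro fps_expansion_intros)
    show "?F = 0"
    proof (rule fps_ext)
      fix n
      define f where "f = fps_nth (hyp2F1_fps a b c) n"
      have nz: "c + of_nat n \<noteq> 0" "c \<noteq> 0" using nonpos_Ints_add_of_nat_nonzero[OF c(1)] c(1) by auto
      have 1: "of_nat (Suc n) * fps_nth (hyp2F1_fps a b c) (Suc n) = (a + of_nat n) * (b + of_nat n) / (c + of_nat n) * f"
        unfolding hyp2F1_fps_nth_Suc f_def by (simp del: of_nat_Suc)
      have 2: "fps_nth (hyp2F1_fps a b (c + 1)) n = c / (c + of_nat n) * f"
      proof -
        have "pochhammer c n * (c + of_nat n) = c * pochhammer (c + 1) n"
          by (metis pochhammer_Suc pochhammer_rec)
        moreover have "pochhammer (c + 1) n \<noteq> 0" "pochhammer c n \<noteq> 0"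
          using c by (auto dest: pochhammer_eq_0_imp_nonpos_Int)
        ultimately have *: "c / (c + of_nat n) / pochhammer c n = 1 / pochhammer (c + 1) n"
          using nz by (simp add: divide_simps mult_ac)
        have "c / (c + of_nat n) * f = pochhammer a n * pochhammer b n / fact n * (1 / pochhammer (c + 1) n)"
        proof -
          have "x * (A / (p * q)) = A / q * (x / p)" for x A p q :: complex by (simp add: mult_ac)
          then show ?thesis unfolding f_def hyp2F1_fps_def fps_nth_Abs_fps by (simp only: *)
        qed
        then show ?thesis by (simp add: hyp2F1_fps_def mult_ac)
      qed
      have 3: "fps_nth (fps_X * fps_deriv (hyp2F1_fps a b c)) n = of_nat n * f"
        by (cases n) (simp_all add: f_def)
      have "fps_nth ?F n = (a + of_nat n) * (b + of_nat n) / (c + of_nat n) * f - of_nat n * f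
          + (c - a - b) * f - (c - a) * (c - b) / c * (c / (c + of_nat n) * f)"
        unfolding fps_sub_nth fps_add_nth fps_mult_left_const_nth 2 3 fps_deriv_nth Suc_eq_plus1[symmetric] 1 f_def[symmetric] by simp
      also have "\<dots> = ((a + of_nat n) * (b + of_nat n) + ((c - a - b) - of_nat n) * (c + of_nat n) - (c - a) * (c - b))
          / (c + of_nat n) * f"
      proof -
        have "A / x * f - N * f + K * f - P / c * (c / x * f) = (A + (K - N) * x - P) / x * f"
          if "x \<noteq> 0" for A x N K P
          using that nz(2) by (simp add: field_simps)
        then show ?thesis using nz(1) by blast
      qed
      also have "\<dots> = 0" by (simp add: algebra_simps)
      finally show "fps_nth ?F n = fps_nth 0 n" by simp
    qed
  qed
  moreover have "?f holomorphic_on hyp2F1_domain"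
    by (intro holomorphic_intros hyp2F1_holomorphic c holomorphic_deriv open_hyp2F1_domain)
  ultimately have "?f w = 0"
    using has_fps_expansion_0_imp_zero[of ?f hyp2F1_domain w] open_hyp2F1_domain connected_hyp2F1_domain w by auto
  then show ?thesis by (simp add: algebra_simps)
qed

section \<open>The connection between 0 and 1\<close>

text \<open>The common domain of F(w), F(1 - w) and the principal powers of w and 1 - w.\<close>

definition two_slit_plane :: "complex set" where
  "two_slit_plane = {w. w \<notin> \<real>\<^sub>\<le>\<^sub>0 \<and> 1 - w \<notin> \<real>\<^sub>\<le>\<^sub>0}"

lemma two_slit_plane_subset: "two_slit_plane \<subseteq> hyp2F1_domain"
  by (auto simp: two_slit_plane_def hyp2F1_domain_iff)

lemma two_slit_planeD:
  assumes "w \<in> two_slit_plane"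
  shows "w \<in> hyp2F1_domain" "1 - w \<in> hyp2F1_domain" "w \<notin> \<real>\<^sub>\<le>\<^sub>0" "1 - w \<notin> \<real>\<^sub>\<le>\<^sub>0"
    "w \<noteq> 0" "1 - w \<noteq> 0" "w \<noteq> 1"
  using assms by (auto simp: two_slit_plane_def hyp2F1_domain_iff)

lemma open_two_slit_plane: "open two_slit_plane"
proof -
  have "two_slit_plane = hyp2F1_domain \<inter> - \<real>\<^sub>\<le>\<^sub>0"
    by (auto simp: two_slit_plane_def hyp2F1_domain_iff)
  then show ?thesis
    using open_Int[OF open_hyp2F1_domain open_Compl[OF closed_nonpos_Reals_complex]] by simp
qed

lemma connected_two_slit_plane: "connected two_slit_plane"
proof (rule starlike_imp_connected)
  have "closed_segment (1/2) w \<subseteq> two_slit_plane" if w: "w \<in> two_slit_plane" for w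
  proof
    fix x assume "x \<in> closed_segment (1/2) w"
    then obtain u where u: "0 \<le> u" "u \<le> 1" "x = (1 - u) *\<^sub>R (1/2) + u *\<^sub>R w"
      by (auto simp: in_segment)
    then have x: "Im x = u * Im w" "Re x = (1 - u) / 2 + u * Re w"
      by (simp_all add: scaleR_conv_of_real)
    show "x \<in> two_slit_plane"
    proof (cases "Im w = 0 \<or> u = 0")
      case True
      have "0 < Re x \<and> Re x < 1"
      proof (cases "u = 0")
        case False
        then have "0 < Re w" "Re w < 1"
          using w True by (auto simp: two_slit_plane_def complex_nonpos_Reals_iff)
        then have "0 < u * Re w" "u * Re w < u" using u False by auto
        then show ?thesis unfolding x using u by (simp add: field_simps)
      qed (use x in auto)
      then show ?thesis by (auto simp: two_slit_plane_def complex_nonpos_Reals_iff)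
    next
      case False
      then show ?thesis using x by (auto simp: two_slit_plane_def complex_nonpos_Reals_iff)
    qed
  qed
  then show "starlike two_slit_plane"
    by (auto simp: starlike_def intro!: bexI[of _ "1/2"]) (auto simp: two_slit_plane_def complex_nonpos_Reals_iff)
qed

lemma two_slit_plane_of_real: "0 < x \<Longrightarrow> x < 1 \<Longrightarrow> complex_of_real x \<in> two_slit_plane"
  by (auto simp: two_slit_plane_def complex_nonpos_Reals_iff)

lemma hyp2F1_ode_subset:
  assumes "hyp2F1_ode a b c S y" "T \<subseteq> S"
  shows "hyp2F1_ode a b c T y"
  using assms holomorphic_on_subset by (auto simp: hyp2F1_ode_def)

text \<open>The Frobenius solution for the other exponent 1 - c at the origin: splitting off that
  power turns the equation into a hypergeometric one with the shifted parameters.\<close>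

lemma hyp2F1_ode_second_solution:
  assumes c: "2 - c \<notin> \<int>\<^sub>\<le>\<^sub>0"
  shows "hyp2F1_ode a b c two_slit_plane (\<lambda>w. w powr (1 - c) * hyp2F1 (a - c + 1) (b - c + 1) (2 - c) w)"
proof -
  define g g1 g2 where "g = hyp2F1 (a - c + 1) (b - c + 1) (2 - c)" and "g1 = deriv g" and "g2 = deriv g1"
  define E where "E w = w powr (1 - c)" for w :: complex
  have "hyp2F1_ode a b c two_slit_plane (\<lambda>w. E w * g w)"
  proof (rule hyp2F1_odeI[OF open_two_slit_plane])
    fix w assume w: "w \<in> two_slit_plane"
    note wD = two_slit_planeD[OF w]
    have dE: "(E has_field_derivative ((1 - c) * E w / w)) (at w)"
      unfolding E_def [abs_def]
      by (rule DERIV_cong[OF has_field_derivative_powr_const]) (use wD in \<open>auto intro!: derivative_eq_intros\<close>)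
    have dg: "(g has_field_derivative g1 w) (at w)" "(g1 has_field_derivative g2 w) (at w)"
      using hyp2F1_has_field_derivative[OF c wD(1)] by (simp_all add: g_def g1_def g2_def)
    show "((\<lambda>w. E w * g w) has_field_derivative E w * ((1 - c) * g w / w + g1 w)) (at w)"
      by (rule DERIV_cong[OF DERIV_mult[OF dE dg(1)]]) (simp add: algebra_simps)
    have "((\<lambda>w. (1 - c) * g w / w + g1 w) has_field_derivative
        - (1 - c) * g w / w\<^sup>2 + (1 - c) * g1 w / w + g2 w) (at w)"
      by (rule DERIV_cong, (rule derivative_intros dg wD)+)
         (use wD in \<open>simp add: field_simps power2_eq_square\<close>)
    with dE show "((\<lambda>w. E w * ((1 - c) * g w / w + g1 w)) has_field_derivative
        E w * (- c * (1 - c) * g w / w\<^sup>2 + 2 * (1 - c) * g1 w / w + g2 w)) (at w)"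
      by (rule DERIV_cong[OF DERIV_mult]) (use wD in \<open>simp add: field_simps power2_eq_square\<close>)
    have "w * (1 - w) * g2 w + (2 - c - ((a - c + 1) + (b - c + 1) + 1) * w) * g1 w - (a - c + 1) * (b - c + 1) * g w = 0"
      (is "?ode = 0")
      using hyp2F1_ode_eq[OF c wD(1)] unfolding g_def g1_def g2_def by blast
    moreover have "w * (1 - w) * (E w * (- c * (1 - c) * g w / w\<^sup>2 + 2 * (1 - c) * g1 w / w + g2 w))
      + (c - (a + b + 1) * w) * (E w * ((1 - c) * g w / w + g1 w)) - a * b * (E w * g w) = E w * ?ode"
    proof -
      have 1: "w * (1 - w) * (E w * (- c * (1 - c) * g w / w\<^sup>2 + 2 * (1 - c) * g1 w / w + g2 w))
        = E w * (- c * (1 - c) * (1 - w) * (g w / w) + 2 * (1 - c) * (1 - w) * g1 w + w * (1 - w) * g2 w)"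
        using wD(5) by (simp add: field_simps power2_eq_square)
      have 2: "w * (g w / w) = g w" using wD(5) by simp
      \<comment> \<open>Here x stands for g w / w; with w * x in place of g w the identity is
        polynomial.\<close>
      have "E w * (- c * (1 - c) * (1 - w) * x + 2 * (1 - c) * (1 - w) * g1 w + w * (1 - w) * g2 w)
         + (c - (a + b + 1) * w) * (E w * ((1 - c) * x + g1 w)) - a * b * (E w * (w * x))
         = E w * (w * (1 - w) * g2 w + (2 - c - ((a - c + 1) + (b - c + 1) + 1) * w) * g1 w - (a - c + 1) * (b - c + 1) * (w * x))" for x
        by (simp add: algebra_simps)
      from this[of "g w / w"] show ?thesis unfolding 1 2 by simp
    qed
    ultimately show "w * (1 - w) * (E w * (- c * (1 - c) * g w / w\<^sup>2 + 2 * (1 - c) * g1 w / w + g2 w))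
      + (c - (a + b + 1) * w) * (E w * ((1 - c) * g w / w + g1 w)) - a * b * (E w * g w) = 0" by simp
  qed
  then show ?thesis by (simp add: E_def g_def)
qed

text \<open>The substitution of 1 - w for w preserves the form of the equation and exchanges c with
  a + b - c + 1.\<close>

lemma hyp2F1_ode_reflect:
  assumes c: "c \<notin> \<int>\<^sub>\<le>\<^sub>0"
  shows "hyp2F1_ode a b (a + b - c + 1) two_slit_plane (\<lambda>w. hyp2F1 a b c (1 - w))"
proof (rule hyp2F1_odeI[OF open_two_slit_plane])
  fix w assume w: "w \<in> two_slit_plane"
  define g g1 g2 where "g = hyp2F1 a b c" and "g1 = deriv g" and "g2 = deriv g1"
  have d: "((\<lambda>w. 1 - w) has_field_derivative - 1) (at w)" by (auto intro!: derivative_eq_intros)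
  note wD = two_slit_planeD[OF w]
  show "((\<lambda>w. hyp2F1 a b c (1 - w)) has_field_derivative - deriv (hyp2F1 a b c) (1 - w)) (at w)"
    using DERIV_chain2[OF hyp2F1_has_field_derivative(1)[OF c wD(2)] d] by simp
  show "((\<lambda>w. - deriv (hyp2F1 a b c) (1 - w)) has_field_derivative deriv (deriv (hyp2F1 a b c)) (1 - w)) (at w)"
    using DERIV_minus[OF DERIV_chain2[OF hyp2F1_has_field_derivative(2)[OF c wD(2)] d]] by simp
  show "w * (1 - w) * deriv (deriv (hyp2F1 a b c)) (1 - w) +
      (a + b - c + 1 - (a + b + 1) * w) * - deriv (hyp2F1 a b c) (1 - w) - a * b * hyp2F1 a b c (1 - w) = 0"
    using hyp2F1_ode_eq[OF c wD(2), of a b] by (simp add: algebra_simps)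
qed

section \<open>Wronskians and the existence of connection coefficients\<close>

lemma hyp2F1_ode_derivs:
  assumes "hyp2F1_ode a b c S y" "open S" "w \<in> S"
  shows "(y has_field_derivative deriv y w) (at w)"
    and "(deriv y has_field_derivative deriv (deriv y) w) (at w)"
  using assms by (auto simp: hyp2F1_ode_def intro!: holomorphic_derivI holomorphic_deriv)

text \<open>Abel's identity: the equation gives W' = - (c / w - d / (1 - w)) W with d = a + b + 1 -
  c, and the weight is the reciprocal of a solution of this first-order equation, so the product has
  derivative 0.\<close>

lemma hyp2F1_ode_wronskian:
  assumes u: "hyp2F1_ode a b c two_slit_plane u" and v: "hyp2F1_ode a b c two_slit_plane v"
  obtains k where "\<And>w. w \<in> two_slit_plane \<Longrightarrow>
    w powr c * (1 - w) powr (a + b + 1 - c) * (u w * deriv v w - deriv u w * v w) = k"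
proof -
  define d where "d = a + b + 1 - c"
  define p where "p w = w powr c * (1 - w) powr d" for w
  define W where "W w = u w * deriv v w - deriv u w * v w" for w
  have D: "((\<lambda>w. p w * W w) has_field_derivative 0) (at w)" if w: "w \<in> two_slit_plane" for w
  proof -
    note wD = two_slit_planeD[OF w]
    have dp: "(p has_field_derivative (p w * (c / w - d / (1 - w)))) (at w)"
    proof -
      have "((\<lambda>w. w powr c) has_field_derivative (c * (w powr c) / w * 1)) (at w)"
        by (rule has_field_derivative_powr_const) (use wD in \<open>auto intro!: derivative_eq_intros\<close>)
      moreover have "((\<lambda>w. (1 - w) powr d) has_field_derivative (d * ((1 - w) powr d) / (1 - w) * - 1)) (at w)"
        by (rule has_field_derivative_powr_const) (use wD in \<open>auto intro!: derivative_eq_intros\<close>)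
      ultimately show ?thesis
        unfolding p_def [abs_def] by (rule DERIV_cong[OF DERIV_mult]) (simp add: algebra_simps)
    qed
    have dW: "(W has_field_derivative (u w * deriv (deriv v) w - deriv (deriv u) w * v w)) (at w)"
      unfolding W_def [abs_def]
      by (rule DERIV_cong, (rule derivative_intros hyp2F1_ode_derivs[OF u open_two_slit_plane w]
            hyp2F1_ode_derivs[OF v open_two_slit_plane w])+) (simp add: algebra_simps)
    have "w * (1 - w) * (u w * deriv (deriv v) w - deriv (deriv u) w * v w) = - (c - (a + b + 1) * w) * W w"
      (is "_ * ?W' = _")
    proof -
      have eq: "w * (1 - w) * deriv (deriv y) w = a * b * y w - (c - (a + b + 1) * w) * deriv y w"
        if "hyp2F1_ode a b c two_slit_plane y" for y
        using that w by (auto simp: hyp2F1_ode_def algebra_simps)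
      have "w * (1 - w) * ?W' = u w * (w * (1 - w) * deriv (deriv v) w) - (w * (1 - w) * deriv (deriv u) w) * v w"
        by (simp add: algebra_simps)
      then show ?thesis unfolding eq[OF u] eq[OF v] by (simp add: W_def algebra_simps)
    qed
    then have "?W' = - (c - (a + b + 1) * w) * W w / (w * (1 - w))"
      using wD by (simp add: field_simps)
    also have "\<dots> = - (c / w - d / (1 - w)) * W w"
      using wD by (simp add: d_def divide_simps) (simp add: algebra_simps)
    finally have W': "?W' = - (c / w - d / (1 - w)) * W w" .
    show ?thesis
      by (rule DERIV_cong[OF DERIV_mult[OF dp dW[unfolded W']]]) (simp add: algebra_simps)
  qed
  then have "continuous_on two_slit_plane (\<lambda>w. p w * W w)"
    by (meson DERIV_isCont continuous_at_imp_continuous_on)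
  from DERIV_zero_connected_constant[OF connected_two_slit_plane open_two_slit_plane finite.emptyI this] D
  obtain k where "\<And>w. w \<in> two_slit_plane \<Longrightarrow> p w * W w = k" by auto
  then show ?thesis by (intro that) (auto simp: p_def W_def d_def)
qed

text \<open>A predicate instead of a formula, so that the coefficients can be carried through
  Euler's transformation and shifts of c while their values are still unknown.\<close>

definition hyp2F1_connection :: "complex \<Rightarrow> complex \<Rightarrow> complex \<Rightarrow> complex \<Rightarrow> complex \<Rightarrow> bool" where
  "hyp2F1_connection a b c A B \<longleftrightarrow> (\<forall>w\<in>two_slit_plane. hyp2F1 a b c (1 - w) =
     A * hyp2F1 a b (a + b - c + 1) w
     + B * (w powr (c - a - b) * hyp2F1 (c - a) (c - b) (c - a - b + 1) w))"

lemma not_Int_imp_not_nonpos_Int: "x \<notin> \<int> \<Longrightarrow> x \<notin> \<int>\<^sub>\<le>\<^sub>0"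
  using nonpos_Ints_subset_Ints by auto

lemma not_Int_shift:
  assumes "c - a - b \<notin> (\<int> :: complex set)"
  shows "a + b - c + 1 \<notin> \<int>" "c - a - b + 1 \<notin> \<int>" "2 - (a + b - c + 1) \<notin> \<int>" "a + b - c \<notin> \<int>"
    "a + b - c + 1 + 1 \<notin> \<int>"
proof -
  have "c - a - b \<in> \<int>" if "a + b - c + 1 \<in> \<int> \<or> c - a - b + 1 \<in> \<int> \<or> 2 - (a + b - c + 1) \<in> \<int>
      \<or> a + b - c \<in> \<int> \<or> a + b - c + 1 + 1 \<in> \<int>"
  proof -
    have *: "c - a - b = 1 - (a + b - c + 1)" "c - a - b = (c - a - b + 1) - 1"
      "c - a - b = (2 - (a + b - c + 1)) - 1" "c - a - b = - (a + b - c)"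
      "c - a - b = 2 - (a + b - c + 1 + 1)" by simp_all
    have "x - 1 \<in> \<int>" "1 - x \<in> \<int>" "2 - x \<in> \<int>" "- x \<in> \<int>" if "x \<in> \<int>" for x :: complex
      using that by auto
    then show ?thesis using that * by metis
  qed
  then show "a + b - c + 1 \<notin> \<int>" "c - a - b + 1 \<notin> \<int>" "2 - (a + b - c + 1) \<notin> \<int>" "a + b - c \<notin> \<int>"
    "a + b - c + 1 + 1 \<notin> \<int>"
    using assms by blast+
qed

lemma hyp2F1_second_solution:
  assumes "c - a - b \<notin> \<int>"
  shows "hyp2F1_ode a b (a + b - c + 1) two_slit_plane
    (\<lambda>w. w powr (c - a - b) * hyp2F1 (c - a) (c - b) (c - a - b + 1) w)"
proof -
  have *: "1 - (a + b - c + 1) = c - a - b" "a - (a + b - c + 1) + 1 = c - b"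
    "b - (a + b - c + 1) + 1 = c - a" "2 - (a + b - c + 1) = c - a - b + 1" by simp_all
  show ?thesis
    using hyp2F1_ode_second_solution[of "a + b - c + 1" a b] not_Int_shift[OF assms]
      not_Int_imp_not_nonpos_Int
    unfolding * hyp2F1_commute[of "c - b"] by blast
qed

text \<open>Abel's constant is found at the origin: the powers of w multiply to w itself, and the
  remaining expression h extends continuously to 0, where its value is c - a - b.\<close>

lemma hyp2F1_wronskian:
  assumes "c - a - b \<notin> \<int>" and w: "w \<in> two_slit_plane"
  defines "y1 \<equiv> hyp2F1 a b (a + b - c + 1)"
    and "y2 \<equiv> \<lambda>w. w powr (c - a - b) * hyp2F1 (c - a) (c - b) (c - a - b + 1) w"
  shows "w powr (a + b - c + 1) * (1 - w) powr c * (y1 w * deriv y2 w - deriv y1 w * y2 w) = c - a - b"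
proof -
  define e where "e = c - a - b"
  define g where "g = hyp2F1 (c - a) (c - b) (e + 1)"
  note nI = not_Int_shift[OF assms(1), THEN not_Int_imp_not_nonpos_Int]
  have c1: "a + b - c + 1 \<notin> \<int>\<^sub>\<le>\<^sub>0" and c2: "e + 1 \<notin> \<int>\<^sub>\<le>\<^sub>0" using nI by (auto simp: e_def)
  have o1: "hyp2F1_ode a b (a + b - c + 1) two_slit_plane y1"
    unfolding y1_def by (rule hyp2F1_ode_subset[OF hyp2F1_ode[OF c1] two_slit_plane_subset])
  have o2: "hyp2F1_ode a b (a + b - c + 1) two_slit_plane y2"
    unfolding y2_def by (rule hyp2F1_second_solution[OF assms(1)])
  obtain k where k: "w powr (a + b - c + 1) * (1 - w) powr c * (y1 w * deriv y2 w - deriv y1 w * y2 w) = k"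
    if "w \<in> two_slit_plane" for w
    using hyp2F1_ode_wronskian[OF o1 o2] by (auto simp: algebra_simps)
  define h where "h w = (1 - w) powr c * (e * y1 w * g w + w * (y1 w * deriv g w - deriv y1 w * g w))" for w
  have h: "h w = k" if w: "w \<in> two_slit_plane" for w
  proof -
    note wD = two_slit_planeD[OF w]
    have "(y2 has_field_derivative (e * (w powr e) / w * 1 * g w + deriv g w * w powr e)) (at w)"
      unfolding y2_def e_def[symmetric] g_def[symmetric]
      by (intro DERIV_mult has_field_derivative_powr_const)
         (use wD hyp2F1_has_field_derivative(1)[OF c2] in \<open>auto simp: g_def\<close>)
    moreover have y2: "y2 w = w powr e * g w" by (simp add: y2_def e_def g_def)
    ultimately have d: "deriv y2 w = w powr e * (e * g w / w + deriv g w)"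
      by (subst DERIV_imp_deriv) (auto simp: algebra_simps)
    have p: "w powr (a + b - c + 1) * w powr e = w"
      using wD by (simp add: e_def powr_def flip: exp_add distrib_right)
    have "k = w powr (a + b - c + 1) * w powr e * ((1 - w) powr c * (y1 w * (e * g w / w + deriv g w) - deriv y1 w * g w))"
      unfolding k[OF w, symmetric] d by (simp add: y2 algebra_simps)
    also have "\<dots> = h w" unfolding p h_def using wD by (simp add: field_simps)
    finally show ?thesis by simp
  qed
  \<comment> \<open>The summand 2 keeps every s n strictly between 0 and 1.\<close>
  define s where "s n = complex_of_real (1 / (real n + 2))" for n
  have "s \<longlonglongrightarrow> of_real 0"
    unfolding s_def by (intro tendsto_of_real) real_asymp
  moreover have "isCont h 0"
  proof -
    have c: "isCont y1 0" "isCont (deriv y1) 0" "isCont g 0" "isCont (deriv g) 0"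
      unfolding y1_def g_def
      by (rule hyp2F1_has_field_derivative[OF c1 hyp2F1_domain_0, THEN DERIV_isCont]
            hyp2F1_has_field_derivative[OF c2 hyp2F1_domain_0, THEN DERIV_isCont])+
    then show ?thesis
      unfolding h_def [abs_def] by (intro continuous_intros) auto
  qed
  ultimately have "(\<lambda>n. h (s n)) \<longlonglongrightarrow> h 0"
    by (simp add: isCont_tendsto_compose)
  moreover have "h (s n) = k" for n
    by (rule h) (auto simp: s_def intro!: two_slit_plane_of_real simp del: of_real_divide of_real_add)
  ultimately have "h 0 = k" by (simp add: LIMSEQ_const_iff)
  then have "k = c - a - b" using c1 c2 by (simp add: h_def y1_def g_def e_def)
  then show ?thesis using k[OF w] by simp
qed

text \<open>Cramer's rule: y W(y1, y2) = W(y, y2) y1 - W(y, y1) y2 holds identically, and with the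
  common weight all three Wronskians are constants, the one on the left being c - a - b and
  nonzero.\<close>

lemma hyp2F1_connection_exists:
  assumes c: "c \<notin> \<int>" and e: "c - a - b \<notin> \<int>"
  obtains A B where "hyp2F1_connection a b c A B"
proof -
  define cs where "cs = a + b - c + 1"
  define y y1 y2 where "y = (\<lambda>w. hyp2F1 a b c (1 - w))" and "y1 = hyp2F1 a b cs"
    and "y2 = (\<lambda>w. w powr (c - a - b) * hyp2F1 (c - a) (c - b) (c - a - b + 1) w)"
  have c0: "c \<notin> \<int>\<^sub>\<le>\<^sub>0" and cs0: "cs \<notin> \<int>\<^sub>\<le>\<^sub>0"
    using c not_Int_shift[OF e] by (auto intro: not_Int_imp_not_nonpos_Int simp: cs_def)
  have o: "hyp2F1_ode a b cs two_slit_plane y" "hyp2F1_ode a b cs two_slit_plane y1" "hyp2F1_ode a b cs two_slit_plane y2"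
    using hyp2F1_ode_reflect[OF c0, of a b] hyp2F1_ode_subset[OF hyp2F1_ode[OF cs0, of a b] two_slit_plane_subset]
      hyp2F1_second_solution[OF e]
    unfolding y_def y1_def y2_def cs_def by simp_all
  obtain k1 where k1: "w powr cs * (1 - w) powr (a + b + 1 - cs) * (y w * deriv y2 w - deriv y w * y2 w) = k1"
    if "w \<in> two_slit_plane" for w
    using hyp2F1_ode_wronskian[OF o(1,3)] by blast
  obtain k3 where k3: "w powr cs * (1 - w) powr (a + b + 1 - cs) * (y w * deriv y1 w - deriv y w * y1 w) = k3"
    if "w \<in> two_slit_plane" for w
    using hyp2F1_ode_wronskian[OF o(1,2)] by blast
  have e0: "c - a - b \<noteq> 0" using e by auto
  have "y w = k1 / (c - a - b) * y1 w + - k3 / (c - a - b) * y2 w" if w: "w \<in> two_slit_plane" for w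
  proof -
    define p where "p = w powr cs * (1 - w) powr (a + b + 1 - cs)"
    have k2: "p * (y1 w * deriv y2 w - deriv y1 w * y2 w) = c - a - b"
      using hyp2F1_wronskian[OF e w] by (simp add: p_def y1_def y2_def cs_def)
    have "y w * (c - a - b) = k1 * y1 w - k3 * y2 w"
      unfolding k2[symmetric] k1[OF w, symmetric] k3[OF w, symmetric] p_def[symmetric] by (simp add: algebra_simps)
    moreover have "x = p / d * u + - q / d * v" if "x * d = p * u - q * v" "d \<noteq> 0" for x d p q u v :: complex
      using that by (simp add: field_simps)
    ultimately show ?thesis using e0 by blast
  qed
  then show ?thesis
    by (intro that[of "k1 / (c - a - b)" "- k3 / (c - a - b)"])
       (simp add: hyp2F1_connection_def y_def y1_def y2_def cs_def)
qed

text \<open>The Wronskian of the two solutions at 1/2 is nonzero, so they are linearly independent.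
  Hence A depends on the parameters alone, and a recursion in c makes sense for it.\<close>

lemma hyp2F1_connection_unique:
  assumes e: "c - a - b \<notin> \<int>"
    and AB: "hyp2F1_connection a b c A B" and AB': "hyp2F1_connection a b c A' B'"
  shows "A = A'"
proof -
  define y1 y2 where "y1 = hyp2F1 a b (a + b - c + 1)"
    and "y2 = (\<lambda>w. w powr (c - a - b) * hyp2F1 (c - a) (c - b) (c - a - b + 1) w)"
  have eq: "(A - A') * y1 w + (B - B') * y2 w = 0" if "w \<in> two_slit_plane" for w
    using AB AB' that unfolding hyp2F1_connection_def y1_def y2_def by (simp add: algebra_simps)
  have w: "1/2 \<in> two_slit_plane" using two_slit_plane_of_real[of "1/2"] by simp
  note nI = not_Int_shift[OF e, THEN not_Int_imp_not_nonpos_Int]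
  have d1: "(y1 has_field_derivative deriv y1 (1/2)) (at (1/2))"
    unfolding y1_def by (rule hyp2F1_has_field_derivative[OF nI(1) two_slit_planeD(1)[OF w]])
  have d2: "(y2 has_field_derivative deriv y2 (1/2)) (at (1/2))"
    unfolding y2_def by (rule hyp2F1_ode_derivs[OF hyp2F1_second_solution[OF e] open_two_slit_plane w])
  have "((\<lambda>w. (A - A') * y1 w + (B - B') * y2 w) has_field_derivative
      (A - A') * deriv y1 (1/2) + (B - B') * deriv y2 (1/2)) (at (1/2))"
    by (intro DERIV_add DERIV_cmult d1 d2)
  moreover have "((\<lambda>w. (A - A') * y1 w + (B - B') * y2 w) has_field_derivative 0) (at (1/2))"
    by (rule has_field_derivative_transform_within_open[OF DERIV_const[of 0] open_two_slit_plane w])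
       (simp add: eq)
  ultimately have eq': "(A - A') * deriv y1 (1/2) + (B - B') * deriv y2 (1/2) = 0"
    by (rule DERIV_unique)
  define W where "W = y1 (1/2) * deriv y2 (1/2) - deriv y1 (1/2) * y2 (1/2)"
  have "(A - A') * W = ((A - A') * y1 (1/2) + (B - B') * y2 (1/2)) * deriv y2 (1/2)
      - ((A - A') * deriv y1 (1/2) + (B - B') * deriv y2 (1/2)) * y2 (1/2)"
    by (simp add: W_def algebra_simps)
  also have "\<dots> = 0" unfolding eq' eq[OF w] by simp
  finally have "(A - A') * W = 0" .
  moreover have "W \<noteq> 0"
    using hyp2F1_wronskian[OF e w] e unfolding W_def y1_def y2_def by force
  ultimately show ?thesis by simp
qed

text \<open>Multiplying by w powr (a + b - c) transforms the left-hand side by Euler and exchanges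
  the two solutions on the right. The second coefficient thereby becomes a first one.\<close>

lemma hyp2F1_connection_euler:
  assumes c: "c \<notin> \<int>" and e: "c - a - b \<notin> \<int>" and AB: "hyp2F1_connection a b c A B"
  shows "hyp2F1_connection (c - a) (c - b) c B A"
  unfolding hyp2F1_connection_def
proof
  fix w assume w: "w \<in> two_slit_plane"
  note wD = two_slit_planeD[OF w]
  have p: "w powr (a + b - c) * w powr (c - a - b) = 1"
    using wD by (simp add: powr_def flip: exp_add distrib_right)
  have "hyp2F1 (c - a) (c - b) c (1 - w) = w powr (a + b - c) * hyp2F1 a b c (1 - w)"
    using hyp2F1_euler[OF not_Int_imp_not_nonpos_Int[OF c] wD(2), of "c - a" "c - b"] by (simp add: algebra_simps)
  also have "hyp2F1 a b c (1 - w) = A * hyp2F1 a b (a + b - c + 1) w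
     + B * (w powr (c - a - b) * hyp2F1 (c - a) (c - b) (c - a - b + 1) w)"
    using AB w by (simp add: hyp2F1_connection_def)
  also have "w powr (a + b - c) * \<dots> = A * (w powr (a + b - c) * hyp2F1 a b (a + b - c + 1) w)
     + (w powr (a + b - c) * w powr (c - a - b)) * (B * hyp2F1 (c - a) (c - b) (c - a - b + 1) w)"
    by (simp add: algebra_simps)
  finally show "hyp2F1 (c - a) (c - b) c (1 - w) = B * hyp2F1 (c - a) (c - b) (c - a + (c - b) - c + 1) w
     + A * (w powr (c - (c - a) - (c - b)) * hyp2F1 (c - (c - a)) (c - (c - b)) (c - (c - a) - (c - b) + 1) w)"
    unfolding p by (simp add: algebra_simps)
qed

text \<open>The lowering relation is applied at 1 - w and both sides of the connection formula are
  differentiated. On the first solution it acts by \<open>hyp2F1_contiguous_raise\<close>; on the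
  second, rewritten by Euler's transformation, by \<open>hyp2F1_contiguous_lower\<close>.\<close>

lemma hyp2F1_connection_lower:
  assumes c: "c \<notin> \<int>" and e: "c - a - b \<notin> \<int>" and AB: "hyp2F1_connection a b c A B"
  obtains B' where "hyp2F1_connection a b (c - 1)
    (A * ((c - 1 - a) * (c - 1 - b) / ((c - 1) * (c - 1 - a - b)))) B'"
proof -
  define C where "C = c - a - b + 1"
  have c0: "c \<notin> \<int>\<^sub>\<le>\<^sub>0" "c - 1 \<notin> \<int>\<^sub>\<le>\<^sub>0" "c - 1 \<noteq> 0"
  proof -
    have "c - 1 \<notin> \<int>" using c Ints_add[of "c - 1" 1] by auto
    then show "c \<notin> \<int>\<^sub>\<le>\<^sub>0" "c - 1 \<notin> \<int>\<^sub>\<le>\<^sub>0" "c - 1 \<noteq> 0" using c not_Int_imp_not_nonpos_Int by auto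
  qed
  note nI = not_Int_shift[OF e, THEN not_Int_imp_not_nonpos_Int]
  have C0: "C \<notin> \<int>\<^sub>\<le>\<^sub>0" "C - 1 \<notin> \<int>\<^sub>\<le>\<^sub>0" using nI not_Int_imp_not_nonpos_Int[OF e] by (auto simp: C_def)
  have cs0: "a + b - c + 1 \<noteq> 0" using nI(1) by auto
  define H where "H = hyp2F1 (1 - a) (1 - b) C"
  have "hyp2F1_connection a b (c - 1)
    (A * ((c - 1 - a) * (c - 1 - b) / ((c - 1) * (c - 1 - a - b)))) (- B * (C - 1) / (c - 1))"
    unfolding hyp2F1_connection_def
  proof
    fix w assume w: "w \<in> two_slit_plane"
    note wD = two_slit_planeD[OF w]
    define y1 where "y1 = hyp2F1 a b (a + b - c + 1)"
    define y2 where "y2 w = w powr (c - a - b) * hyp2F1 (c - a) (c - b) (c - a - b + 1) w" for w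
    define y2' where "y2' = (1 - w) powr (1 - c) * w powr (C - 1) * ((c - 1) / (1 - w) * H w + (C - 1) / w * H w + deriv H w)"
    \<comment> \<open>Differentiating the factor (1 - z) powr (1 - c) split off here produces
      exactly the term (c - 1) * y2 that has to be subtracted; what remains is the lowering operator
      applied to H.\<close>
    have y2H: "y2 z = (1 - z) powr (1 - c) * (z powr (C - 1) * H z)" if "z \<in> two_slit_plane" for z
    proof -
      have 1: "C - (c - a) - (c - b) = 1 - c" "C - (c - a) = 1 - b" "C - (c - b) = 1 - a" "c - a - b = C - 1"
        by (simp_all add: C_def)
      show ?thesis
        using hyp2F1_euler[OF C0(1) two_slit_planeD(1)[OF that], of "c - a" "c - b"]
        unfolding y2_def C_def[symmetric] H_def hyp2F1_commute[of "1 - a"] 1 by simp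
    qed
    have "((\<lambda>z. (1 - z) powr (1 - c) * (z powr (C - 1) * H z)) has_field_derivative y2') (at w)"
    proof -
      have "((\<lambda>z. (1 - z) powr (1 - c)) has_field_derivative ((1 - c) * ((1 - w) powr (1 - c)) / (1 - w) * - 1)) (at w)"
        by (rule has_field_derivative_powr_const) (use wD in \<open>auto intro!: derivative_eq_intros\<close>)
      moreover have "((\<lambda>z. z powr (C - 1)) has_field_derivative ((C - 1) * (w powr (C - 1)) / w * 1)) (at w)"
        by (rule has_field_derivative_powr_const) (use wD in \<open>auto intro!: derivative_eq_intros\<close>)
      moreover have "(H has_field_derivative deriv H w) (at w)"
        unfolding H_def by (rule hyp2F1_has_field_derivative[OF C0(1) wD(1)])
      ultimately show ?thesis
        unfolding y2'_def
        by (rule DERIV_cong[OF DERIV_mult[OF _ DERIV_mult]]) (use wD in \<open>simp add: field_simps\<close>)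
    qed
    then have d2: "(y2 has_field_derivative y2') (at w)"
      by (rule has_field_derivative_transform_within_open[OF _ open_two_slit_plane w]) (simp add: y2H)
    have d1: "(y1 has_field_derivative deriv y1 w) (at w)"
      unfolding y1_def by (rule hyp2F1_has_field_derivative[OF nI(1) wD(1)])
    have dl: "((\<lambda>w. hyp2F1 a b c (1 - w)) has_field_derivative - deriv (hyp2F1 a b c) (1 - w)) (at w)"
    proof -
      have "((\<lambda>w. 1 - w) has_field_derivative - 1) (at w)" by (auto intro!: derivative_eq_intros)
      from DERIV_chain2[OF hyp2F1_has_field_derivative(1)[OF c0(1) wD(2)] this] show ?thesis by simp
    qed
    have eq: "hyp2F1 a b c (1 - z) = A * y1 z + B * y2 z" if "z \<in> two_slit_plane" for z
      using AB that by (simp add: hyp2F1_connection_def y1_def y2_def)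
    have "((\<lambda>w. hyp2F1 a b c (1 - w)) has_field_derivative (A * deriv y1 w + B * y2')) (at w)"
      by (rule has_field_derivative_transform_within_open[OF DERIV_add[OF DERIV_cmult[OF d1] DERIV_cmult[OF d2]]
            open_two_slit_plane w]) (simp add: eq)
    then have deq: "- deriv (hyp2F1 a b c) (1 - w) = A * deriv y1 w + B * y2'"
      using dl DERIV_unique by blast
    have "(c - 1) * hyp2F1 a b (c - 1) (1 - w) = (1 - w) * deriv (hyp2F1 a b c) (1 - w) + (c - 1) * hyp2F1 a b c (1 - w)"
      using hyp2F1_contiguous_lower[OF c0(1,2) wD(2)] by simp
    also have "\<dots> = - (1 - w) * (- deriv (hyp2F1 a b c) (1 - w)) + (c - 1) * hyp2F1 a b c (1 - w)" by (simp add: algebra_simps)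
    also have "\<dots> = - A * ((1 - w) * deriv y1 w + (1 - c) * y1 w) - B * ((1 - w) * y2' - (c - 1) * y2 w)"
      unfolding deq eq[OF w] by (simp add: algebra_simps)
    also have "(1 - w) * deriv y1 w + (1 - c) * y1 w
        = (a + b - c + 1 - a) * (a + b - c + 1 - b) / (a + b - c + 1) * hyp2F1 a b (a + b - c + 1 + 1) w"
      using hyp2F1_contiguous_raise[OF nI(1,5) wD(1), of a b] by (simp add: y1_def)
    also have "(1 - w) * y2' - (c - 1) * y2 w
       = (C - 1) * (w powr (c - 1 - a - b) * hyp2F1 (c - 1 - a) (c - 1 - b) (c - 1 - a - b + 1) w)"
    proof -
      have "(1 - w) * y2' - (c - 1) * y2 w = (1 - w) powr (1 - c) * w powr (C - 1) * (1 - w) / w * ((C - 1) * H w + w * deriv H w)"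
        unfolding y2H[OF w] y2'_def using wD by (simp add: field_simps)
      also have "w * deriv H w + (C - 1) * H w = (C - 1) * hyp2F1 (1 - a) (1 - b) (C - 1) w"
        unfolding H_def by (rule hyp2F1_contiguous_lower[OF C0 wD(1)])
      then have "(C - 1) * H w + w * deriv H w = (C - 1) * hyp2F1 (1 - a) (1 - b) (C - 1) w"
        by (simp add: add.commute)
      \<comment> \<open>A second use of Euler's transformation leads to the numerator parameters of
        the second solution for c - 1.\<close>
      also have "hyp2F1 (1 - a) (1 - b) (C - 1) w
         = (1 - w) powr (c - 2) * hyp2F1 (c - 1 - a) (c - 1 - b) (c - 1 - a - b + 1) w"
      proof -
        have *: "C - 1 - (1 - b) - (1 - a) = c - 2" "C - 1 - (1 - a) = c - 1 - b" "C - 1 - (1 - b) = c - 1 - a"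
          "c - 1 - a - b + 1 = C - 1" "c - 1 - a - (1 - a) = c - 2" by (simp_all add: C_def)
        show ?thesis
          using hyp2F1_euler[OF C0(2) wD(1), of "1 - b" "1 - a"]
          unfolding * hyp2F1_commute[of "1 - a" "1 - b"] .
      qed
      also have "(1 - w) powr (1 - c) * w powr (C - 1) * (1 - w) / w * ((C - 1) * ((1 - w) powr (c - 2) * h))
         = ((1 - w) powr (1 - c) * (1 - w) powr (c - 2) * (1 - w)) * (C - 1) * ((w powr (C - 1) / w) * h)" for h
        by simp
      also have "(1 - w) powr (1 - c) * (1 - w) powr (c - 2) * (1 - w) = 1"
      proof -
        have "(1 - w) powr (1 - c) * (1 - w) powr (c - 2) = exp (- Ln (1 - w))"
          using wD by (simp add: powr_def algebra_simps flip: exp_add)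
        then show ?thesis using wD by (simp add: exp_minus)
      qed
      also have "w powr (C - 1) / w = w powr (c - 1 - a - b)"
        using wD by (simp add: C_def powr_diff)
      finally show ?thesis by simp
    qed
    finally have "hyp2F1 a b (c - 1) (1 - w) = (- A * ((a + b - c + 1 - a) * (a + b - c + 1 - b) / (a + b - c + 1) * hyp2F1 a b (a + b - c + 1 + 1) w)
       - B * ((C - 1) * (w powr (c - 1 - a - b) * hyp2F1 (c - 1 - a) (c - 1 - b) (c - 1 - a - b + 1) w))) / (c - 1)"
      (is "_ = (- A * (?q * ?f) - B * (_ * ?g)) / _")
      using c0(3) by (simp add: field_simps)
    also have "\<dots> = A * (- ?q / (c - 1)) * ?f + (- B * (C - 1) / (c - 1)) * ?g"
    proof -
      have "(- A * (q * f) - B * (K * g)) / d = A * (- q / d) * f + (- B * K / d) * g" for q f K g d :: complex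
        by (simp add: diff_divide_distrib mult_ac)
      then show ?thesis .
    qed
    \<comment> \<open>Each of the three factors of \<open>?q\<close> changes sign, and together
      these signs cancel the leading minus.\<close>
    also have "- ?q / (c - 1) = (c - 1 - a) * (c - 1 - b) / ((c - 1) * (c - 1 - a - b))"
    proof -
      have 1: "a + b - c + 1 - a = - (c - 1 - b)" "a + b - c + 1 - b = - (c - 1 - a)" "a + b - c + 1 = - (c - 1 - a - b)"
        by simp_all
      have "?q = (- (c - 1 - b)) * (- (c - 1 - a)) / (- (c - 1 - a - b))"
        by (intro arg_cong2[where f = "(/)"] arg_cong2[where f = "(*)"] 1)
      moreover have "- ((- x) * (- y) / (- z)) / d = y * x / (d * z)" for x y z d :: complex by (simp add: mult_ac)
      ultimately show ?thesis by metis
    qed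
    finally have fin: "hyp2F1 a b (c - 1) (1 - w) =
        A * ((c - 1 - a) * (c - 1 - b) / ((c - 1) * (c - 1 - a - b))) * ?f + - B * (C - 1) / (c - 1) * ?g" .
    show "hyp2F1 a b (c - 1) (1 - w) = A * ((c - 1 - a) * (c - 1 - b) / ((c - 1) * (c - 1 - a - b))) * hyp2F1 a b (a + b - (c - 1) + 1) w
      + - B * (C - 1) / (c - 1) * (w powr (c - 1 - a - b) * hyp2F1 (c - 1 - a) (c - 1 - b) (c - 1 - a - b + 1) w)"
    proof -
      have "a + b - (c - 1) + 1 = a + b - c + 1 + 1" by simp
      then show ?thesis using fin by (simp only:)
    qed
  qed
  then show ?thesis by (rule that)
qed

section \<open>The Gauss series for large c\<close>

lemma hyp2F1_sums:
  assumes c: "c \<notin> \<int>\<^sub>\<le>\<^sub>0" and w: "norm w < 1"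
  shows "(\<lambda>n. fps_nth (hyp2F1_fps a b c) n * w ^ n) sums hyp2F1 a b c w"
proof -
  have "(\<lambda>n. (deriv ^^ n) (hyp2F1 a b c) 0 / fact n * (w - 0) ^ n) sums hyp2F1 a b c w"
    by (rule holomorphic_power_series[of _ 0 1])
       (use w hyp2F1_holomorphic[OF c] ball_subset_hyp2F1_domain in \<open>auto intro: holomorphic_on_subset\<close>)
  then show ?thesis
    by (simp add: fps_nth_fps_expansion[OF hyp2F1_has_fps_expansion[OF c]])
qed

text \<open>The majorant is summable without any help from w and carries the factor 1 / R. Its
  consecutive terms have ratio (n + 2) / (n + 4), which has to dominate (m + n + 1)^2 / ((R + n +
  1)(n + 2)). R0 is large enough for this: the difference of the two sides, as a polynomial in n +
  1, then has nonnegative coefficients, and 3 * m^2 <= R0 settles the case n = 0.\<close>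

lemma norm_hyp2F1_fps_nth_le:
  fixes m R :: real
  defines "R0 \<equiv> 3 * m\<^sup>2 + 6 * m + 1"
  assumes m: "norm a \<le> m" "norm b \<le> m" and R: "R \<le> Re c" "R0 \<le> R"
  shows "norm (fps_nth (hyp2F1_fps a b c) (Suc n)) \<le> R0 / R * (2 / ((real n + 2) * (real n + 3)))"
proof -
  have m0: "m \<ge> 0" using m(1) norm_ge_zero order_trans by blast
  have R0: "R0 \<ge> 1" using m0 by (simp add: R0_def)
  have Rpos: "R > 0" using R R0 by simp
  have num: "norm (x + of_nat k) \<le> m + real k" if "norm x \<le> m" for x :: complex and k
    using norm_triangle_ineq[of x "of_nat k"] that by simp
  have den: "norm (c + of_nat k) \<ge> R + real k" for k
    using complex_Re_le_cmod[of "c + of_nat k"] R by simp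
  have step: "norm (fps_nth (hyp2F1_fps a b c) (Suc k))
      \<le> (m + real k)\<^sup>2 / ((R + real k) * (real k + 1)) * norm (fps_nth (hyp2F1_fps a b c) k)" for k
  proof -
    have "norm ((a + of_nat k) * (b + of_nat k)) \<le> (m + real k)\<^sup>2"
      unfolding norm_mult power2_eq_square using m m0 by (intro mult_mono num) auto
    moreover have "norm ((c + of_nat k) * of_nat (Suc k)) \<ge> (R + real k) * (real k + 1)"
      unfolding norm_mult norm_of_nat using den[of k] by (intro mult_mono) auto
    ultimately have "norm ((a + of_nat k) * (b + of_nat k) / ((c + of_nat k) * of_nat (Suc k)))
        \<le> (m + real k)\<^sup>2 / ((R + real k) * (real k + 1))"
      unfolding norm_divide using Rpos by (intro frac_le) auto
    then show ?thesis
      unfolding hyp2F1_fps_nth_Suc norm_mult by (intro mult_right_mono) auto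
  qed
  show ?thesis
  proof (induction n)
    case 0
    have "norm (fps_nth (hyp2F1_fps a b c) (Suc 0)) \<le> m\<^sup>2 / R"
      using step[of 0] by (simp add: hyp2F1_fps_def)
    also have "\<dots> \<le> R0 / R * (1 / 3)" using m0 Rpos by (simp add: R0_def field_simps)
    finally show ?case by simp
  next
    case (Suc n)
    define k where "k = real n"
    have k: "k \<ge> 0" by (simp add: k_def)
    have "(m + (k + 1))\<^sup>2 * (k + 4) \<le> (k + 2)\<^sup>2 * (R0 + (k + 1))"
    proof -
      have "(k + 2)\<^sup>2 * (R0 + (k + 1)) - (m + (k + 1))\<^sup>2 * (k + 4)
         = (3 * m\<^sup>2 + 4 * m) * (k + 1)\<^sup>2 + (5 * m\<^sup>2 + 6 * m + 3) * (k + 1) + (6 * m + 1)"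
        by (simp add: R0_def power2_eq_square algebra_simps)
      also have "\<dots> \<ge> 0" using m0 k by simp
      finally show ?thesis by simp
    qed
    also have "\<dots> \<le> (k + 2)\<^sup>2 * (R + (k + 1))" using R by (intro mult_left_mono) auto
    finally have *: "(m + (k + 1))\<^sup>2 / ((R + (k + 1)) * (k + 2)) \<le> (k + 2) / (k + 4)"
      using Rpos k by (simp add: divide_simps power2_eq_square mult_ac)
    have "norm (fps_nth (hyp2F1_fps a b c) (Suc (Suc n)))
      \<le> (m + (k + 1))\<^sup>2 / ((R + (k + 1)) * (k + 2)) * norm (fps_nth (hyp2F1_fps a b c) (Suc n))"
      using step[of "Suc n"] by (simp add: k_def algebra_simps)
    also have "\<dots> \<le> (k + 2) / (k + 4) * (R0 / R * (2 / ((k + 2) * (k + 3))))"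
      using * Suc Rpos k by (intro mult_mono) (auto simp: k_def)
    also have "\<dots> = R0 / R * (2 / ((k + 3) * (k + 4)))" using k by (simp add: divide_simps)
    finally show ?case by (simp add: k_def algebra_simps)
  qed
qed

lemma summable_inverse_consecutive: "summable (\<lambda>n. 2 / ((real n + 2) * (real n + 3)))"
proof (rule summable_comparison_test')
  show "summable (\<lambda>n. 2 * inverse (real (Suc n) ^ 2))"
    using inverse_power_summable[of 2, where ?'a = real] summable_Suc_iff[of "\<lambda>n. inverse (real n ^ 2)"]
    by (intro summable_mult) simp
  show "norm (2 / ((real n + 2) * (real n + 3))) \<le> 2 * inverse (real (Suc n) ^ 2)" if "n \<ge> 0" for n
    by (simp add: divide_simps power2_eq_square) (simp add: algebra_simps)
qed

text \<open>Termwise comparison after removal of the constant term 1. The bound is uniform on the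
  open disc, hence survives w tending to 1, and it tends to 0 as R grows.\<close>

lemma norm_hyp2F1_diff_1_le:
  fixes m R :: real
  defines "R0 \<equiv> 3 * m\<^sup>2 + 6 * m + 1"
  assumes m: "norm a \<le> m" "norm b \<le> m" and R: "R \<le> Re c" "R0 \<le> R" and w: "norm w < 1"
  shows "norm (hyp2F1 a b c w - 1) \<le> R0 / R * (\<Sum>n. 2 / ((real n + 2) * (real n + 3)))"
proof -
  have m0: "m \<ge> 0" using m(1) norm_ge_zero order_trans by blast
  have R0: "R0 \<ge> 1" using m0 by (simp add: R0_def)
  then have "Re c > 0" using R by simp
  then have c: "c \<notin> \<int>\<^sub>\<le>\<^sub>0" by (auto elim!: nonpos_Ints_cases)
  have "(\<lambda>n. fps_nth (hyp2F1_fps a b c) (Suc n) * w ^ Suc n) sums (hyp2F1 a b c w - 1)"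
    using hyp2F1_sums[OF c w, of a b] by (subst sums_Suc_iff) (simp add: hyp2F1_fps_def)
  moreover have "(\<lambda>n. R0 / R * (2 / ((real n + 2) * (real n + 3)))) sums (R0 / R * (\<Sum>n. 2 / ((real n + 2) * (real n + 3))))"
    by (intro sums_mult summable_sums summable_inverse_consecutive)
  ultimately show ?thesis
  proof (rule norm_sums_le)
    fix n
    have "norm (fps_nth (hyp2F1_fps a b c) (Suc n) * w ^ Suc n) \<le> norm (fps_nth (hyp2F1_fps a b c) (Suc n)) * 1"
      unfolding norm_mult norm_power using w by (intro mult_left_mono power_le_one) auto
    also have "\<dots> \<le> R0 / R * (2 / ((real n + 2) * (real n + 3)))"
      using norm_hyp2F1_fps_nth_le[of a m b R c n] m R by (simp add: R0_def)
    finally show "norm (fps_nth (hyp2F1_fps a b c) (Suc n) * w ^ Suc n) \<le> R0 / R * (2 / ((real n + 2) * (real n + 3)))" .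
  qed
qed

text \<open>For positive real w the power w powr (c - a - b) has modulus w powr Re (c - a - b). It
  tends to 0 with w and removes the second solution, while the hypergeometric factors tend to
  1.\<close>

lemma hyp2F1_connection_imp_limit:
  assumes c: "c \<notin> \<int>" and e: "c - a - b \<notin> \<int>" and AB: "hyp2F1_connection a b c A B"
    and pos: "Re (c - a - b) > 0"
  shows "(\<lambda>n. hyp2F1 a b c (1 - of_real (1 / (real n + 2)))) \<longlonglongrightarrow> A"
proof -
  define s where "s n = 1 / (real n + 2)" for n
  note nI = not_Int_shift[OF e, THEN not_Int_imp_not_nonpos_Int]
  have s: "s \<longlonglongrightarrow> 0" unfolding s_def by real_asymp
  have s': "(\<lambda>n. complex_of_real (s n)) \<longlonglongrightarrow> 0" using tendsto_of_real[OF s] by simp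
  have cont: "(\<lambda>n. hyp2F1 p q r (of_real (s n))) \<longlonglongrightarrow> 1" if "r \<notin> \<int>\<^sub>\<le>\<^sub>0" for p q r
    using isCont_tendsto_compose[OF DERIV_isCont[OF hyp2F1_has_field_derivative(1)[OF that hyp2F1_domain_0]] s', of p q] that
    by simp
  have pw: "(\<lambda>n. complex_of_real (s n) powr (c - a - b)) \<longlonglongrightarrow> 0"
  proof (rule tendsto_norm_zero_cancel)
    have "(\<lambda>n. s n powr Re (c - a - b)) \<longlonglongrightarrow> 0"
    proof (rule tendsto_zero_powrI[OF s tendsto_const _ pos])
      show "\<forall>\<^sub>F n in sequentially. 0 \<le> s n" by (simp add: s_def)
    qed
    moreover have "norm (complex_of_real (s n) powr (c - a - b)) = s n powr Re (c - a - b)" for n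
      using norm_powr_real_powr[of "of_real (s n)" "c - a - b"] by (auto simp: s_def)
    ultimately show "(\<lambda>n. norm (complex_of_real (s n) powr (c - a - b))) \<longlonglongrightarrow> 0" by simp
  qed
  have "(\<lambda>n. A * hyp2F1 a b (a + b - c + 1) (of_real (s n))
     + B * (of_real (s n) powr (c - a - b) * hyp2F1 (c - a) (c - b) (c - a - b + 1) (of_real (s n)))) \<longlonglongrightarrow> A * 1 + B * (0 * 1)"
    by (intro tendsto_intros cont pw nI)
  moreover have "hyp2F1 a b c (1 - of_real (s n)) = A * hyp2F1 a b (a + b - c + 1) (of_real (s n))
     + B * (of_real (s n) powr (c - a - b) * hyp2F1 (c - a) (c - b) (c - a - b + 1) (of_real (s n)))" for n
    using AB two_slit_plane_of_real[of "s n"] unfolding hyp2F1_connection_def by (auto simp: s_def)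
  ultimately show ?thesis unfolding s_def by simp
qed

lemma not_Int_add_of_nat: "x \<notin> (\<int> :: complex set) \<Longrightarrow> x + of_nat n \<notin> \<int>"
  using Ints_diff[of "x + of_nat n" "of_nat n"] by auto

text \<open>
  Lowering \<open>c\<close> multiplies the first coefficient by an explicit factor, and that coefficient tends
  to \<open>1\<close> as \<open>c\<close> is shifted to infinity, because it is the value at \<open>1\<close> of the series. The
  infinite product is evaluated by the product formula for the Gamma function.
\<close>
lemma hyp2F1_connection_first_coeff:
  assumes c: "c \<notin> \<int>" and e: "c - a - b \<notin> \<int>" and AB: "hyp2F1_connection a b c A B"
  shows "A = Gamma c * Gamma (c - a - b) * rGamma (c - a) * rGamma (c - b)"
proof -
  have cn: "c + of_nat n \<notin> \<int>" "c + of_nat n - a - b \<notin> \<int>" for n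
    using not_Int_add_of_nat[OF c, of n] not_Int_add_of_nat[OF e, of n] by (simp_all add: algebra_simps)
  have "\<exists>A B. hyp2F1_connection a b (c + of_nat n) A B" for n
    using hyp2F1_connection_exists[OF cn] by metis
  then obtain a' b' where a': "hyp2F1_connection a b (c + of_nat n) (a' n) (b' n)" for n by metis
  \<comment> \<open>The factor from \<open>hyp2F1_connection_lower\<close> for the step from c + n +
    1 down to c + n.\<close>
  define \<kappa> where "\<kappa> n = (c - a + of_nat n) * (c - b + of_nat n) / ((c + of_nat n) * (c - a - b + of_nat n))" for n
  have step: "a' n = a' (Suc n) * \<kappa> n" for n
  proof -
    obtain B' where "hyp2F1_connection a b (c + of_nat (Suc n) - 1)
      (a' (Suc n) * ((c + of_nat (Suc n) - 1 - a) * (c + of_nat (Suc n) - 1 - b)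
        / ((c + of_nat (Suc n) - 1) * (c + of_nat (Suc n) - 1 - a - b)))) B'"
      using hyp2F1_connection_lower[OF cn a'] by blast
    then have "hyp2F1_connection a b (c + of_nat n) (a' (Suc n) * \<kappa> n) B'"
      by (simp add: \<kappa>_def algebra_simps)
    then show ?thesis using hyp2F1_connection_unique[OF cn(2) a'] by blast
  qed
  have A0: "A = a' n * (pochhammer (c - a) n * pochhammer (c - b) n / (pochhammer c n * pochhammer (c - a - b) n))" for n
  proof (induction n)
    case 0
    show ?case using hyp2F1_connection_unique[OF e AB] a'[of 0] by simp
  next
    case (Suc n)
    then show ?case unfolding step[of n] \<kappa>_def pochhammer_Suc by (simp add: mult_ac)
  qed
  have lim: "a' \<longlonglongrightarrow> 1"
  proof -
    define m where "m = max (norm a) (norm b)"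
    define R0 where "R0 = 3 * m\<^sup>2 + 6 * m + 1"
    define S where "S = (\<Sum>n. 2 / ((real n + 2) * (real n + 3)))"
    have "(\<lambda>n. a' n - 1) \<longlonglongrightarrow> 0"
    proof (rule Lim_null_comparison)
      show "(\<lambda>n. R0 / (Re c + real n) * S) \<longlonglongrightarrow> 0" by real_asymp
      have "\<forall>\<^sub>F n in sequentially. Re c + real n \<ge> R0" by real_asymp
      moreover have "\<forall>\<^sub>F n in sequentially. Re (c - a - b) + real n > 0" by real_asymp
      ultimately show "\<forall>\<^sub>F n in sequentially. norm (a' n - 1) \<le> R0 / (Re c + real n) * S"
      proof eventually_elim
        case (elim n)
        \<comment> \<open>For fixed n the limit over j identifies a' n. The estimate is the same for
          all j and therefore passes to a' n; only afterwards does n grow.\<close>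
        have "(\<lambda>j. hyp2F1 a b (c + of_nat n) (1 - of_real (1 / (real j + 2)))) \<longlonglongrightarrow> a' n"
          by (rule hyp2F1_connection_imp_limit[OF cn a']) (use elim in simp)
        then have "(\<lambda>j. norm (hyp2F1 a b (c + of_nat n) (1 - of_real (1 / (real j + 2))) - 1)) \<longlonglongrightarrow> norm (a' n - 1)"
          by (intro tendsto_intros)
        moreover have "norm (hyp2F1 a b (c + of_nat n) (1 - of_real (1 / (real j + 2))) - 1) \<le> R0 / (Re c + real n) * S" for j
        proof -
          have "1 - complex_of_real (1 / (real j + 2)) = of_real (1 - 1 / (real j + 2))" by simp
          then have "norm (1 - complex_of_real (1 / (real j + 2))) = \<bar>1 - 1 / (real j + 2)\<bar>"
            by (metis norm_of_real)
          also have "\<dots> < 1" by (simp add: field_simps)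
          finally show ?thesis
            unfolding R0_def S_def using elim
            by (intro norm_hyp2F1_diff_1_le) (auto simp: m_def R0_def)
        qed
        ultimately show ?case by (intro LIMSEQ_le_const2) auto
      qed
    qed
    then show ?thesis by (simp add: LIM_zero_iff)
  qed
  have nz: "rGamma c \<noteq> 0" "rGamma (c - a - b) \<noteq> 0"
    using c e by (auto simp: rGamma_eq_zero_iff dest: not_Int_imp_not_nonpos_Int)
  \<comment> \<open>The index is Suc n because \<open>rGamma_series z n\<close> contains
    \<open>pochhammer z (n + 1)\<close>. Its factorials cancel, and so do its powers of n, since (c
    - a) + (c - b) = c + (c - a - b).\<close>
  have "(\<lambda>n. a' (Suc n) * (rGamma_series (c - a) n * rGamma_series (c - b) n / (rGamma_series c n * rGamma_series (c - a - b) n)))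
     \<longlonglongrightarrow> 1 * (rGamma (c - a) * rGamma (c - b) / (rGamma c * rGamma (c - a - b)))"
    using nz by (intro tendsto_intros LIMSEQ_Suc[OF lim]) auto
  moreover have "a' (Suc n) * (rGamma_series (c - a) n * rGamma_series (c - b) n / (rGamma_series c n * rGamma_series (c - a - b) n)) = A" for n
  proof -
    define L where "L = complex_of_real (ln (real n))"
    have "exp ((c - a) * L) * exp ((c - b) * L) = exp (c * L) * exp ((c - a - b) * L)"
      by (simp add: algebra_simps flip: exp_add)
    moreover have "(p1 / (f * e1)) * (p2 / (f * e2)) / ((p3 / (f * e3)) * (p4 / (f * e4))) = p1 * p2 / (p3 * p4)"
      if "e1 * e2 = e3 * e4" "f \<noteq> 0" "e3 \<noteq> 0" "e4 \<noteq> 0" for p1 p2 p3 p4 e1 e2 e3 e4 f :: complex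
    proof -
      have "(p1 / (f * e1)) * (p2 / (f * e2)) / ((p3 / (f * e3)) * (p4 / (f * e4)))
        = (p1 * p2 / (p3 * p4)) * ((f * f) * (e3 * e4) / ((f * f) * (e1 * e2)))"
        by (simp add: field_simps)
      also have "\<dots> = p1 * p2 / (p3 * p4)" unfolding that(1) using that by simp
      finally show ?thesis .
    qed
    ultimately have "rGamma_series (c - a) n * rGamma_series (c - b) n / (rGamma_series c n * rGamma_series (c - a - b) n)
      = pochhammer (c - a) (Suc n) * pochhammer (c - b) (Suc n) / (pochhammer c (Suc n) * pochhammer (c - a - b) (Suc n))"
      unfolding rGamma_series_def L_def[symmetric] Suc_eq_plus1[symmetric] by simp
    then show ?thesis using A0[of "Suc n"] by simp
  qed
  ultimately have "A = 1 * (rGamma (c - a) * rGamma (c - b) / (rGamma c * rGamma (c - a - b)))"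
    by (simp add: LIMSEQ_const_iff)
  then show ?thesis using nz by (simp add: Gamma_def field_simps)
qed

text \<open>The formula for the first coefficient is used twice: directly, and for c - a, c - b, c,
  where by \<open>hyp2F1_connection_euler\<close> it gives the second coefficient.\<close>

lemma hyp2F1_one_minus:
  assumes c: "c \<notin> \<int>" and e: "c - a - b \<notin> \<int>" and w: "w \<in> two_slit_plane"
  shows "hyp2F1 a b c (1 - w) =
     Gamma c * Gamma (c - a - b) * rGamma (c - a) * rGamma (c - b) * hyp2F1 a b (a + b - c + 1) w
     + Gamma c * Gamma (a + b - c) * rGamma a * rGamma b
         * (w powr (c - a - b) * hyp2F1 (c - a) (c - b) (c - a - b + 1) w)"
proof -
  obtain A B where AB: "hyp2F1_connection a b c A B" using hyp2F1_connection_exists[OF c e] by blast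
  have *: "c - (c - a) = a" "c - (c - b) = b" "a - (c - b) = a + b - c" by simp_all
  have "c - (c - a) - (c - b) \<notin> \<int>" using not_Int_shift(4)[OF e] unfolding * .
  from hyp2F1_connection_first_coeff[OF c this hyp2F1_connection_euler[OF c e AB]]
  have B: "B = Gamma c * Gamma (a + b - c) * rGamma a * rGamma b" unfolding * .
  show ?thesis
    using AB w unfolding hyp2F1_connection_def hyp2F1_connection_first_coeff[OF c e AB] B by blast
qed

section \<open>Legendre and Ferrers functions\<close>

lemma D1_iff: "x \<in> D1 \<longleftrightarrow> (Im x = 0 \<longrightarrow> \<bar>Re x\<bar> < 1)"
proof -
  have "x \<in> D1 \<longleftrightarrow> \<not> (Im x = 0 \<and> (Re x \<le> -1 \<or> 1 \<le> Re x))"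
    by (auto simp: D1_def complex_eq_iff intro: exI[of _ "Re x"])
  then show ?thesis by auto
qed

lemma open_D1: "open D1"
proof -
  have "D1 = {x. Im x \<noteq> 0} \<union> {x. \<bar>Re x\<bar> < 1}" by (auto simp: D1_iff)
  also have "open \<dots>" by (intro open_Un open_Collect_neq open_Collect_less continuous_intros)
  finally show ?thesis .
qed

lemma connected_D1: "connected D1"
proof (rule starlike_imp_connected)
  have "closed_segment 0 w \<subseteq> D1" if w: "w \<in> D1" for w
  proof
    fix x assume "x \<in> closed_segment 0 w"
    then obtain u where u: "0 \<le> u" "u \<le> 1" "x = of_real u * w"
      by (auto simp: in_segment scaleR_conv_of_real)
    have "u * \<bar>Re w\<bar> \<le> \<bar>Re w\<bar>" using u by (simp add: mult_left_le_one_le)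
    then show "x \<in> D1" using w u by (auto simp: D1_iff abs_mult)
  qed
  then show "starlike D1" by (auto simp: starlike_def intro!: bexI[of _ 0]) (auto simp: D1_iff)
qed

section \<open>Branches of the elementary functions on the strip\<close>

definition strip :: "complex set" where
  "strip = {\<theta>. 0 < Re \<theta> \<and> Re \<theta> < pi}"

lemma open_strip: "open strip"
  unfolding strip_def by (intro open_Collect_conj open_Collect_less continuous_intros)

text \<open>The real part of \<open>Arccos x\<close> is the argument of u, so u must lie in the
  upper half plane. As x - i s is the inverse of u, 2 Re s is Im u times a positive factor, and Re s
  is nonnegative for the principal root; Im u = 0 would put x on the cuts.\<close>

lemma Arccos_in_strip:
  assumes "x \<in> D1"
  shows "Arccos x \<in> strip"
proof -
  define s where "s = csqrt (1 - x\<^sup>2)"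
  define u where "u = x + \<i> * s"
  have "s\<^sup>2 = 1 - x\<^sup>2" by (simp add: s_def)
  then have "u * (x - \<i> * s) = 1" by (simp add: u_def algebra_simps power2_eq_square)
  then have inv: "x - \<i> * s = inverse u" by (metis inverse_unique)
  have "2 * Re s = Im (u - inverse u)" unfolding inv[symmetric] by (simp add: u_def)
  also have "\<dots> = Im u * (1 + 1 / ((Re u)\<^sup>2 + (Im u)\<^sup>2))" by (simp add: distrib_left)
  finally have "Im u * (1 + 1 / ((Re u)\<^sup>2 + (Im u)\<^sup>2)) \<ge> 0"
    using Re_csqrt[of "1 - x\<^sup>2", folded s_def] by linarith
  moreover have "1 + 1 / ((Re u)\<^sup>2 + (Im u)\<^sup>2) > 0" by (intro add_pos_nonneg) auto
  ultimately have "Im u \<ge> 0" by (simp add: zero_le_mult_iff)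
  moreover have "Im u \<noteq> 0"
    using isCont_Arccos_lemma[of x] assms by (auto simp: u_def s_def D1_iff)
  ultimately show ?thesis
    using Im_Ln_pos_lt_imp[of u] by (auto simp: strip_def Re_Arccos u_def s_def)
qed

lemma cos_strip_in_D1:
  assumes "\<theta> \<in> strip"
  shows "cos \<theta> \<in> D1"
  unfolding D1_iff
proof
  have s: "sin (Re \<theta>) > 0" using assms by (auto simp: strip_def sin_gt_zero)
  assume "Im (cos \<theta>) = 0"
  then have "sinh (Im \<theta>) = 0" using s by (auto simp: Im_cos sinh_def)
  then have "Im \<theta> = 0" by simp
  moreover have "\<bar>cos (Re \<theta>)\<bar> < 1"
  proof -
    have "(cos (Re \<theta>))\<^sup>2 < 1\<^sup>2" using s sin_cos_squared_add[of "Re \<theta>"] by (smt (verit) one_power2 zero_less_power)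
    then show ?thesis using abs_le_square_iff[of 1 "cos (Re \<theta>)"] by (auto simp: not_le[symmetric])
  qed
  ultimately show "\<bar>Re (cos \<theta>)\<bar> < 1" by (simp add: Re_cos)
qed

lemma Arccos_cos_strip: "\<theta> \<in> strip \<Longrightarrow> Arccos (cos \<theta>) = \<theta>"
  by (rule Arccos_cos) (auto simp: strip_def)

lemma Re_sin_pos:
  assumes "\<theta> \<in> strip"
  shows "Re (sin \<theta>) > 0"
  using assms by (auto simp: strip_def Re_sin sin_gt_zero add_pos_pos)

lemma sin_strip:
  assumes "\<theta> \<in> strip"
  shows "sin \<theta> \<noteq> 0" "sin \<theta> \<notin> \<real>\<^sub>\<le>\<^sub>0" "\<bar>Im (Ln (sin \<theta>))\<bar> < pi / 2" "exp (Ln (sin \<theta>)) = sin \<theta>"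
proof -
  show 1: "sin \<theta> \<noteq> 0" using Re_sin_pos[OF assms] by auto
  show "sin \<theta> \<notin> \<real>\<^sub>\<le>\<^sub>0" using Re_sin_pos[OF assms] by (auto simp: complex_nonpos_Reals_iff)
  show "\<bar>Im (Ln (sin \<theta>))\<bar> < pi / 2" using Re_Ln_pos_lt[OF 1] Re_sin_pos[OF assms] by simp
  show "exp (Ln (sin \<theta>)) = sin \<theta>" using 1 by simp
qed

text \<open>Settles branch questions on the strip: once a logarithm is known explicitly, a strict
  bound on its imaginary part makes it principal and keeps its exponential off the cut.\<close>

lemma Ln_eqI:
  assumes "exp z = w" "\<bar>Im z\<bar> < pi"
  shows "Ln w = z" "w \<notin> \<real>\<^sub>\<le>\<^sub>0" "w powr s = exp (s * z)"
proof -
  show Ln: "Ln w = z" using assms by (intro Ln_unique) auto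
  have nz: "w \<noteq> 0" using assms by auto
  show "w \<notin> \<real>\<^sub>\<le>\<^sub>0"
  proof
    assume "w \<in> \<real>\<^sub>\<le>\<^sub>0"
    then have "Im (Ln w) = pi" using nz by (auto simp: Im_Ln_eq_pi complex_nonpos_Reals_iff complex_eq_iff)
    then show False using assms Ln by auto
  qed
  show "w powr s = exp (s * z)" using nz by (simp add: powr_def Ln)
qed

definition cot_arg :: "complex \<Rightarrow> complex \<Rightarrow> complex" where
  "cot_arg \<tau> \<theta> = 1/2 + \<tau> * (\<i> / 2) * cot \<theta>"

lemma cot_arg_minus: "cot_arg (- \<tau>) \<theta> = 1 - cot_arg \<tau> \<theta>"
  by (simp add: cot_arg_def)

lemma exp_ii_sign:
  assumes "\<tau> = 1 \<or> \<tau> = -1"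
  shows "exp (\<i> * \<tau> * \<theta>) = cos \<theta> + \<tau> * \<i> * sin \<theta>" "exp (- (\<i> * \<tau> * \<theta>)) = cos \<theta> - \<tau> * \<i> * sin \<theta>"
    "exp (\<i> * \<tau> * (pi / 2)) = \<tau> * \<i>" "exp (\<i> * \<tau> * pi) = - 1" "\<tau> * \<tau> = 1"
proof -
  show 1: "exp (\<i> * \<tau> * \<theta>) = cos \<theta> + \<tau> * \<i> * sin \<theta>" for \<theta>
    using assms exp_Euler[of \<theta>] exp_Euler[of "- \<theta>"] by auto
  show "exp (- (\<i> * \<tau> * \<theta>)) = cos \<theta> - \<tau> * \<i> * sin \<theta>"
    using 1[of "- \<theta>"] by simp
  show "exp (\<i> * \<tau> * (pi / 2)) = \<tau> * \<i>" "exp (\<i> * \<tau> * pi) = - 1"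
    using 1[of "of_real (pi / 2)"] 1[of "of_real pi"] unfolding cos_of_real sin_of_real by simp_all
  show "\<tau> * \<tau> = 1" using assms by auto
qed

text \<open>The value of \<open>cot_arg\<close> is \<tau> i exp (- i \<tau> \<theta>) / (2 sin
  \<theta>), which yields this logarithm. Both pi / 2 - Re \<theta> and the argument of sin \<theta>
  are below pi / 2 in modulus, whence the bound.\<close>

lemma cot_arg_strip:
  assumes \<tau>: "\<tau> = 1 \<or> \<tau> = -1" and \<theta>: "\<theta> \<in> strip"
  defines "z \<equiv> \<tau> * (\<i> * (pi / 2) - \<i> * \<theta>) - ln 2 - Ln (sin \<theta>)"
  shows "exp z = cot_arg \<tau> \<theta>" "\<bar>Im z\<bar> < pi"
proof -
  have "z = \<i> * \<tau> * (pi / 2) + - (\<i> * \<tau> * \<theta>) - (ln 2 + Ln (sin \<theta>))"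
    by (simp add: z_def algebra_simps)
  then have "exp z = exp (\<i> * \<tau> * (pi / 2)) * exp (- (\<i> * \<tau> * \<theta>)) / (exp (ln 2) * exp (Ln (sin \<theta>)))"
    by (simp only: exp_diff exp_add)
  also have "\<dots> = \<tau> * \<i> * (cos \<theta> - \<tau> * \<i> * sin \<theta>) / (2 * sin \<theta>)"
    unfolding exp_ii_sign(2,3)[OF \<tau>] sin_strip(4)[OF \<theta>] by simp
  also have "\<tau> * \<i> * (cos \<theta> - \<tau> * \<i> * sin \<theta>) = (\<tau> * \<tau>) * sin \<theta> + \<tau> * \<i> * cos \<theta>"
    by (simp add: algebra_simps)
  also have "\<dots> / (2 * sin \<theta>) = cot_arg \<tau> \<theta>"
    using sin_strip(1)[OF \<theta>] exp_ii_sign(5)[OF \<tau>] by (simp add: cot_arg_def cot_def add_divide_distrib)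
  finally show "exp z = cot_arg \<tau> \<theta>" .
  have "Im z = Re \<tau> * (pi / 2 - Re \<theta>) - Im (Ln (sin \<theta>))"
    using \<tau> Ln_of_real[of 2] by (auto simp: z_def)
  then show "\<bar>Im z\<bar> < pi"
    using \<tau> \<theta> sin_strip(3)[OF \<theta>] by (auto simp: strip_def abs_if split: if_splits)
qed

lemma cot_arg_two_slit_plane:
  assumes \<tau>: "\<tau> = 1 \<or> \<tau> = -1" and \<theta>: "\<theta> \<in> strip"
  shows "cot_arg \<tau> \<theta> \<in> two_slit_plane"
proof -
  have "- \<tau> = 1 \<or> - \<tau> = -1" using \<tau> by auto
  from Ln_eqI(2)[OF cot_arg_strip[OF this \<theta>]] Ln_eqI(2)[OF cot_arg_strip[OF \<tau> \<theta>]]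
  show ?thesis by (simp add: two_slit_plane_def cot_arg_minus)
qed

text \<open>
  With \<open>\<tau> = 1\<close> this is the boundary value from the upper half plane, with \<open>\<tau> = -1\<close> the one from the
  lower half plane.
\<close>
definition legendre_Q_bv :: "complex \<Rightarrow> complex \<Rightarrow> complex \<Rightarrow> complex \<Rightarrow> complex" where
  "legendre_Q_bv \<nu> \<mu> \<tau> \<theta> = complex_of_real (sqrt pi) / 2 powr (1/2) * exp (\<i> * pi * \<mu>)
     * (Gamma (\<nu> + \<mu> + 1) * rGamma (\<nu> + 3/2)) * exp (- \<tau> * (\<i> * pi / 4))
     * exp (- \<tau> * \<i> * (\<nu> + 1/2) * \<theta>) / csqrt (sin \<theta>)
     * hyp2F1 (1/2 + \<mu>) (1/2 - \<mu>) (\<nu> + 3/2) (cot_arg \<tau> \<theta>)"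

lemma legendre_Q_bv_holomorphic:
  assumes c: "\<nu> + 3/2 \<notin> \<int>\<^sub>\<le>\<^sub>0" and \<tau>: "\<tau> = 1 \<or> \<tau> = -1"
  shows "legendre_Q_bv \<nu> \<mu> \<tau> holomorphic_on strip"
proof -
  have 1: "(hyp2F1 (1/2 + \<mu>) (1/2 - \<mu>) (\<nu> + 3/2) \<circ> cot_arg \<tau>) holomorphic_on strip"
  proof (rule holomorphic_on_compose_gen[OF _ hyp2F1_holomorphic[OF c]])
    show "cot_arg \<tau> holomorphic_on strip"
      unfolding cot_arg_def [abs_def] cot_def by (intro holomorphic_intros) (use sin_strip in auto)
    show "cot_arg \<tau> ` strip \<subseteq> hyp2F1_domain"
      using cot_arg_two_slit_plane[OF \<tau>] two_slit_plane_subset by blast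
  qed
  show ?thesis
    unfolding legendre_Q_bv_def [abs_def]
    by (intro holomorphic_intros 1[unfolded o_def]) (use sin_strip in auto)
qed

text \<open>\<open>hyp2F1_quadratic\<close> applies with \<alpha> = \<nu> + \<mu> + 1, because 1 /
  z^2 = 4 t / (1 + t)^2. Pfaff's transformation then replaces t by t / (t - 1), which is
  \<open>cot_arg\<close>, so the condition norm t < 1 is no longer visible in the result. All
  remaining factors are powers; their logarithms are determined in A, B and C and added up in
  \<open>key\<close>.\<close>

lemma legendre_Q_cos:
  assumes c: "\<nu> + 3/2 \<notin> \<int>\<^sub>\<le>\<^sub>0" and \<tau>: "\<tau> = 1 \<or> \<tau> = -1" and \<theta>: "\<theta> \<in> strip" and sgn: "Re \<tau> * Im (cos \<theta>) > 0"
  shows "legendre_Q \<nu> \<mu> (cos \<theta>) = legendre_Q_bv \<nu> \<mu> \<tau> \<theta>"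
proof -
  define \<alpha> where "\<alpha> = \<nu> + \<mu> + 1"
  define z where "z = cos \<theta>"
  define L where "L = Ln (sin \<theta>)"
  define t where "t = exp (- (\<i> * \<tau> * (2 * \<theta>)))"
  define l where "l = complex_of_real (ln 2)"
  have l2: "exp l = 2" by (simp add: l_def exp_of_real)
  note L = sin_strip[OF \<theta>, folded L_def]
  note ex = exp_ii_sign[OF \<tau>]
  have \<tau>': "Re \<tau> = 1 \<and> \<tau> = 1 \<or> Re \<tau> = - 1 \<and> \<tau> = - 1" using \<tau> by auto
  have Imz: "Re \<tau> * Im z > 0" using sgn by (simp add: z_def)
  have znz: "z \<noteq> 0" using Imz by auto
  \<comment> \<open>The half plane selected by \<tau> is the one in which norm t = exp (2 \<tau> Im
    \<theta>) is below 1.\<close>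
  have Im0: "Re \<tau> * Im \<theta> < 0"
  proof (rule ccontr)
    assume "\<not> ?thesis"
    then have "exp (- (Re \<tau> * Im \<theta>)) \<le> exp (Re \<tau> * Im \<theta>)" by simp
    moreover have "Re \<tau> * Im z = sin (Re \<theta>) * (exp (- (Re \<tau> * Im \<theta>)) - exp (Re \<tau> * Im \<theta>)) / 2"
      using \<tau>' by (auto simp: z_def Im_cos)
    moreover have "sin (Re \<theta>) > 0" using \<theta> by (auto simp: strip_def sin_gt_zero)
    ultimately show False using Imz
      mult_nonneg_nonpos[of "sin (Re \<theta>)" "exp (- (Re \<tau> * Im \<theta>)) - exp (Re \<tau> * Im \<theta>)"] by linarith
  qed
  have t: "norm t < 1" using Im0 \<tau>' by (auto simp: t_def norm_exp_eq_Re)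
  have e2: "t = exp (- (\<i> * \<tau> * \<theta>)) * exp (- (\<i> * \<tau> * \<theta>))"
    by (simp add: t_def algebra_simps flip: exp_add)
  have inv: "exp (- (\<i> * \<tau> * \<theta>)) * exp (\<i> * \<tau> * \<theta>) = 1" by (simp flip: exp_add)
  have plus: "1 + t = 2 * exp (- (\<i> * \<tau> * \<theta>)) * z"
  proof -
    have "2 * z = exp (\<i> * \<tau> * \<theta>) + exp (- (\<i> * \<tau> * \<theta>))" unfolding ex z_def by simp
    then have "2 * exp (- (\<i> * \<tau> * \<theta>)) * z = exp (- (\<i> * \<tau> * \<theta>)) * (exp (\<i> * \<tau> * \<theta>) + exp (- (\<i> * \<tau> * \<theta>)))"
      by (simp add: mult_ac)
    then show ?thesis unfolding distrib_left inv e2 by simp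
  qed
  have minus: "1 - t = 2 * (\<tau> * \<i>) * exp (- (\<i> * \<tau> * \<theta>)) * sin \<theta>"
  proof -
    have "2 * (\<tau> * \<i>) * sin \<theta> = exp (\<i> * \<tau> * \<theta>) - exp (- (\<i> * \<tau> * \<theta>))" unfolding ex by simp
    then have "2 * (\<tau> * \<i>) * exp (- (\<i> * \<tau> * \<theta>)) * sin \<theta> = exp (- (\<i> * \<tau> * \<theta>)) * (exp (\<i> * \<tau> * \<theta>) - exp (- (\<i> * \<tau> * \<theta>)))"
      by (simp add: mult_ac)
    then show ?thesis unfolding right_diff_distrib inv e2 by simp
  qed
  have tRe: "\<bar>Re t\<bar> < 1" using t abs_Re_le_cmod[of t] by simp
  have nz: "1 + t \<noteq> 0" "1 - t \<noteq> 0" using tRe by (auto simp: complex_eq_iff)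
  have Imb: "\<bar>Im (Ln (1 + t))\<bar> < pi / 2" "\<bar>Im (Ln (1 - t))\<bar> < pi / 2"
    using Re_Ln_pos_lt[OF nz(1)] Re_Ln_pos_lt[OF nz(2)] tRe by auto
  have Imz': "0 < Re \<tau> * Im (Ln z)" "Re \<tau> * Im (Ln z) < pi"
    if "Re \<tau> * Im z > 0" for z
  proof -
    have "Im z \<noteq> 0" "z \<noteq> 0" using that by auto
    have "Re \<tau> = 1 \<and> 0 < Im z \<or> Re \<tau> = - 1 \<and> Im z < 0" using \<tau>' that by auto
    then show "0 < Re \<tau> * Im (Ln z)" "Re \<tau> * Im (Ln z) < pi"
      using Im_Ln_pos_lt[OF \<open>z \<noteq> 0\<close>] Im_Ln_pos_lt_imp[of z] Im_Ln_pos_le[OF \<open>z \<noteq> 0\<close>]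
        mpi_less_Im_Ln[OF \<open>z \<noteq> 0\<close>] Im_Ln_le_pi[OF \<open>z \<noteq> 0\<close>] by auto
  qed
  have Re\<theta>: "0 < Re \<theta>" "Re \<theta> < pi" using \<theta> by (auto simp: strip_def)
  \<comment> \<open>The exponentials agree, so it suffices that the imaginary parts differ by less
    than 2 pi. For this \<tau> Im (Ln z) and Re \<theta> both lie in (0, pi), and 1 + t has positive
    real part. B is obtained in the same way.\<close>
  have A: "Ln (1 + t) = l - \<i> * \<tau> * \<theta> + Ln z"
  proof (rule exp_complex_eqI)
    show "exp (Ln (1 + t)) = exp (l - \<i> * \<tau> * \<theta> + Ln z)"
      using nz znz by (simp add: plus l2 exp_add exp_diff exp_minus field_simps)
    have "Im (l - \<i> * \<tau> * \<theta> + Ln z) = - Re \<tau> * Re \<theta> + Im (Ln z)" using \<tau>' by (auto simp: l_def)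
    then show "\<bar>Im (Ln (1 + t)) - Im (l - \<i> * \<tau> * \<theta> + Ln z)\<bar> < 2 * pi"
      using Imb(1) Imz'[OF Imz] Re\<theta> \<tau>' by (auto simp: abs_if split: if_splits)
  qed
  have B: "Ln (1 - t) = l + \<i> * \<tau> * (pi / 2) - \<i> * \<tau> * \<theta> + L"
  proof (rule exp_complex_eqI)
    have "exp (l + \<i> * \<tau> * (pi / 2) - \<i> * \<tau> * \<theta> + L) = 2 * (\<tau> * \<i>) * exp (- (\<i> * \<tau> * \<theta>)) * sin \<theta>"
      unfolding diff_conv_add_uminus[of _ "\<i> * \<tau> * \<theta>"] exp_add l2 L ex(3) by simp
    then show "exp (Ln (1 - t)) = exp (l + \<i> * \<tau> * (pi / 2) - \<i> * \<tau> * \<theta> + L)"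
      using nz by (simp add: minus)
    have "Im (l + \<i> * \<tau> * (pi / 2) - \<i> * \<tau> * \<theta> + L) = Re \<tau> * (pi / 2 - Re \<theta>) + Im L"
      using \<tau>' by (auto simp: l_def)
    then show "\<bar>Im (Ln (1 - t)) - Im (l + \<i> * \<tau> * (pi / 2) - \<i> * \<tau> * \<theta> + L)\<bar> < 2 * pi"
      using Imb(2) L(3) Re\<theta> \<tau>' by (auto simp: abs_if split: if_splits)
  qed
  have z1: "z + 1 \<noteq> 0" "z - 1 \<noteq> 0" using Imz by (auto simp: complex_eq_iff)
  \<comment> \<open>The product of the arguments is - (sin \<theta>)^2, but the sum of the
    logarithms need not be principal. In the half plane of \<tau> both logarithms have imaginary
    part of sign \<tau> and modulus below pi, which singles out the term i \<tau> pi.\<close>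
  have C: "Ln (z + 1) + Ln (z - 1) = 2 * L + \<i> * \<tau> * pi"
  proof (rule exp_complex_eqI)
    have "(z + 1) * (z - 1) = - (sin \<theta> * sin \<theta>)"
      using sin_cos_squared_add[of \<theta>] by (simp add: z_def algebra_simps power2_eq_square)
    then show "exp (Ln (z + 1) + Ln (z - 1)) = exp (2 * L + \<i> * \<tau> * pi)"
      unfolding exp_add mult_2 ex(4) L using z1 by simp
    have "Im (2 * L + \<i> * \<tau> * pi) = 2 * Im L + Re \<tau> * pi" using \<tau>' by auto
    then show "\<bar>Im (Ln (z + 1) + Ln (z - 1)) - Im (2 * L + \<i> * \<tau> * pi)\<bar> < 2 * pi"
      using Imz'[of "z + 1"] Imz'[of "z - 1"] Imz L(3) \<tau>' by (auto simp: abs_if split: if_splits)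
  qed
  have arg: "1 / z\<^sup>2 = 4 * t / (1 + t)\<^sup>2"
    unfolding plus using znz by (simp add: e2 power2_eq_square)
  have tdom: "t \<in> hyp2F1_domain" using t ball_subset_hyp2F1_domain by auto
  have t': "t / (t - 1) = cot_arg \<tau> \<theta>"
  proof -
    have "t / (t - 1) = - (t / (1 - t))" using nz by (simp add: divide_simps) (simp add: algebra_simps)
    also have "\<dots> = - (exp (- (\<i> * \<tau> * \<theta>)) / (2 * (\<tau> * \<i>) * sin \<theta>))"
      unfolding minus unfolding e2 by simp
    also have "\<dots> = \<tau> * \<i> * (cos \<theta> - \<tau> * \<i> * sin \<theta>) / (2 * sin \<theta>)"
      unfolding ex(2) using L(1) \<tau> by (auto simp: divide_simps algebra_simps)
    also have "\<tau> * \<i> * (cos \<theta> - \<tau> * \<i> * sin \<theta>) = (\<tau> * \<tau>) * sin \<theta> + \<tau> * \<i> * cos \<theta>"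
      by (simp add: algebra_simps)
    also have "\<dots> / (2 * sin \<theta>) = cot_arg \<tau> \<theta>"
      using L(1) ex(5) by (simp add: cot_arg_def cot_def add_divide_distrib)
    finally show ?thesis .
  qed
  define F where "F = hyp2F1 (1/2 + \<mu>) (1/2 - \<mu>) (\<nu> + 3/2) (cot_arg \<tau> \<theta>)"
  have hyp: "hyp2F1 ((\<nu> + \<mu> + 2) / 2) ((\<nu> + \<mu> + 1) / 2) (\<nu> + 3/2) (1 / z\<^sup>2)
      = exp (\<alpha> * Ln (1 + t)) * (exp (- (1/2 + \<mu>) * Ln (1 - t)) * F)"
  proof -
    have 1: "(\<nu> + \<mu> + 2) / 2 = (\<alpha> + 1) / 2" "(\<nu> + \<mu> + 1) / 2 = \<alpha> / 2"
      "\<alpha> - (\<nu> + 3/2) + 1 = 1/2 + \<mu>" "\<nu> + 3/2 - \<alpha> = 1/2 - \<mu>"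
      by (simp_all add: \<alpha>_def)
    have "hyp2F1 ((\<nu> + \<mu> + 2) / 2) ((\<nu> + \<mu> + 1) / 2) (\<nu> + 3/2) (1 / z\<^sup>2)
      = (1 + t) powr \<alpha> * hyp2F1 (1/2 + \<mu>) \<alpha> (\<nu> + 3/2) t"
      unfolding 1(1,2) arg hyp2F1_commute[of "(\<alpha> + 1) / 2"] hyp2F1_quadratic[OF c t] 1(3)
      by (simp add: hyp2F1_commute)
    also have "hyp2F1 (1/2 + \<mu>) \<alpha> (\<nu> + 3/2) t = (1 - t) powr (- (1/2 + \<mu>)) * F"
      unfolding hyp2F1_pfaff[OF c tdom, of "1/2 + \<mu>" \<alpha>] 1(4) t' F_def ..
    finally show ?thesis using nz by (simp add: powr_def)
  qed
  have pw: "(z + 1) powr (\<mu> / 2) * (z - 1) powr (\<mu> / 2) = exp (\<mu> / 2 * (2 * L + \<i> * \<tau> * pi))"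
    unfolding C[symmetric] using z1 by (simp add: powr_def distrib_left flip: exp_add)
  have two: "2 powr s = exp (s * l)" for s :: complex by (simp add: powr_def l_def flip: Ln_of_real)
  have csq: "csqrt (sin \<theta>) = exp (L / 2)" using L(1) by (simp add: csqrt_exp_Ln L_def)
  have key: "exp (\<mu> / 2 * (2 * L + \<i> * \<tau> * pi)) / (exp ((\<nu> + 1) * l) * exp (\<alpha> * Ln z))
        * (exp (\<alpha> * Ln (1 + t)) * exp (- (1/2 + \<mu>) * Ln (1 - t)))
      = exp (- \<tau> * (\<i> * pi / 4)) * exp (- \<tau> * \<i> * (\<nu> + 1/2) * \<theta>) / exp (L / 2) / exp (1 / 2 * l)"
    unfolding A B \<alpha>_def exp_add[symmetric] exp_diff[symmetric]
    by (rule arg_cong[of _ _ exp]) (simp add: field_simps)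
  define P where "P = complex_of_real (sqrt pi) * exp (\<i> * pi * \<mu>) * Gamma (\<nu> + \<mu> + 1) * rGamma (\<nu> + 3/2) * F"
  have "legendre_Q \<nu> \<mu> (cos \<theta>) = P * (exp (\<mu> / 2 * (2 * L + \<i> * \<tau> * pi)) / (exp ((\<nu> + 1) * l) * exp (\<alpha> * Ln z))
        * (exp (\<alpha> * Ln (1 + t)) * exp (- (1/2 + \<mu>) * Ln (1 - t))))"
    unfolding legendre_Q_def z_def[symmetric] pw hyp two using znz by (simp add: P_def powr_def \<alpha>_def)
  also have "\<dots> = legendre_Q_bv \<nu> \<mu> \<tau> \<theta>"
    unfolding key legendre_Q_bv_def csq two F_def[symmetric] by (simp add: P_def mult_ac)
  finally show ?thesis .
qed

section \<open>Boundary values on (-1,1) and continuation to D1\<close>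

lemma half_plane_islimpt:
  assumes "s = 1 \<or> s = - 1"
  shows "complex_of_real x islimpt {z. s * Im z > 0}"
  unfolding islimpt_approachable
proof safe
  fix e :: real assume "e > 0"
  then show "\<exists>x'\<in>{z. s * Im z > 0}. x' \<noteq> complex_of_real x \<and> dist x' (complex_of_real x) < e"
    using assms by (intro bexI[of _ "of_real x + of_real (s * e / 2) * \<i>"]) (auto simp: dist_norm norm_mult complex_eq_iff)
qed

text \<open>Inside the half plane \<open>legendre_Q\<close> coincides with
  \<open>legendre_Q_bv\<close> composed with \<open>Arccos\<close>, and the latter is continuous at
  x itself, so the one-sided limit is a value.\<close>

lemma legendre_Q_Lim:
  assumes c: "\<nu> + 3/2 \<notin> \<int>\<^sub>\<le>\<^sub>0" and s: "s = 1 \<or> s = - 1" and x: "-1 < x" "x < 1"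
  shows "Lim (at (complex_of_real x) within {z. s * Im z > 0}) (legendre_Q \<nu> \<mu>)
    = legendre_Q_bv \<nu> \<mu> (of_real s) (Arccos (of_real x))"
proof (rule tendsto_Lim)
  show "\<not> trivial_limit (at (complex_of_real x) within {z. s * Im z > 0})"
    using half_plane_islimpt[OF s] by (simp add: trivial_limit_within)
  have \<tau>: "complex_of_real s = 1 \<or> complex_of_real s = - 1" using s by auto
  have xD: "of_real x \<in> D1" using x by (simp add: D1_iff)
  have "(\<lambda>z. legendre_Q_bv \<nu> \<mu> (of_real s) (Arccos z)) \<midarrow>of_real x\<rightarrow> legendre_Q_bv \<nu> \<mu> (of_real s) (Arccos (of_real x))"
  proof (rule isContD, rule isCont_o2[where f = Arccos])
    show "isCont Arccos (of_real x)" using xD by (intro isCont_Arccos) (simp add: D1_iff)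
    show "isCont (legendre_Q_bv \<nu> \<mu> (of_real s)) (Arccos (of_real x))"
      using holomorphic_on_imp_continuous_on[OF legendre_Q_bv_holomorphic[OF c \<tau>]] open_strip Arccos_in_strip[OF xD]
      by (simp add: continuous_on_eq_continuous_at)
  qed
  then have "((\<lambda>z. legendre_Q_bv \<nu> \<mu> (of_real s) (Arccos z)) \<longlongrightarrow> legendre_Q_bv \<nu> \<mu> (of_real s) (Arccos (of_real x)))
     (at (of_real x) within {z. s * Im z > 0})"
    by (rule tendsto_within_subset) simp
  moreover have "\<forall>\<^sub>F z in at (of_real x) within {z. s * Im z > 0}.
     legendre_Q_bv \<nu> \<mu> (of_real s) (Arccos z) = legendre_Q \<nu> \<mu> z"
    unfolding eventually_at_filter
  proof (rule always_eventually, safe)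
    fix z :: complex assume z: "s * Im z > 0"
    then have "z \<in> D1" by (auto simp: D1_iff)
    then show "legendre_Q_bv \<nu> \<mu> (of_real s) (Arccos z) = legendre_Q \<nu> \<mu> z"
      using legendre_Q_cos[OF c \<tau> Arccos_in_strip, of z \<mu>] z by simp
  qed
  ultimately show "(legendre_Q \<nu> \<mu> \<longlongrightarrow> legendre_Q_bv \<nu> \<mu> (of_real s) (Arccos (of_real x)))
     (at (complex_of_real x) within {z. s * Im z > 0})"
    by (rule Lim_transform_eventually)
qed

definition ferrers_Q_strip :: "complex \<Rightarrow> complex \<Rightarrow> complex \<Rightarrow> complex" where
  "ferrers_Q_strip \<nu> \<mu> \<theta> =
     (exp (- (\<i> * pi * \<mu> / 2)) * exp (- (\<i> * pi * \<mu>)) * legendre_Q_bv \<nu> \<mu> 1 \<theta>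
      + exp (\<i> * pi * \<mu> / 2) * exp (- (\<i> * pi * \<mu>)) * legendre_Q_bv \<nu> \<mu> (- 1) \<theta>) / 2"

lemma ferrers_Q_real_eq:
  assumes c: "\<nu> + 3/2 \<notin> \<int>\<^sub>\<le>\<^sub>0" and x: "-1 < x" "x < 1"
  shows "ferrers_Q_real \<nu> \<mu> x = ferrers_Q_strip \<nu> \<mu> (Arccos (of_real x))"
  using legendre_Q_Lim[OF c _ x, of 1 \<mu>] legendre_Q_Lim[OF c _ x, of "- 1" \<mu>]
  by (simp add: ferrers_Q_real_def ferrers_Q_strip_def legendre_Q_upper_def legendre_Q_lower_def)

lemma D1_analytic_unique:
  assumes "f holomorphic_on D1" "g holomorphic_on D1"
    and eq: "\<And>x::real. -1 < x \<Longrightarrow> x < 1 \<Longrightarrow> f (of_real x) = g (of_real x)" and w: "w \<in> D1"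
  shows "f w = g w"
proof -
  have "f w - g w = 0"
  proof (rule analytic_continuation[of "\<lambda>z. f z - g z" D1 "complex_of_real ` {-1<..<1}" 0 w])
    show "(0::complex) islimpt complex_of_real ` {-1<..<1}"
      unfolding islimpt_approachable
    proof safe
      fix e :: real assume "e > 0"
      then show "\<exists>x'\<in>complex_of_real ` {-1<..<1}. x' \<noteq> 0 \<and> dist x' 0 < e"
        by (intro bexI[of _ "of_real (min (1/2) (e/2))"]) (auto simp: dist_norm intro!: imageI)
    qed
  qed (use assms open_D1 connected_D1 in \<open>auto simp: D1_iff intro!: holomorphic_intros\<close>)
  then show ?thesis by simp
qed

text \<open>The composition with \<open>Arccos\<close> is holomorphic on D1 and has the prescribed
  values on the interval, so it is a witness for the choice in \<open>ferrers_Q\<close>; the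
  interval accumulates at 0 and determines the continuation.\<close>

lemma ferrers_Q_eq:
  assumes c: "\<nu> + 3/2 \<notin> \<int>\<^sub>\<le>\<^sub>0" and x: "x \<in> D1"
  shows "ferrers_Q \<nu> \<mu> x = ferrers_Q_strip \<nu> \<mu> (Arccos x)"
proof -
  define P where "P = (\<lambda>f. f holomorphic_on D1 \<and>
     (\<forall>x::real. -1 < x \<and> x < 1 \<longrightarrow> f (of_real x) = ferrers_Q_real \<nu> \<mu> x))"
  have holo: "ferrers_Q_strip \<nu> \<mu> holomorphic_on strip"
    unfolding ferrers_Q_strip_def [abs_def]
    by (intro holomorphic_intros legendre_Q_bv_holomorphic[OF c]) auto
  have "(ferrers_Q_strip \<nu> \<mu> \<circ> Arccos) holomorphic_on D1"
    by (rule holomorphic_on_compose_gen[OF holomorphic_on_Arccos holo])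
       (use Arccos_in_strip in \<open>auto simp: D1_iff\<close>)
  then have P1: "P (\<lambda>x. ferrers_Q_strip \<nu> \<mu> (Arccos x))"
    using ferrers_Q_real_eq[OF c] by (simp add: P_def o_def)
  then have P2: "P (ferrers_Q \<nu> \<mu>)" unfolding ferrers_Q_def P_def[symmetric] by (rule someI[of P])
  show ?thesis
    by (rule D1_analytic_unique[OF _ _ _ x]) (use P1 P2 in \<open>auto simp: P_def\<close>)
qed

text \<open>Since a + b = 1, the number c - a - b + 1 in \<open>hyp2F1_one_minus\<close> is c again.
  Euler's transformation therefore turns the second solution back into F at the same parameters,
  with w / (1 - w) raised to the power \<nu> + 1/2 in front, and the reflection formula reduces its
  four Gamma factors to cosines.\<close>

lemma hyp2F1_cot_arg_connection:
  fixes \<nu> \<mu> \<sigma> \<theta> :: complex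
  assumes \<nu>: "\<nu> + 1/2 \<notin> \<int>" and \<sigma>: "\<sigma> = 1 \<or> \<sigma> = -1" and \<theta>: "\<theta> \<in> strip"
  defines "F \<equiv> hyp2F1 (1/2 + \<mu>) (1/2 - \<mu>)"
  shows "F (\<nu> + 3/2) (cot_arg (- \<sigma>) \<theta>) =
    Gamma (\<nu> + 3/2) * Gamma (\<nu> + 1/2) * rGamma (\<nu> - \<mu> + 1) * rGamma (\<nu> + \<mu> + 1) * F (1/2 - \<nu>) (cot_arg \<sigma> \<theta>)
    - cos (pi * \<mu>) / cos (pi * \<nu>) * exp ((\<nu> + 1/2) * (\<sigma> * (\<i> * pi - 2 * \<i> * \<theta>))) * F (\<nu> + 3/2) (cot_arg \<sigma> \<theta>)"
proof -
  define w where "w = cot_arg \<sigma> \<theta>"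
  have c: "\<nu> + 3/2 \<notin> \<int>"
    using not_Int_add_of_nat[OF \<nu>, of 1] by (simp add: add.assoc)
  have w: "w \<in> two_slit_plane" unfolding w_def by (rule cot_arg_two_slit_plane[OF \<sigma> \<theta>])
  have \<sigma>': "- \<sigma> = 1 \<or> - \<sigma> = -1" using \<sigma> by auto
  have eqs: "\<nu> + 3/2 - (1/2 + \<mu>) = \<nu> - \<mu> + 1" "\<nu> + 3/2 - (1/2 - \<mu>) = \<nu> + \<mu> + 1"
    "(1/2 + \<mu>) + (1/2 - \<mu>) - (\<nu> + 3/2) + 1 = 1/2 - \<nu>"
    "(1/2 + \<mu>) + (1/2 - \<mu>) - (\<nu> + 3/2) = 1 - (\<nu> + 3/2)"
    by simp_all
  have e: "\<nu> + 3/2 - (1/2 + \<mu>) - (1/2 - \<mu>) = \<nu> + 1/2" "\<nu> + 1/2 + 1 = \<nu> + 3/2" by simp_all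
  \<comment> \<open>The terms ln 2 and Ln (sin \<theta>) are common to both logarithms and
    cancel.\<close>
  have L: "Ln w - Ln (1 - w) = \<sigma> * (\<i> * pi - 2 * \<i> * \<theta>)"
  proof -
    have "Ln w = \<sigma> * (\<i> * (pi / 2) - \<i> * \<theta>) - ln 2 - Ln (sin \<theta>)"
      unfolding w_def by (rule Ln_eqI(1)[OF cot_arg_strip[OF \<sigma> \<theta>]])
    moreover have "Ln (1 - w) = - \<sigma> * (\<i> * (pi / 2) - \<i> * \<theta>) - ln 2 - Ln (sin \<theta>)"
      unfolding w_def cot_arg_minus[symmetric] by (rule Ln_eqI(1)[OF cot_arg_strip[OF \<sigma>' \<theta>]])
    ultimately show ?thesis by (simp only:) (simp add: algebra_simps)
  qed
  note wD = two_slit_planeD[OF w]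
  have eul: "w powr (\<nu> + 1/2) * hyp2F1 (\<nu> - \<mu> + 1) (\<nu> + \<mu> + 1) (\<nu> + 3/2) w
     = exp ((\<nu> + 1/2) * (\<sigma> * (\<i> * pi - 2 * \<i> * \<theta>))) * F (\<nu> + 3/2) w"
  proof -
    have "F (\<nu> + 3/2) w = (1 - w) powr (\<nu> + 1/2) * hyp2F1 (\<nu> - \<mu> + 1) (\<nu> + \<mu> + 1) (\<nu> + 3/2) w"
      using hyp2F1_euler[OF not_Int_imp_not_nonpos_Int[OF c] wD(1), of "1/2 + \<mu>" "1/2 - \<mu>"]
      unfolding e(1) unfolding eqs(1,2) F_def .
    then show ?thesis
      using wD unfolding L[symmetric] by (simp add: powr_def right_diff_distrib exp_diff)
  qed
  have "Gamma (\<nu> + 3/2) * Gamma (1 - (\<nu> + 3/2)) * rGamma (1/2 + \<mu>) * rGamma (1/2 - \<mu>)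
      = - (cos (pi * \<mu>) / cos (pi * \<nu>))"
  proof -
    have "Gamma (\<nu> + 3/2) * Gamma (1 - (\<nu> + 3/2)) = of_real pi / sin (of_real pi * (\<nu> + 3/2))"
      by (rule Gamma_reflection_complex)
    also have "sin (of_real pi * (\<nu> + 3/2)) = - cos (pi * \<nu>)"
    proof -
      have "sin (of_real pi * (\<nu> + 3/2)) = sin (of_real pi * \<nu> + of_real (pi / 2) + of_real pi)"
        by (rule arg_cong[of _ _ sin]) (simp add: algebra_simps)
      then show ?thesis by (simp add: sin_add cos_add sin_of_real cos_of_real del: of_real_divide)
    qed
    finally have 1: "Gamma (\<nu> + 3/2) * Gamma (1 - (\<nu> + 3/2)) = of_real pi / - cos (pi * \<nu>)" .
    have "rGamma (1/2 + \<mu>) * rGamma (1 - (1/2 + \<mu>)) = sin (of_real pi * (1/2 + \<mu>)) / of_real pi"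
      by (rule rGamma_reflection_complex)
    also have "sin (of_real pi * (1/2 + \<mu>)) = cos (pi * \<mu>)"
    proof -
      have "sin (of_real pi * (1/2 + \<mu>)) = sin (of_real (pi / 2) + of_real pi * \<mu>)"
        by (rule arg_cong[of _ _ sin]) (simp add: algebra_simps)
      then show ?thesis by (simp add: sin_add sin_of_real cos_of_real del: of_real_divide)
    qed
    finally have 2: "rGamma (1/2 + \<mu>) * rGamma (1/2 - \<mu>) = cos (pi * \<mu>) / of_real pi" by simp
    show ?thesis unfolding mult.assoc[of _ "rGamma (1/2 + \<mu>)"] 1 2 by simp
  qed
  moreover have "F (\<nu> + 3/2) (1 - w) =
     Gamma (\<nu> + 3/2) * Gamma (\<nu> + 1/2) * rGamma (\<nu> - \<mu> + 1) * rGamma (\<nu> + \<mu> + 1) * F (1/2 - \<nu>) w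
     + Gamma (\<nu> + 3/2) * Gamma (1 - (\<nu> + 3/2)) * rGamma (1/2 + \<mu>) * rGamma (1/2 - \<mu>)
         * (w powr (\<nu> + 1/2) * hyp2F1 (\<nu> - \<mu> + 1) (\<nu> + \<mu> + 1) (\<nu> + 3/2) w)"
    using hyp2F1_one_minus[OF c _ w, of "1/2 + \<mu>" "1/2 - \<mu>"] \<nu>
    unfolding e(1) unfolding eqs(3) unfolding eqs(1,2,4) e(2) F_def by blast
  ultimately show ?thesis
    unfolding cot_arg_minus w_def[symmetric] eul by (simp add: mult.assoc)
qed

text \<open>The average is T(\<sigma>) + T(- \<sigma>) up to a common factor. The second term
  involves F at 1 - w, where w = \<open>cot_arg \<sigma> \<theta>\<close>, and is expanded by
  \<open>hyp2F1_cot_arg_connection\<close>; part of it merges with T(\<sigma>) and produces the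
  factor with the cosines.\<close>

lemma ferrers_Q_strip_eq:
  fixes \<nu> \<mu> \<sigma> \<theta> :: complex
  assumes \<nu>\<mu>: "\<nu> + \<mu> + 1 \<notin> \<int>\<^sub>\<le>\<^sub>0" and \<nu>: "\<nu> + 1/2 \<notin> \<int>" and \<sigma>: "\<sigma> = 1 \<or> \<sigma> = -1" and \<theta>: "\<theta> \<in> strip"
  shows "ferrers_Q_strip \<nu> \<mu> \<theta> =
        complex_of_real (sqrt pi) / (2 powr (3/2) * csqrt (sin \<theta>)) *
        (exp (\<sigma> * (\<i> * pi / 2) * (\<mu> + 1/2)) * (Gamma (\<nu> + 1/2) * rGamma (\<nu> - \<mu> + 1))
           * exp (\<sigma> * \<i> * (\<nu> + 1/2) * \<theta>)
           * hyp2F1 (1/2 + \<mu>) (1/2 - \<mu>) (1/2 - \<nu>) (1/2 + \<sigma> * (\<i> / 2) * cot \<theta>)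
         + exp (- \<sigma> * (\<i> * pi / 2) * (\<mu> + 1/2)) * (Gamma (\<nu> + \<mu> + 1) * rGamma (\<nu> + 3/2))
           * (1 + exp (\<sigma> * \<i> * pi * (\<nu> + \<mu>)) * (cos (pi * \<mu>) / cos (pi * \<nu>)))
           * exp (- \<sigma> * \<i> * (\<nu> + 1/2) * \<theta>)
           * hyp2F1 (1/2 + \<mu>) (1/2 - \<mu>) (\<nu> + 3/2) (1/2 + \<sigma> * (\<i> / 2) * cot \<theta>))"
proof -
  define K where "K = complex_of_real (sqrt pi) / (2 powr (3/2) * csqrt (sin \<theta>))"
  define G where "G = Gamma (\<nu> + \<mu> + 1) * rGamma (\<nu> + 3/2)"
  define F where "F = hyp2F1 (1/2 + \<mu>) (1/2 - \<mu>)"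
  define \<epsilon> where "\<epsilon> \<tau> = exp (\<tau> * (\<i> * pi / 2) * (\<mu> + 1/2))" for \<tau> :: complex
  define \<phi> where "\<phi> \<tau> = exp (\<tau> * \<i> * (\<nu> + 1/2) * \<theta>)" for \<tau> :: complex
  define R where "R = exp ((\<nu> + 1/2) * (\<sigma> * (\<i> * pi - 2 * \<i> * \<theta>)))"
  define Q where "Q = cos (pi * \<mu>) / cos (pi * \<nu>)"
  define T where "T \<tau> = \<epsilon> (- \<tau>) * \<phi> (- \<tau>) * F (\<nu> + 3/2) (cot_arg \<tau> \<theta>)" for \<tau>
  have c: "\<nu> + 3/2 \<notin> \<int>\<^sub>\<le>\<^sub>0"
    using not_Int_add_of_nat[OF \<nu>, of 1] by (intro not_Int_imp_not_nonpos_Int) (simp add: add.assoc)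
  have two: "2 powr (3/2) = 2 * (2 powr (1/2) :: complex)"
  proof -
    have "(2 :: complex) powr (3/2) = exp (Ln 2 + 1/2 * Ln 2)" by (simp add: powr_def)
    then show ?thesis unfolding exp_add by (simp add: powr_def)
  qed
  \<comment> \<open>The phases exp (i pi \<mu>) and exp (- i pi \<mu>) cancel, and the 2 of the
    average turns 2 powr (1/2) into 2 powr (3/2).\<close>
  have half: "exp (- \<tau> * (\<i> * pi * \<mu> / 2)) * exp (- (\<i> * pi * \<mu>)) * legendre_Q_bv \<nu> \<mu> \<tau> \<theta> / 2 = K * G * T \<tau>" for \<tau>
  proof -
    have 1: "exp (- \<tau> * (\<i> * pi * \<mu> / 2)) * exp (- \<tau> * (\<i> * pi / 4)) = \<epsilon> (- \<tau>)"
      unfolding \<epsilon>_def exp_add[symmetric] by (rule arg_cong[of _ _ exp]) (simp add: field_simps)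
    have 2: "exp (- (\<i> * pi * \<mu>)) * exp (\<i> * pi * \<mu>) = 1" by (simp flip: exp_add)
    have 3: "exp (- \<tau> * \<i> * (\<nu> + 1/2) * \<theta>) = \<phi> (- \<tau>)" by (simp add: \<phi>_def)
    have "exp (- \<tau> * (\<i> * pi * \<mu> / 2)) * exp (- (\<i> * pi * \<mu>)) * legendre_Q_bv \<nu> \<mu> \<tau> \<theta> / 2
      = (exp (- (\<i> * pi * \<mu>)) * exp (\<i> * pi * \<mu>)) * (exp (- \<tau> * (\<i> * pi * \<mu> / 2)) * exp (- \<tau> * (\<i> * pi / 4)))
         * (K * G * \<phi> (- \<tau>) * F (\<nu> + 3/2) (cot_arg \<tau> \<theta>))"
      unfolding legendre_Q_bv_def 3 K_def two G_def F_def by (simp add: mult_ac)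
    then show ?thesis unfolding 1 2 T_def by (simp add: mult_ac)
  qed
  have "ferrers_Q_strip \<nu> \<mu> \<theta> = K * G * (T 1 + T (- 1))"
    using half[of 1] half[of "- 1"] by (simp add: ferrers_Q_strip_def add_divide_distrib distrib_left)
  also have "T 1 + T (- 1) = T \<sigma> + T (- \<sigma>)" using \<sigma> by (auto simp: add.commute)
  also have "T (- \<sigma>) = \<epsilon> \<sigma> * \<phi> \<sigma> * (Gamma (\<nu> + 3/2) * Gamma (\<nu> + 1/2) * rGamma (\<nu> - \<mu> + 1) * rGamma (\<nu> + \<mu> + 1) * F (1/2 - \<nu>) (cot_arg \<sigma> \<theta>)
      - Q * R * F (\<nu> + 3/2) (cot_arg \<sigma> \<theta>))"
    using hyp2F1_cot_arg_connection[OF \<nu> \<sigma> \<theta>, of \<mu>] by (simp add: T_def F_def Q_def R_def)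
  also have "K * G * (T \<sigma> + \<dots>) = K * (\<epsilon> \<sigma> * (G * (Gamma (\<nu> + 3/2) * rGamma (\<nu> + \<mu> + 1)) * (Gamma (\<nu> + 1/2) * rGamma (\<nu> - \<mu> + 1)))
           * \<phi> \<sigma> * F (1/2 - \<nu>) (cot_arg \<sigma> \<theta>)
        + G * (T \<sigma> - (\<epsilon> \<sigma> * \<phi> \<sigma> * R) * Q * F (\<nu> + 3/2) (cot_arg \<sigma> \<theta>)))"
    by (simp add: algebra_simps)
  \<comment> \<open>The condition on \<nu> + \<mu> enters here: neither Gamma function has a pole,
    so each cancels against its reciprocal.\<close>
  also have "G * (Gamma (\<nu> + 3/2) * rGamma (\<nu> + \<mu> + 1)) = 1"
  proof -
    have "Gamma (\<nu> + \<mu> + 1) * rGamma (\<nu> + \<mu> + 1) = 1" "Gamma (\<nu> + 3/2) * rGamma (\<nu> + 3/2) = 1"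
      using \<nu>\<mu> c by (simp_all add: Gamma_def rGamma_eq_zero_iff)
    then show ?thesis unfolding G_def by (metis mult.commute mult.left_commute mult_1)
  qed
  \<comment> \<open>The exponents differ by \<sigma> i pi, which supplies the minus sign; it cancels
    the one in front of the quotient of cosines.\<close>
  also have "\<epsilon> \<sigma> * \<phi> \<sigma> * R = - (\<epsilon> (- \<sigma>) * \<phi> (- \<sigma>) * exp (\<sigma> * \<i> * pi * (\<nu> + \<mu>)))"
  proof -
    have "\<epsilon> \<sigma> * \<phi> \<sigma> * R = \<epsilon> (- \<sigma>) * \<phi> (- \<sigma>) * exp (\<sigma> * \<i> * pi * (\<nu> + \<mu>)) * exp (\<i> * \<sigma> * pi)"
      unfolding \<epsilon>_def \<phi>_def R_def exp_add[symmetric] by (rule arg_cong[of _ _ exp]) (simp add: field_simps)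
    then show ?thesis unfolding exp_ii_sign(4)[OF \<sigma>] by simp
  qed
  also have "G * (T \<sigma> - - (\<epsilon> (- \<sigma>) * \<phi> (- \<sigma>) * exp (\<sigma> * \<i> * pi * (\<nu> + \<mu>))) * Q * F (\<nu> + 3/2) (cot_arg \<sigma> \<theta>))
     = \<epsilon> (- \<sigma>) * G * (1 + exp (\<sigma> * \<i> * pi * (\<nu> + \<mu>)) * Q) * \<phi> (- \<sigma>) * F (\<nu> + 3/2) (cot_arg \<sigma> \<theta>)"
    unfolding T_def by (simp add: algebra_simps)
  finally show ?thesis
    unfolding K_def G_def F_def \<epsilon>_def \<phi>_def Q_def cot_arg_def by simp
qed

theorem theorem5p1:
  fixes \<nu> \<mu> :: complex and \<sigma> :: complex
  assumes "\<And>n::nat. n \<ge> 1 \<Longrightarrow> \<nu> + \<mu> \<noteq> - of_nat n"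
    and "\<nu> + 1/2 \<notin> \<int>"
    and sign: "\<sigma> = 1 \<or> \<sigma> = -1"
  shows
    "(\<forall>x \<in> D1. ferrers_Q \<nu> \<mu> x =
        complex_of_real (sqrt pi) / (2 powr (3/2) * (1 - x\<^sup>2) powr (1/4)) *
        (exp (\<sigma> * (\<i> * pi / 2) * (\<mu> + 1/2)) * (Gamma (\<nu> + 1/2) * rGamma (\<nu> - \<mu> + 1))
           * (x + \<sigma> * \<i> * csqrt (1 - x\<^sup>2)) powr (\<nu> + 1/2)
           * hyp2F1 (1/2 + \<mu>) (1/2 - \<mu>) (1/2 - \<nu>)
               ((- \<sigma> * x + \<i> * csqrt (1 - x\<^sup>2)) / (2 * \<i> * csqrt (1 - x\<^sup>2)))
         + exp (- \<sigma> * (\<i> * pi / 2) * (\<mu> + 1/2)) * (Gamma (\<nu> + \<mu> + 1) * rGamma (\<nu> + 3/2))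
           * (1 + exp (\<sigma> * \<i> * pi * (\<nu> + \<mu>)) * (cos (pi * \<mu>) / cos (pi * \<nu>)))
           * (x - \<sigma> * \<i> * csqrt (1 - x\<^sup>2)) powr (\<nu> + 1/2)
           * hyp2F1 (1/2 + \<mu>) (1/2 - \<mu>) (\<nu> + 3/2)
               ((- \<sigma> * x + \<i> * csqrt (1 - x\<^sup>2)) / (2 * \<i> * csqrt (1 - x\<^sup>2)))))
     \<and>
     (\<forall>\<theta>::complex. 0 < Re \<theta> \<and> Re \<theta> < pi \<longrightarrow> ferrers_Q \<nu> \<mu> (cos \<theta>) =
        complex_of_real (sqrt pi) / (2 powr (3/2) * csqrt (sin \<theta>)) *
        (exp (\<sigma> * (\<i> * pi / 2) * (\<mu> + 1/2)) * (Gamma (\<nu> + 1/2) * rGamma (\<nu> - \<mu> + 1))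
           * exp (\<sigma> * \<i> * (\<nu> + 1/2) * \<theta>)
           * hyp2F1 (1/2 + \<mu>) (1/2 - \<mu>) (1/2 - \<nu>) (1/2 + \<sigma> * (\<i> / 2) * cot \<theta>)
         + exp (- \<sigma> * (\<i> * pi / 2) * (\<mu> + 1/2)) * (Gamma (\<nu> + \<mu> + 1) * rGamma (\<nu> + 3/2))
           * (1 + exp (\<sigma> * \<i> * pi * (\<nu> + \<mu>)) * (cos (pi * \<mu>) / cos (pi * \<nu>)))
           * exp (- \<sigma> * \<i> * (\<nu> + 1/2) * \<theta>)
           * hyp2F1 (1/2 + \<mu>) (1/2 - \<mu>) (\<nu> + 3/2) (1/2 + \<sigma> * (\<i> / 2) * cot \<theta>)))"
proof (intro conjI ballI allI impI)
  have \<nu>\<mu>: "\<nu> + \<mu> + 1 \<notin> \<int>\<^sub>\<le>\<^sub>0"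
  proof
    assume "\<nu> + \<mu> + 1 \<in> \<int>\<^sub>\<le>\<^sub>0"
    then obtain n where "\<nu> + \<mu> + 1 = - of_nat n" by (auto elim: nonpos_Ints_cases')
    then have "\<nu> + \<mu> = - of_nat (Suc n)" by (simp add: algebra_simps eq_neg_iff_add_eq_0)
    then show False using assms(1)[of "Suc n"] by simp
  qed
  have c: "\<nu> + 3/2 \<notin> \<int>\<^sub>\<le>\<^sub>0"
    using not_Int_add_of_nat[OF assms(2), of 1] by (intro not_Int_imp_not_nonpos_Int) (simp add: add.assoc)
  have trig: "ferrers_Q \<nu> \<mu> (cos \<theta>) = ferrers_Q_strip \<nu> \<mu> \<theta>" if "\<theta> \<in> strip" for \<theta>
    using ferrers_Q_eq[OF c cos_strip_in_D1[OF that]] by (simp add: Arccos_cos_strip[OF that])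
  note eq = ferrers_Q_strip_eq[OF \<nu>\<mu> assms(2) sign]
  {
    fix \<theta> :: complex assume "0 < Re \<theta> \<and> Re \<theta> < pi"
    then have "\<theta> \<in> strip" by (simp add: strip_def)
    then show "ferrers_Q \<nu> \<mu> (cos \<theta>) =
        complex_of_real (sqrt pi) / (2 powr (3/2) * csqrt (sin \<theta>)) *
        (exp (\<sigma> * (\<i> * pi / 2) * (\<mu> + 1/2)) * (Gamma (\<nu> + 1/2) * rGamma (\<nu> - \<mu> + 1))
           * exp (\<sigma> * \<i> * (\<nu> + 1/2) * \<theta>)
           * hyp2F1 (1/2 + \<mu>) (1/2 - \<mu>) (1/2 - \<nu>) (1/2 + \<sigma> * (\<i> / 2) * cot \<theta>)
         + exp (- \<sigma> * (\<i> * pi / 2) * (\<mu> + 1/2)) * (Gamma (\<nu> + \<mu> + 1) * rGamma (\<nu> + 3/2))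
           * (1 + exp (\<sigma> * \<i> * pi * (\<nu> + \<mu>)) * (cos (pi * \<mu>) / cos (pi * \<nu>)))
           * exp (- \<sigma> * \<i> * (\<nu> + 1/2) * \<theta>)
           * hyp2F1 (1/2 + \<mu>) (1/2 - \<mu>) (\<nu> + 3/2) (1/2 + \<sigma> * (\<i> / 2) * cot \<theta>))"
      unfolding trig[OF \<open>\<theta> \<in> strip\<close>] by (rule eq)
  next
    fix x assume x: "x \<in> D1"
    \<comment> \<open>The algebraic form is the trigonometric one at \<theta> = Arccos x; only the
      branches of the roots and powers have to be matched.\<close>
    define \<theta> where "\<theta> = Arccos x"
    have \<theta>: "\<theta> \<in> strip" unfolding \<theta>_def by (rule Arccos_in_strip[OF x])
    have cos: "cos \<theta> = x" by (simp add: \<theta>_def)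
    note L = sin_strip[OF \<theta>]
    have "1 - x\<^sup>2 = (sin \<theta>)\<^sup>2" unfolding cos[symmetric] by (simp add: sin_squared_eq)
    moreover have "csqrt ((sin \<theta>)\<^sup>2) = sin \<theta>"
      by (rule csqrt_square) (use Re_sin_pos[OF \<theta>] in auto)
    ultimately have s: "csqrt (1 - x\<^sup>2) = sin \<theta>" by simp
    \<comment> \<open>As the argument of sin \<theta> is below pi / 2 in modulus, doubling Ln (sin
      \<theta>) gives the principal logarithm of 1 - x^2.\<close>
    have p4: "(1 - x\<^sup>2) powr (1/4) = csqrt (sin \<theta>)"
    proof -
      have "(1 - x\<^sup>2) powr (1/4) = exp (1/4 * (2 * Ln (sin \<theta>)))"
        unfolding \<open>1 - x\<^sup>2 = (sin \<theta>)\<^sup>2\<close>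
        by (rule Ln_eqI(3)) (use L in \<open>auto simp: exp_double\<close>)
      then show ?thesis using L(1) by (simp add: csqrt_exp_Ln)
    qed
    have pow: "(x + \<sigma> * \<i> * csqrt (1 - x\<^sup>2)) powr (\<nu> + 1/2) = exp (\<sigma> * \<i> * (\<nu> + 1/2) * \<theta>)"
      "(x - \<sigma> * \<i> * csqrt (1 - x\<^sup>2)) powr (\<nu> + 1/2) = exp (- \<sigma> * \<i> * (\<nu> + 1/2) * \<theta>)"
    proof -
      \<comment> \<open>The imaginary part is Re \<theta> up to sign, so the exponents are principal
        logarithms of x + \<sigma> i sin \<theta> and x - \<sigma> i sin \<theta>.\<close>
      have Im: "\<bar>Im (\<i> * \<sigma> * \<theta>)\<bar> < pi" "\<bar>Im (- (\<i> * \<sigma> * \<theta>))\<bar> < pi"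
        using \<theta> sign by (auto simp: strip_def)
      show "(x + \<sigma> * \<i> * csqrt (1 - x\<^sup>2)) powr (\<nu> + 1/2) = exp (\<sigma> * \<i> * (\<nu> + 1/2) * \<theta>)"
        unfolding s unfolding cos[symmetric]
        using Ln_eqI(3)[OF exp_ii_sign(1)[OF sign] Im(1), of "\<nu> + 1/2"] by (simp add: mult_ac)
      show "(x - \<sigma> * \<i> * csqrt (1 - x\<^sup>2)) powr (\<nu> + 1/2) = exp (- \<sigma> * \<i> * (\<nu> + 1/2) * \<theta>)"
        unfolding s unfolding cos[symmetric]
        using Ln_eqI(3)[OF exp_ii_sign(2)[OF sign] Im(2), of "\<nu> + 1/2"] by (simp add: mult_ac)
    qed
    have arg: "(- \<sigma> * x + \<i> * csqrt (1 - x\<^sup>2)) / (2 * \<i> * csqrt (1 - x\<^sup>2)) = 1/2 + \<sigma> * (\<i> / 2) * cot \<theta>"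
      unfolding s unfolding cos[symmetric] cot_def using L(1) by (simp add: field_simps)
    show "ferrers_Q \<nu> \<mu> x =
        complex_of_real (sqrt pi) / (2 powr (3/2) * (1 - x\<^sup>2) powr (1/4)) *
        (exp (\<sigma> * (\<i> * pi / 2) * (\<mu> + 1/2)) * (Gamma (\<nu> + 1/2) * rGamma (\<nu> - \<mu> + 1))
           * (x + \<sigma> * \<i> * csqrt (1 - x\<^sup>2)) powr (\<nu> + 1/2)
           * hyp2F1 (1/2 + \<mu>) (1/2 - \<mu>) (1/2 - \<nu>)
               ((- \<sigma> * x + \<i> * csqrt (1 - x\<^sup>2)) / (2 * \<i> * csqrt (1 - x\<^sup>2)))
         + exp (- \<sigma> * (\<i> * pi / 2) * (\<mu> + 1/2)) * (Gamma (\<nu> + \<mu> + 1) * rGamma (\<nu> + 3/2))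
           * (1 + exp (\<sigma> * \<i> * pi * (\<nu> + \<mu>)) * (cos (pi * \<mu>) / cos (pi * \<nu>)))
           * (x - \<sigma> * \<i> * csqrt (1 - x\<^sup>2)) powr (\<nu> + 1/2)
           * hyp2F1 (1/2 + \<mu>) (1/2 - \<mu>) (\<nu> + 3/2)
               ((- \<sigma> * x + \<i> * csqrt (1 - x\<^sup>2)) / (2 * \<i> * csqrt (1 - x\<^sup>2))))"
      unfolding arg p4 pow using trig[OF \<theta>] eq[OF \<theta>] unfolding cos by simp
  }
qed

end
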